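(* Let $\xi(t)$, $t\geq0$, be a time-stable process. Then $\xi$ is identically distributed (in the sense of finite-dimensional distributions) as the sum of a deterministic linear function $t\mapsto bt$ (for some $b\in\mathbb{R}$), a centred Gaussian process with covariance function $C(t,s)$ satisfying $C(ut,us)=uC(t,s)$ for all $t,s,u\geq0$, and an independent time-stable process without Gaussian component.
   Context: For a process $\eta$ on $[0,\infty)$ and $a>0$, $(a\circ\eta)(t)=\eta(at)$. A stochastically continuous real-valued process $\xi(t)$, $t\geq0$, is called time-stable if for each integer $n\geq2$, $\xi_1+\cdots+\xi_n$ and $n\circ\xi$ have the same finite-dimensional distributions, where $\xi_1,\dots,\xi_n$ are i.i.d. copies of $\xi$. Such a process is infinitely divisible; "without Gaussian component" means its finite-dimensional (infinitely divisible) distributions have zero Gaussian part in their L\'evy--Khintchine triplets. *)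

theory Defs
  imports "HOL-Probability.Probability"
begin

text \<open>Processes are indexed by real times; only times t \<ge> 0 are relevant.
  A process on a probability space M is a family X :: real \<Rightarrow> 'a \<Rightarrow> real.\<close>

definition fdd :: "'a measure \<Rightarrow> (real \<Rightarrow> 'a \<Rightarrow> real) \<Rightarrow> nat \<Rightarrow> (nat \<Rightarrow> real)
    \<Rightarrow> (nat \<Rightarrow> real) measure" where
  "fdd M X k ts = distr M (PiM {..<k} (\<lambda>_. borel)) (\<lambda>\<omega>. \<lambda>i\<in>{..<k}. X (ts i) \<omega>)"

definition stoch_continuous :: "'a measure \<Rightarrow> (real \<Rightarrow> 'a \<Rightarrow> real) \<Rightarrow> bool" where
  "stoch_continuous M X \<longleftrightarrow>
     (\<forall>t\<ge>0. \<forall>\<epsilon>>0. ((\<lambda>s. measure M {\<omega>\<in>space M. \<bar>X s \<omega> - X t \<omega>\<bar> > \<epsilon>}) \<longlongrightarrow> 0)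
                     (at t within {0..}))"

text \<open>Time-stability. The i.i.d. copies xi_1, ..., xi_n of X are realised on the
  product space M^n as xi_i(t)(\<omega>) = X t (\<omega> i).\<close>
definition time_stable :: "'a measure \<Rightarrow> (real \<Rightarrow> 'a \<Rightarrow> real) \<Rightarrow> bool" where
  "time_stable M X \<longleftrightarrow>
     prob_space M \<and> (\<forall>t\<ge>0. X t \<in> borel_measurable M) \<and> stoch_continuous M X \<and>
     (\<forall>n::nat\<ge>2. \<forall>k ts. (\<forall>i<k. ts i \<ge> 0) \<longrightarrow>
        fdd (PiM {..<n} (\<lambda>_. M)) (\<lambda>t \<omega>. \<Sum>j<n. X t (\<omega> j)) k ts
          = fdd M X k (\<lambda>i. real n * ts i))"

definition charv :: "nat \<Rightarrow> (nat \<Rightarrow> real) measure \<Rightarrow> (nat \<Rightarrow> real) \<Rightarrow> complex" where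
  "charv k \<mu> u = integral\<^sup>L \<mu> (\<lambda>x. exp (\<i> * complex_of_real (\<Sum>i<k. u i * x i)))"

definition vnorm :: "nat \<Rightarrow> (nat \<Rightarrow> real) \<Rightarrow> real" where
  "vnorm k x = sqrt (\<Sum>i<k. (x i)\<^sup>2)"

definition levy_measure :: "nat \<Rightarrow> (nat \<Rightarrow> real) measure \<Rightarrow> bool" where
  "levy_measure k \<nu> \<longleftrightarrow>
     sets \<nu> = sets (PiM {..<k} (\<lambda>_. borel)) \<and>
     emeasure \<nu> {x\<in>space \<nu>. \<forall>i<k. x i = 0} = 0 \<and>
     (\<integral>\<^sup>+ x. ennreal (min 1 ((vnorm k x)\<^sup>2)) \<partial>\<nu>) < \<infinity>"

text \<open>A distribution on R^{0..<k} is infinitely divisible with Levy--Khintchine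
  triplet (b, 0, \<nu>), i.e. with zero Gaussian part.\<close>
definition id_no_gaussian_part :: "nat \<Rightarrow> (nat \<Rightarrow> real) measure \<Rightarrow> bool" where
  "id_no_gaussian_part k \<mu> \<longleftrightarrow>
     (\<exists>(b :: nat \<Rightarrow> real) \<nu>. levy_measure k \<nu> \<and>
        (\<forall>u. charv k \<mu> u =
           exp (\<i> * complex_of_real (\<Sum>i<k. b i * u i) +
                integral\<^sup>L \<nu> (\<lambda>x. exp (\<i> * complex_of_real (\<Sum>i<k. u i * x i)) - 1
                   - \<i> * complex_of_real ((\<Sum>i<k. u i * x i) *
                          (if vnorm k x \<le> 1 then 1 else 0))))))"

definition no_gaussian_component :: "'a measure \<Rightarrow> (real \<Rightarrow> 'a \<Rightarrow> real) \<Rightarrow> bool" where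
  "no_gaussian_component M X \<longleftrightarrow>
     (\<forall>k ts. (\<forall>i<k. ts i \<ge> 0) \<longrightarrow> id_no_gaussian_part k (fdd M X k ts))"

definition centred_normal :: "real \<Rightarrow> real measure" where
  "centred_normal v = (if v = 0 then return borel 0
                       else density lborel (normal_density 0 (sqrt v)))"

definition centred_gaussian_process ::
    "'a measure \<Rightarrow> (real \<Rightarrow> 'a \<Rightarrow> real) \<Rightarrow> (real \<Rightarrow> real \<Rightarrow> real) \<Rightarrow> bool" where
  "centred_gaussian_process M G C \<longleftrightarrow>
     prob_space M \<and> (\<forall>t\<ge>0. G t \<in> borel_measurable M) \<and>
     (\<forall>k ts (u :: nat \<Rightarrow> real). (\<forall>i<k. ts i \<ge> 0) \<longrightarrow>
        distr M borel (\<lambda>\<omega>. \<Sum>i<k. u i * G (ts i) \<omega>)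
          = centred_normal (\<Sum>i<k. \<Sum>j<k. u i * u j * C (ts i) (ts j)))"

end

theory Submission
  imports Defs
begin

text \<open>For fixed times the law of $(X(t_1),\dots,X(t_k))$ is the $n$-fold convolution of the law of
  $(X(t_1/n),\dots,X(t_k/n))$, and stochastic continuity makes its characteristic function nonzero
  with exponent $\Psi$. Weighting these $n$-th roots with $n |x|^2/(1+|x|^2)$ gives bounded, tight
  measures; a weak limit yields the Levy measure and the quadratic form $Q$ in the
  Levy--Khintchine formula for $\Psi$. Weak compactness on $R^k$ is reduced to Helly's theorem on the
  line by coding $R^k$ in a single real number with a continuous decoding.

  The form $Q$ depends only on the process, not on the chosen times: $\sqrt{n} X(t/n)$ converges in law
  to the centred Gaussian law with variance $Q$. Hence $\exp(-Q/2)$ and $\exp(\Psi + Q/2)$ are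
  consistent families of characteristic functions, the second one belonging to limits of compound
  Poisson laws, and Kolmogorov's theorem provides the independent processes $G$ and $Y$. As
  $|\exp \Psi| \le \exp(-Q/2) \le 1$, stochastic continuity passes from $X$ to $Y$. The drift is
  left inside $Y$, so that $b = 0$.\<close>

subsection \<open>Schoenberg's curve\<close>


text \<open>The matrix in the Levy--Khintchine formula comes from a subsequence chosen for one
  finite set of times, so representations at different times need not fit together; an intrinsic
  description of the Gaussian part is what makes Kolmogorov's theorem applicable. It rests on
  homogeneity: at time t/n and frequency sqrt(n) u the exponent is Psi(sqrt(n) u)/n, in which the
  drift has size 1/sqrt(n), the jump part tends to 0 and the quadratic form is unchanged.
  Homogeneity also gives C(ut,us) = u C(t,s).

  Weak convergence handles continuous integrands, whereas the truncated integrand jumps at the unit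
  sphere and, divided by |x|^2/(1+|x|^2), has in general direction-dependent limits at 0. Hence the
  linear and quadratic Taylor terms are both removed with the smooth factor 1/(1+|x|^2) and restored
  afterwards.

  Time-stability scales by integers only. Real factors are reached through continuous logarithms and
  rational approximation, and knowing the exponent along a whole ray of times fixes the branch of
  Psi(u).\<close>

definition clipped_cos :: "real \<Rightarrow> real" where
  "clipped_cos x = max 0 (min 1 (1/2 - cos (pi * x)))"

lemma clipped_cos_bounds: "0 \<le> clipped_cos x" "clipped_cos x \<le> 1"
  by (auto simp: clipped_cos_def)

lemma continuous_on_clipped_cos [continuous_intros]:
  "continuous_on A f \<Longrightarrow> continuous_on A (\<lambda>x::'a::t2_space. clipped_cos (f x))"
  unfolding clipped_cos_def by (intro continuous_intros)

lemma cos_shift_even_int: "cos (pi * (2 * of_int m + y)) = cos (pi * y)"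
proof -
  have "cos (pi * (2 * of_int m + y)) = cos (2 * pi * of_int m + pi * y)"
    by (simp add: algebra_simps)
  also have "\<dots> = cos (pi * y)"
    using cos_int_2pin[of m] sin_int_2pin[of m]
    by (simp add: cos_add mult.commute mult.left_commute)
  finally show ?thesis .
qed

text \<open>The thresholds are cos(pi/3) = 1/2 and cos(2 pi/3) = -1/2: after clipping, 1/2 - cos(pi
  x) is flat on the two outer thirds of [0,1] and moves only in the middle third, which expansions
  with ternary digits 0 and 2 avoid.\<close>

lemma clipped_cos_eq_0:
  assumes "0 \<le> y" "y \<le> 1/3"
  shows "clipped_cos (2 * of_int m + y) = 0"
proof -
  have "cos (pi / 3) \<le> cos (pi * y)"
    using assms by (intro cos_monotone_0_pi_le) (auto simp: field_simps mult_left_le)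
  then show ?thesis
    by (simp add: clipped_cos_def cos_shift_even_int cos_60 del: distrib_left distrib_left_numeral)
qed

lemma clipped_cos_eq_1:
  assumes "0 \<le> y" "y \<le> 1/3"
  shows "clipped_cos (2 * of_int m + 2/3 + y) = 1"
proof -
  have "cos (pi * (2/3 + y)) = - cos (pi * (1/3 - y))"
    using cos_pi_minus[of "pi * (1/3 - y)"] by (simp add: algebra_simps)
  moreover have "cos (pi / 3) \<le> cos (pi * (1/3 - y))"
    using assms by (intro cos_monotone_0_pi_le) (auto simp: field_simps mult_left_le)
  ultimately have "cos (pi * (2/3 + y)) \<le> - 1/2"
    by (simp add: cos_60)
  then show ?thesis
    using cos_shift_even_int[of m "2/3 + y"]
    by (simp add: clipped_cos_def add.assoc)
qed

text \<open>Multiplication by 3^n turns the digits before position n into an integer, which is even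
  because every digit is 0 or 2, so the period 2 of \<open>clipped_cos\<close> forgets it. What
  remains is 2/3 * a n plus a tail of at most 1/3, and this lies in the flat third belonging to a
  n.\<close>

lemma clipped_cos_ternary_digit:
  fixes a :: "nat \<Rightarrow> real"
  assumes a: "\<And>j. a j \<in> {0,1}"
  shows "clipped_cos (3 ^ n * (\<Sum>j. 2 * a j / 3 ^ Suc j)) = a n"
proof -
  define f where "f j = 2 * a j / 3 ^ Suc j" for j
  have a01: "0 \<le> a j" "a j \<le> 1" for j using a[of j] by auto
  have geo: "(\<lambda>j. 2/3 * (1/3) ^ j :: real) sums 1"
    using sums_mult[OF geometric_sums[of "1/3::real"], of "2/3"] by simp
  have fle: "f j \<le> 2/3 * (1/3) ^ j" for j
    using a01[of j] by (simp add: f_def field_simps)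
  have f0: "0 \<le> f j" for j using a01[of j] by (simp add: f_def)
  have summ: "summable f"
    by (rule summable_comparison_test'[OF sums_summable[OF geo], of 0]) (use fle f0 in auto)
  define r where "r = 3 ^ n * (\<Sum>j. f (j + Suc n))"
  have summ': "summable (\<lambda>j. f (j + Suc n))" using summ by (rule summable_ignore_initial_segment)
  have r0: "0 \<le> r" unfolding r_def by (intro mult_nonneg_nonneg suminf_nonneg summ' f0) auto
  have "(\<Sum>j. f (j + Suc n)) \<le> (\<Sum>j. (1/3) ^ Suc n * (2/3 * (1/3) ^ j))"
  proof (intro suminf_le summ' summable_mult[OF sums_summable[OF geo]])
    show "f (j + Suc n) \<le> (1/3) ^ Suc n * (2/3 * (1/3) ^ j)" for j
      using fle[of "j + Suc n"] by (simp add: power_add mult_ac)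
  qed
  also have "\<dots> = (1/3) ^ Suc n"
    using sums_unique[OF sums_mult[OF geo, of "(1/3)^Suc n"]] by simp
  finally have r1: "r \<le> 1/3"
    unfolding r_def by (simp add: field_simps)
  define k :: int where "k = (\<Sum>j<n. (if a j = 1 then 1 else 0) * 3 ^ (n - 1 - j))"
  have "3 ^ n * (\<Sum>j<n. f j) = 2 * of_int k"
  proof -
    have "3 ^ n * f j = 2 * of_int ((if a j = 1 then 1 else 0) * 3 ^ (n - 1 - j))" if "j < n" for j
    proof -
      have "(3::real) ^ n = 3 ^ (n - 1 - j) * 3 ^ Suc j"
        using that by (simp flip: power_add power_Suc)
      then show ?thesis using a[of j] by (auto simp: f_def)
    qed
    then show ?thesis by (simp add: sum_distrib_left k_def)
  qed
  moreover have "3 ^ n * f n = 2/3 * a n" by (simp add: f_def)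
  moreover have "(\<Sum>j. f j) = (\<Sum>j. f (j + Suc n)) + (\<Sum>j<Suc n. f j)"
    by (rule suminf_split_initial_segment[OF summ])
  ultimately have eq: "3 ^ n * (\<Sum>j. f j) = 2 * of_int k + 2/3 * a n + r"
    by (simp add: r_def algebra_simps)
  show ?thesis
  proof (cases "a n = 0")
    case True
    then show ?thesis using clipped_cos_eq_0[OF r0 r1, of k] eq by (simp add: f_def)
  next
    case False
    then have "a n = 1" using a[of n] by simp
    then show ?thesis using clipped_cos_eq_1[OF r0 r1, of k] eq by (simp add: f_def)
  qed
qed

definition binary_digit :: "nat \<Rightarrow> real \<Rightarrow> real" where
  "binary_digit m y = of_int (\<lfloor>2 ^ Suc m * y\<rfloor> - 2 * \<lfloor>2 ^ m * y\<rfloor>)"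

lemma binary_digit_01: "binary_digit m y \<in> {0,1}"
proof -
  have "\<lfloor>2 * z\<rfloor> - 2 * \<lfloor>z\<rfloor> \<in> {0,1}" for z :: real
    by (auto simp: floor_eq_iff) linarith+
  from this[of "2 ^ m * y"] show ?thesis
    by (auto simp: binary_digit_def mult.assoc)
qed

lemma binary_digit_sums:
  assumes "0 \<le> y" "y < 1"
  shows "(\<lambda>m. binary_digit m y / 2 ^ Suc m) sums y"
proof -
  have eq: "binary_digit m y / 2 ^ Suc m = \<lfloor>2 ^ Suc m * y\<rfloor> / 2 ^ Suc m - \<lfloor>2 ^ m * y\<rfloor> / 2 ^ m" for m
    by (simp add: binary_digit_def field_simps)
  \<comment> \<open>The sum telescopes; its initial term is the floor of y, which is 0 because y
    lies in [0,1).\<close>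
  have partial: "(\<Sum>m<M. binary_digit m y / 2 ^ Suc m) = \<lfloor>2 ^ M * y\<rfloor> / 2 ^ M" for M
    unfolding eq using assms by (subst sum_lessThan_telescope) (auto simp: floor_eq_iff)
  have "(\<lambda>M. \<lfloor>2 ^ M * y\<rfloor> / 2 ^ M) \<longlonglongrightarrow> y"
  proof (rule tendsto_sandwich[of "\<lambda>M. y - (1/2) ^ M" _ _ "\<lambda>M. y"])
    show "(\<lambda>M. y - (1/2) ^ M) \<longlonglongrightarrow> y"
      using tendsto_diff[OF tendsto_const LIMSEQ_power_zero[of "1/2::real"], of y] by simp
    have "y - (1/2) ^ M \<le> \<lfloor>2 ^ M * y\<rfloor> / 2 ^ M" for M
    proof -
      have "2 ^ M * y - 1 \<le> \<lfloor>2 ^ M * y\<rfloor>" by linarith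
      then have "(2 ^ M * y - 1) / 2 ^ M \<le> \<lfloor>2 ^ M * y\<rfloor> / 2 ^ M" by (intro divide_right_mono) auto
      then show ?thesis by (simp add: diff_divide_distrib power_divide)
    qed
    then show "\<forall>\<^sub>F M in sequentially. y - (1/2) ^ M \<le> \<lfloor>2 ^ M * y\<rfloor> / 2 ^ M" by simp
    have "\<lfloor>2 ^ M * y\<rfloor> / 2 ^ M \<le> y" for M
      by (simp add: field_simps)
    then show "\<forall>\<^sub>F M in sequentially. \<lfloor>2 ^ M * y\<rfloor> / 2 ^ M \<le> y" by simp
  qed simp
  then show ?thesis unfolding sums_def partial .
qed

lemma measurable_binary_digit [measurable]: "binary_digit m \<in> borel_measurable borel"
  unfolding binary_digit_def by measurable

text \<open>Schoenberg's space-filling curve: all binary digits of all coordinates are stored in the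
  ternary digits of one real number and are read off continuously.\<close>

lemma schoenberg_curve:
  fixes I :: "'i set"
  assumes "finite I"
  obtains dec :: "'i \<Rightarrow> real \<Rightarrow> real" and enc :: "('i \<Rightarrow> real) \<Rightarrow> real"
  where "\<And>i. continuous_on UNIV (dec i)"
    and "enc \<in> borel_measurable (PiM I (\<lambda>_. borel))"
    and "\<And>x. 0 \<le> enc x" "\<And>x. enc x \<le> 1"
    and "\<And>x i. i \<in> I \<Longrightarrow> 0 \<le> x i \<Longrightarrow> x i < 1 \<Longrightarrow> dec i (enc x) = x i"
proof -
  obtain e :: "'i \<Rightarrow> nat" where e: "inj_on e I"
    using finite_imp_inj_to_nat_seg[OF assms] by auto
  \<comment> \<open>Ternary position \<open>prod_encode (e i, m)\<close> stores bit m of coordinate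
    i; positions whose first component is not the number of a coordinate store 0.\<close>
  define dec where "dec i t = (\<Sum>m. clipped_cos (3 ^ prod_encode (e i, m) * t) / 2 ^ Suc m)" for i t
  define dig where "dig x j = (if fst (prod_decode j) \<in> e ` I
      then binary_digit (snd (prod_decode j)) (x (inv_into I e (fst (prod_decode j)))) else 0)" for x j
  define enc where "enc x = (\<Sum>j. 2 * dig x j / 3 ^ Suc j)" for x
  have dig01: "dig x j \<in> {0,1}" for x j
    using binary_digit_01 by (auto simp: dig_def)
  have dig_b: "0 \<le> dig x j" "dig x j \<le> 1" for x j using dig01[of x j] by auto
  have half: "(\<lambda>m. (1/2) ^ Suc m :: real) sums 1"
    using sums_mult[OF geometric_sums[of "1/2::real"], of "1/2"] by simp
  have geo: "(\<lambda>j. 2/3 * (1/3) ^ j :: real) sums 1"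
    using sums_mult[OF geometric_sums[of "1/3::real"], of "2/3"] by simp
  have enc_le: "2 * dig x j / 3 ^ Suc j \<le> 2/3 * (1/3) ^ j" for x j
    using dig_b[of x j] by (simp add: field_simps)
  have enc_summable: "summable (\<lambda>j. 2 * dig x j / 3 ^ Suc j)" for x
    by (rule summable_comparison_test'[OF sums_summable[OF geo], of 0])
       (use enc_le dig_b in auto)
  show ?thesis
  proof
    fix i
    have "uniform_limit UNIV (\<lambda>n t. \<Sum>m<n. clipped_cos (3 ^ prod_encode (e i, m) * t) / 2 ^ Suc m) (dec i) sequentially"
      unfolding dec_def
    proof (rule Weierstrass_m_test)
      show "norm (clipped_cos (3 ^ prod_encode (e i, m) * t) / 2 ^ Suc m) \<le> (1/2) ^ Suc m" for m t
        using clipped_cos_bounds by (simp add: power_divide divide_right_mono)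
      show "summable (\<lambda>m. (1/2) ^ Suc m :: real)" by (rule sums_summable[OF half])
    qed
    then show "continuous_on UNIV (dec i)"
      by (rule uniform_limit_theorem[rotated]) (auto intro!: continuous_intros always_eventually)
  next
    have "inv_into I e p \<in> I" if "p \<in> e ` I" for p using that by (rule inv_into_into)
    then have [measurable]: "(\<lambda>x. dig x j) \<in> borel_measurable (PiM I (\<lambda>_. borel))" for j
      unfolding dig_def by (cases "fst (prod_decode j) \<in> e ` I") (simp_all, measurable)
    show "enc \<in> borel_measurable (PiM I (\<lambda>_. borel))"
      unfolding enc_def[abs_def] by measurable
  next
    fix x :: "'i \<Rightarrow> real"
    show "0 \<le> enc x" unfolding enc_def by (intro suminf_nonneg enc_summable) (simp add: dig_b)
    have "enc x \<le> (\<Sum>j. 2/3 * (1/3) ^ j)" unfolding enc_def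
      by (intro suminf_le enc_summable sums_summable[OF geo] enc_le)
    then show "enc x \<le> 1" using sums_unique[OF geo] by simp
  next
    fix x :: "'i \<Rightarrow> real" and i assume i: "i \<in> I" "0 \<le> x i" "x i < 1"
    have "clipped_cos (3 ^ prod_encode (e i, m) * enc x) = binary_digit m (x i)" for m
    proof -
      have "clipped_cos (3 ^ prod_encode (e i, m) * enc x) = dig x (prod_encode (e i, m))"
        unfolding enc_def by (rule clipped_cos_ternary_digit) (rule dig01)
      also have "\<dots> = binary_digit m (x i)"
        using i e by (simp add: dig_def)
      finally show ?thesis .
    qed
    then show "dec i (enc x) = x i"
      using sums_unique[OF binary_digit_sums[OF i(2,3)]] by (simp add: dec_def)
  qed
qed

subsection \<open>Weak compactness in several dimensions\<close>


text \<open>Each coordinate is squashed into (0,1) by arctan and the results are coded by one real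
  number in [0,1], where tightness is automatic. The decoding F is discontinuous only at codes with
  a coordinate outside (0,1), that is, at infinity before squashing; tightness of the original
  coordinates makes this set null for the limit law, so convergence on the line transfers
  back.\<close>

lemma multivariate_helly:
  fixes I :: "'i set" and \<mu> :: "nat \<Rightarrow> ('i \<Rightarrow> real) measure"
  assumes I: "finite I"
    and prob: "\<And>n. prob_space (\<mu> n)"
    and sets: "\<And>n. sets (\<mu> n) = sets (PiM I (\<lambda>_. borel))"
    and tight: "\<And>i \<epsilon>. i \<in> I \<Longrightarrow> 0 < \<epsilon> \<Longrightarrow>
      \<exists>R>0. \<forall>\<^sub>F n in sequentially. measure (\<mu> n) {x\<in>space (\<mu> n). R < \<bar>x i\<bar>} \<le> \<epsilon>"
  obtains r :: "nat \<Rightarrow> nat" and \<nu> where "strict_mono r" "prob_space \<nu>"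
    "sets \<nu> = sets (PiM I (\<lambda>_. borel))"
    "\<And>(g :: ('i \<Rightarrow> real) \<Rightarrow> complex) B. continuous_on UNIV g \<Longrightarrow> g \<in> borel_measurable (PiM I (\<lambda>_. borel)) \<Longrightarrow>
       (\<And>x. norm (g x) \<le> B) \<Longrightarrow> (\<lambda>n. \<integral>x. g x \<partial>\<mu> (r n)) \<longlonglongrightarrow> (\<integral>x. g x \<partial>\<nu>)"
proof -
  obtain dec :: "'i \<Rightarrow> real \<Rightarrow> real" and enc :: "('i \<Rightarrow> real) \<Rightarrow> real"
    where dec_cont: "\<And>i. continuous_on UNIV (dec i)"
    and enc_meas: "enc \<in> borel_measurable (PiM I (\<lambda>_. borel))"
    and enc01: "\<And>x. 0 \<le> enc x" "\<And>x. enc x \<le> 1"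
    and dec_enc: "\<And>x i. i \<in> I \<Longrightarrow> 0 \<le> x i \<Longrightarrow> x i < 1 \<Longrightarrow> dec i (enc x) = x i"
    using schoenberg_curve[OF I] by blast
  have dec_meas [measurable]: "dec i \<in> borel_measurable borel" for i
    by (intro borel_measurable_continuous_onI dec_cont)
  define sq where "sq y = 1/2 + arctan y / pi" for y :: real
  have sq01: "0 < sq y" "sq y < 1" for y
    using arctan_lbound[of y] arctan_ubound[of y] by (auto simp: sq_def field_simps)
  have sq_meas: "sq \<in> borel_measurable borel" unfolding sq_def[abs_def]
    by (intro borel_measurable_continuous_onI continuous_intros) auto
  define E where "E x = enc (\<lambda>i\<in>I. sq (x i))" for x
  define F where "F t = (\<lambda>i\<in>I. tan (pi * (dec i t - 1/2)))" for t
  have dec_E: "dec i (E x) = sq (x i)" if "i \<in> I" for x i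
    unfolding E_def using dec_enc[of i "\<lambda>i\<in>I. sq (x i)"] that sq01[of "x i"] by (simp add: less_imp_le)
  have FE: "F (E x) = x" if "x \<in> space (PiM I (\<lambda>_. borel))" for x
  proof
    fix i show "F (E x) i = x i"
      using that dec_E[of i x] by (cases "i \<in> I") (auto simp: F_def sq_def tan_arctan space_PiM PiE_def extensional_def)
  qed
  have E_meas0: "E \<in> borel_measurable (PiM I (\<lambda>_. borel))"
    unfolding E_def[abs_def]
    by (rule measurable_compose[OF _ enc_meas])
       (intro measurable_restrict measurable_compose[OF _ sq_meas] measurable_component_singleton)
  have E_meas: "E \<in> borel_measurable (\<mu> n)" for n
    using E_meas0 by (simp add: measurable_cong_sets[OF sets refl])
  have tan_meas: "(tan :: real \<Rightarrow> real) \<in> borel_measurable borel"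
    unfolding tan_def[abs_def] by measurable
  have F_meas: "F \<in> measurable borel (PiM I (\<lambda>_. borel))"
    unfolding F_def[abs_def]
    by (intro measurable_restrict measurable_compose[OF _ tan_meas]) measurable
  \<comment> \<open>The left end is -1 and not 0 because tightness on the line uses half-open
    intervals \<open>{a<..b}\<close> and the code 0 may occur.\<close>
  have E01: "- 1 < E x" "E x \<le> 1" for x
    using enc01[of "\<lambda>i\<in>I. sq (x i)"] unfolding E_def by linarith+
  define m where "m n = distr (\<mu> n) borel E" for n
  have rd: "real_distribution (m n)" for n
    unfolding m_def by (intro prob_space.real_distribution_distr prob E_meas)
  have "tight m"
    unfolding tight_def
  proof (intro conjI allI impI rd)
    fix \<epsilon> :: real assume "0 < \<epsilon>"
    interpret m: real_distribution "m n" for n by (rule rd)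
    have "measure (m n) {-1<..1} = 1" for n
    proof -
      have "measure (m n) {-1<..1} = measure (\<mu> n) (E -` {-1<..1} \<inter> space (\<mu> n))"
        unfolding m_def by (rule measure_distr[OF E_meas]) auto
      also have "E -` {-1<..1} \<inter> space (\<mu> n) = space (\<mu> n)"
        using E01 by auto
      finally show ?thesis using prob_space.prob_space[OF prob] by simp
    qed
    then show "\<exists>a b. a < b \<and> (\<forall>n. 1 - \<epsilon> < measure (m n) {a<..b})"
      using \<open>0 < \<epsilon>\<close> by (intro exI[of _ "-1"] exI[of _ 1]) auto
  qed
  from tight_imp_convergent_subsubsequence[OF this strict_mono_id]
  obtain r N where r: "strict_mono r" and N: "real_distribution N" and "weak_conv_m (m \<circ> id \<circ> r) N"
    by blast
  then have wc: "weak_conv_m (\<lambda>n. m (r n)) N" by (simp add: comp_def)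
  interpret N: real_distribution N by (rule N)
  note conv = weak_conv_imp_bdd_ae_continuous_conv[OF rd N wc]
  \<comment> \<open>No mass escapes to infinity in coordinate i. The exceptional set is dominated by
    a continuous function \<open>h\<close>, so that weak convergence applies to it.\<close>
  have bad: "measure N {t. \<not> (0 < dec i t \<and> dec i t < 1)} = 0" if i: "i \<in> I" for i
  proof -
    have "measure N {t. \<not> (0 < dec i t \<and> dec i t < 1)} \<le> \<epsilon>" if \<epsilon>: "0 < \<epsilon>" for \<epsilon>
    proof -
      obtain R where R: "0 < R" and
        ev: "\<forall>\<^sub>F n in sequentially. measure (\<mu> n) {x\<in>space (\<mu> n). R < \<bar>x i\<bar>} \<le> \<epsilon>"
        using tight[OF i \<epsilon>] by blast
      \<comment> \<open>This is 1 - sq R: a coordinate with \<bar>x i\<bar> \<le> R is squashed to a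
        point at distance at least \<eta> from both ends of [0,1], where \<open>h\<close>
        vanishes.\<close>
      define \<eta> where "\<eta> = 1/2 - arctan R / pi"
      have \<eta>: "0 < \<eta>" using arctan_ubound[of R] by (auto simp: \<eta>_def field_simps)
      define h where "h t = max 0 (min 1 (1 - (1/2 - \<bar>dec i t - 1/2\<bar>) / \<eta>))" for t
      have h_cont: "continuous_on UNIV h" unfolding h_def using \<eta>
        by (intro continuous_intros dec_cont) auto
      have h01: "0 \<le> h t" "h t \<le> 1" for t by (auto simp: h_def)
      have h_meas[measurable]: "h \<in> borel_measurable borel" by (intro borel_measurable_continuous_onI h_cont)
      have int: "(\<lambda>n. \<integral>t. h t \<partial>m (r n)) \<longlonglongrightarrow> (\<integral>t. h t \<partial>N)"
        by (rule weak_conv_imp_integral_bdd_continuous_conv[OF rd N wc, where B=1])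
           (use h_cont h01 in \<open>auto simp: continuous_on_eq_continuous_at\<close>)
      have up: "(\<integral>t. h t \<partial>m n) \<le> measure (\<mu> n) {x\<in>space (\<mu> n). R < \<bar>x i\<bar>}" for n
      proof -
        interpret \<mu>: prob_space "\<mu> n" by (rule prob)
        have coord: "(\<lambda>x. x i) \<in> borel_measurable (\<mu> n)"
          using i by (simp add: measurable_cong_sets[OF sets refl])
        have set: "{x\<in>space (\<mu> n). R < \<bar>x i\<bar>} \<in> sets (\<mu> n)" using coord by measurable
        have "(\<integral>t. h t \<partial>m n) = (\<integral>x. h (E x) \<partial>\<mu> n)"
          unfolding m_def by (rule integral_distr[OF E_meas h_meas])
        also have "\<dots> \<le> (\<integral>x. indicator {x\<in>space (\<mu> n). R < \<bar>x i\<bar>} x \<partial>\<mu> n)"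
        proof (rule integral_mono)
          show "integrable (\<mu> n) (\<lambda>x. h (E x))"
            by (rule \<mu>.integrable_const_bound[where B=1])
               (use h01 in \<open>auto intro!: measurable_compose[OF E_meas h_meas]\<close>)
          show "integrable (\<mu> n) (indicator {x\<in>space (\<mu> n). R < \<bar>x i\<bar>} :: _ \<Rightarrow> real)"
            by (rule \<mu>.integrable_const_bound[where B=1]) (use set in auto)
          fix x assume x: "x \<in> space (\<mu> n)"
          show "h (E x) \<le> indicator {x\<in>space (\<mu> n). R < \<bar>x i\<bar>} x"
          proof (cases "R < \<bar>x i\<bar>")
            case True then show ?thesis using x h01 by (simp add: indicator_def)
          next
            case False
            have "\<bar>arctan (x i)\<bar> \<le> arctan R"
              using False arctan_le_iff[of "x i" R] arctan_le_iff[of "-R" "x i"] by (auto simp: arctan_minus abs_le_iff)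
            then have "\<bar>arctan (x i) / pi\<bar> \<le> arctan R / pi"
              by (simp add: divide_right_mono)
            then have "\<eta> \<le> 1/2 - \<bar>dec i (E x) - 1/2\<bar>"
              unfolding dec_E[OF i] by (simp add: sq_def \<eta>_def)
            then have "h (E x) \<le> 0" using \<eta> by (simp add: h_def)
            then show ?thesis by (simp add: False)
          qed
        qed
        also have "\<dots> = measure (\<mu> n) {x\<in>space (\<mu> n). R < \<bar>x i\<bar>}" using set by simp
        finally show ?thesis .
      qed
      have "(\<integral>t. h t \<partial>N) \<le> \<epsilon>"
      proof (rule tendsto_upperbound[OF int])
        have "\<forall>\<^sub>F n in sequentially. measure (\<mu> (r n)) {x\<in>space (\<mu> (r n)). R < \<bar>x i\<bar>} \<le> \<epsilon>"
          by (rule eventually_subseq[OF r ev])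
        then show "\<forall>\<^sub>F n in sequentially. (\<integral>t. h t \<partial>m (r n)) \<le> \<epsilon>"
          by eventually_elim (use up order_trans in blast)
      qed simp
      moreover have "measure N {t. \<not> (0 < dec i t \<and> dec i t < 1)} \<le> (\<integral>t. h t \<partial>N)"
      proof -
        have [measurable]: "{t. \<not> (0 < dec i t \<and> dec i t < 1)} \<in> sets borel" by measurable
        have "measure N {t. \<not> (0 < dec i t \<and> dec i t < 1)} = (\<integral>t. indicator {t. \<not> (0 < dec i t \<and> dec i t < 1)} t \<partial>N)"
          by simp
        also have "\<dots> \<le> (\<integral>t. h t \<partial>N)"
        proof (rule integral_mono)
          show "integrable N (indicator {t. \<not> (0 < dec i t \<and> dec i t < 1)} :: real \<Rightarrow> real)"
            by (rule N.integrable_const_bound[where B=1]) auto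
          show "integrable N h"
            by (rule N.integrable_const_bound[where B=1]) (use h01 in auto)
          fix t
          have "(1/2 - \<bar>dec i t - 1/2\<bar>) / \<eta> \<le> 0" if "\<not> (0 < dec i t \<and> dec i t < 1)"
            using that \<eta> by (auto simp: divide_le_0_iff)
          then show "indicator {t. \<not> (0 < dec i t \<and> dec i t < 1)} t \<le> h t"
            by (auto simp: indicator_def h_def)
        qed
        finally show ?thesis .
      qed
      ultimately show ?thesis by linarith
    qed
    then have "measure N {t. \<not> (0 < dec i t \<and> dec i t < 1)} \<le> 0"
      by (rule dense_ge)
    then show ?thesis by (rule antisym) (rule measure_nonneg)
  qed
  define S where "S = (\<Inter>i\<in>I. {t. 0 < dec i t \<and> dec i t < 1})"
  have S_open: "open S"
    unfolding S_def using I
    by (intro open_INT ballI open_Collect_conj open_Collect_less continuous_intros dec_cont) auto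
  have AE_S: "AE t in N. t \<in> S"
  proof -
    have "AE t in N. 0 < dec i t \<and> dec i t < 1" if "i \<in> I" for i
      by (rule AE_I[of _ _ "{t. \<not> (0 < dec i t \<and> dec i t < 1)}"])
         (use bad[OF that] in \<open>auto simp: N.emeasure_eq_measure\<close>)
    then show ?thesis using I by (simp add: S_def AE_finite_all)
  qed
  \<comment> \<open>On S the angles stay strictly between -pi/2 and pi/2; coordinates outside I are
    constant.\<close>
  have F_cont: "continuous_on S F"
  proof (rule continuous_on_coordinatewise_then_product)
    fix i
    show "continuous_on S (\<lambda>t. F t i)"
    proof (cases "i \<in> I")
      case True
      have "cos (pi * (dec i t - 1/2)) \<noteq> 0" if "t \<in> S" for t
      proof -
        have "0 < dec i t" "dec i t < 1" using that True by (auto simp: S_def)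
        then have "cos (pi * (dec i t - 1/2)) > 0"
          by (intro cos_gt_zero_pi) (auto simp: field_simps)
        then show ?thesis by simp
      qed
      then have "continuous_on S (\<lambda>t. tan (pi * (dec i t - 1/2)))"
        by (intro continuous_intros continuous_on_tan) (auto intro: continuous_on_subset[OF dec_cont])
      then show ?thesis using True by (simp add: F_def)
    qed (simp add: F_def)
  qed
  define \<nu> where "\<nu> = distr N (PiM I (\<lambda>_. borel)) F"
  have F_N: "F \<in> measurable N (PiM I (\<lambda>_. borel))"
    using F_meas by (simp add: measurable_cong_sets[OF N.events_eq_borel refl])
  show ?thesis
  proof
    show "strict_mono r" by (rule r)
    show "prob_space \<nu>" unfolding \<nu>_def by (rule N.prob_space_distr[OF F_N])
    show "sets \<nu> = sets (PiM I (\<lambda>_. borel))" by (simp add: \<nu>_def)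
    fix g :: "('i \<Rightarrow> real) \<Rightarrow> complex" and B
    assume g: "continuous_on UNIV g" "g \<in> borel_measurable (PiM I (\<lambda>_. borel))" "\<And>x. norm (g x) \<le> B"
    have gF: "(\<lambda>t. g (F t)) \<in> borel_measurable borel" by (rule measurable_compose[OF F_meas g(2)])
    have "continuous_on S (\<lambda>t. g (F t))"
      by (rule continuous_on_compose2[OF g(1) F_cont]) auto
    then have "{t. \<not> isCont (\<lambda>t. g (F t)) t} \<subseteq> - S"
      using S_open by (auto simp: continuous_on_eq_continuous_at)
    moreover have "emeasure N (- S) = 0"
    proof -
      have "- S \<in> sets N" using S_open by auto
      then show ?thesis using AE_S by (subst (asm) AE_iff_measurable[of "- S"]) auto
    qed
    ultimately have null: "emeasure N {t. \<not> isCont (\<lambda>t. g (F t)) t} = 0"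
      using emeasure_eq_0[of "- S" N] S_open by auto
    have "(\<lambda>n. \<integral>t. g (F t) \<partial>m (r n)) \<longlonglongrightarrow> (\<integral>t. g (F t) \<partial>N)"
      by (rule conv[OF null g(3) gF])
    moreover have "(\<integral>t. g (F t) \<partial>m n) = (\<integral>x. g x \<partial>\<mu> n)" for n
    proof -
      have "(\<integral>t. g (F t) \<partial>m n) = (\<integral>x. g (F (E x)) \<partial>\<mu> n)"
        unfolding m_def by (rule integral_distr[OF E_meas gF])
      also have "\<dots> = (\<integral>x. g x \<partial>\<mu> n)"
        by (rule Bochner_Integration.integral_cong) (simp_all add: FE sets_eq_imp_space_eq[OF sets])
      finally show ?thesis .
    qed
    moreover have "(\<integral>t. g (F t) \<partial>N) = (\<integral>x. g x \<partial>\<nu>)"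
      unfolding \<nu>_def by (rule integral_distr[OF F_N g(2), symmetric])
    ultimately show "(\<lambda>n. \<integral>x. g x \<partial>\<mu> (r n)) \<longlonglongrightarrow> (\<integral>x. g x \<partial>\<nu>)" by simp
  qed
qed

subsection \<open>Characteristic functions in several dimensions\<close>


text \<open>General index sets instead of \<open>{..<k}\<close> allow sets of times to serve as
  indices, so that marginals need no renumbering.\<close>

definition mchar :: "'i set \<Rightarrow> ('i \<Rightarrow> real) measure \<Rightarrow> ('i \<Rightarrow> real) \<Rightarrow> complex" where
  "mchar I \<mu> u = (\<integral>x. iexp (\<Sum>i\<in>I. u i * x i) \<partial>\<mu>)"

section \<open>Truncated second moments and tails from averaged characteristic functions\<close>

text \<open>Origin of the 8: for y \<le> 2 the Taylor bound and y^4 \<le> 4 y^2 give 1 - sin y / y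
  \<ge> (1/6 - 1/30) y^2 = 2/15 y^2, which exceeds y^2/8; for y > 2 the quotient sin y / y is at
  most 1/2 and there is room to spare.\<close>

lemma one_minus_sinc_lower:
  fixes y :: real
  assumes "0 < y"
  shows "y\<^sup>2 / (1 + y\<^sup>2) \<le> 8 * (1 - sin y / y)"
proof (cases "y \<le> 2")
  case True
  have "\<bar>Im (iexp y - (\<Sum>k\<le>4. (\<i> * y)^k / fact k))\<bar> \<le> \<bar>y\<bar>^5 / fact 5"
    using iexp_approx1[of y 4] abs_Im_le_cmod order_trans by fastforce
  moreover have "Im (iexp y - (\<Sum>k\<le>4. (\<i> * y)^k / fact k)) = sin y - (y - y^3/6)"
    by (simp add: Im_exp eval_nat_numeral fact_numeral)
  ultimately have "\<bar>sin y - (y - y^3/6)\<bar> \<le> y^5 / 120"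
    using assms by (simp add: fact_numeral)
  then have "sin y \<le> y - y^3/6 + y^5/120" by linarith
  then have "sin y / y \<le> (y - y^3/6 + y^5/120) / y"
    using assms by (intro divide_right_mono) auto
  also have "\<dots> = 1 - y\<^sup>2/6 + y\<^sup>2 * y\<^sup>2/120"
    using assms by (simp add: field_simps eval_nat_numeral)
  finally have s: "sin y / y \<le> 1 - y\<^sup>2/6 + y\<^sup>2 * y\<^sup>2/120" .
  have "y\<^sup>2 \<le> 4" using power_mono[OF True, of 2] assms by simp
  then have "y\<^sup>2 * y\<^sup>2 \<le> 4 * y\<^sup>2" by (intro mult_right_mono) auto
  moreover have "q \<le> 8 * (1 - s)" if "s \<le> 1 - q/6 + p/120" "0 \<le> q" "p \<le> 4 * q" for s p q :: real
    using that by (simp add: field_simps)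
  ultimately have "y\<^sup>2 \<le> 8 * (1 - sin y / y)" using s zero_le_power2[of y] by blast
  moreover have "y\<^sup>2 / (1 + y\<^sup>2) \<le> y\<^sup>2" by (simp add: divide_le_eq mult_le_cancel_left1 add_pos_nonneg not_less)
  ultimately show ?thesis by linarith
next
  case False
  have "sin y * 2 \<le> y" using False sin_le_one[of y] by linarith
  then have "sin y / y \<le> 1 / 2"
    using False by (simp add: divide_le_eq)
  moreover have "y\<^sup>2 / (1 + y\<^sup>2) \<le> 1" by (simp add: divide_le_eq add_pos_nonneg)
  moreover have "a \<le> 8 * (1 - s)" if "s \<le> 1/2" "a \<le> 1" for a s :: real using that by (simp add: algebra_simps)
  ultimately show ?thesis by blast
qed

abbreviation unit_lborel :: "real measure" where
  "unit_lborel \<equiv> restrict_space lborel {0..1}"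

lemma prob_space_unit_lborel: "prob_space unit_lborel"
  by (rule prob_spaceI) (simp add: emeasure_restrict_space space_restrict_space)

lemma integral_one_minus_cos:
  fixes y :: real
  assumes "0 < y"
  shows "(\<integral>r. 1 - cos (r * y) \<partial>unit_lborel) = 1 - sin y / y"
proof -
  have "(\<integral>r. 1 - cos (r * y) \<partial>unit_lborel) = (\<integral>r. (1 - cos (r * y)) * indicator {0..1} r \<partial>lborel)"
    by (subst integral_restrict_space) (auto simp: set_lebesgue_integral_def mult.commute)
  also have "\<dots> = (1 - sin (1 * y) / y) - (0 - sin (0 * y) / y)"
    using assms
    by (intro integral_FTC_Icc_real) (auto intro!: derivative_eq_intros simp: field_simps)
  finally show ?thesis by simp
qed

lemma quadratic_ratio_le_integral_cos:
  fixes y :: real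
  shows "y\<^sup>2 / (1 + y\<^sup>2) \<le> 8 * (\<integral>r. 1 - cos (r * y) \<partial>unit_lborel)"
proof -
  consider "y = 0" | "0 < y" | "0 < - y" by linarith
  then show ?thesis
  proof cases
    case 2 then show ?thesis using one_minus_sinc_lower integral_one_minus_cos by simp
  next
    case 3 then show ?thesis using one_minus_sinc_lower[of "-y"] integral_one_minus_cos[of "-y"] by simp
  qed simp
qed

context prob_space
begin

lemma integrable_iexp_rv:
  "Z \<in> borel_measurable M \<Longrightarrow> integrable M (\<lambda>\<omega>. iexp (Z \<omega>))"
  by (rule integrable_const_bound[where B=1]) auto

lemma norm_integral_iexp_le_1:
  assumes "Z \<in> borel_measurable M"
  shows "norm (\<integral>\<omega>. iexp (Z \<omega>) \<partial>M) \<le> 1"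
proof -
  have "norm (\<integral>\<omega>. iexp (Z \<omega>) \<partial>M) \<le> (\<integral>\<omega>. norm (iexp (Z \<omega>)) \<partial>M)" by (rule integral_norm_bound)
  then show ?thesis by (simp add: prob_space)
qed

lemma one_minus_Re_integral_iexp:
  assumes [measurable]: "Z \<in> borel_measurable M"
  shows "1 - Re (\<integral>\<omega>. iexp (Z \<omega>) \<partial>M) = (\<integral>\<omega>. 1 - cos (Z \<omega>) \<partial>M)"
proof -
  have "Re (\<integral>\<omega>. iexp (Z \<omega>) \<partial>M) = (\<integral>\<omega>. cos (Z \<omega>) \<partial>M)"
    using integral_Re[OF integrable_iexp_rv[OF assms]] by (simp add: Re_exp)
  moreover have "integrable M (\<lambda>\<omega>. cos (Z \<omega>))"
    by (rule integrable_const_bound[where B=1]) auto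
  ultimately show ?thesis by (simp add: prob_space)
qed

text \<open>Fubini moves the average over the frequencies r in [0,1] from 1 - cos(rZ) to the
  characteristic function, whose behaviour near 0 thereby controls the truncated second
  moment.\<close>

lemma expectation_quadratic_ratio_le:
  assumes [measurable]: "Z \<in> borel_measurable M"
  shows "(\<integral>\<omega>. (Z \<omega>)\<^sup>2 / (1 + (Z \<omega>)\<^sup>2) \<partial>M) \<le>
    8 * (\<integral>r. 1 - Re (\<integral>\<omega>. iexp (r * Z \<omega>) \<partial>M) \<partial>unit_lborel)"
proof -
  interpret U: prob_space unit_lborel by (rule prob_space_unit_lborel)
  interpret P: pair_prob_space M unit_lborel ..
  have [measurable]: "(\<lambda>r. r) \<in> borel_measurable unit_lborel"
    by (rule measurable_restrict_space1) auto
  have [measurable]: "(\<lambda>(\<omega>, r). 1 - cos (r * Z \<omega>)) \<in> borel_measurable (M \<Otimes>\<^sub>M unit_lborel)"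
  proof -
    have "snd \<in> borel_measurable (M \<Otimes>\<^sub>M unit_lborel)"
      by (rule measurable_compose[OF measurable_snd]) measurable
    then show ?thesis by measurable
  qed
  have int: "integrable (M \<Otimes>\<^sub>M unit_lborel) (\<lambda>(\<omega>, r). 1 - cos (r * Z \<omega>))"
  proof (rule P.integrable_const_bound[where B=2])
    have "norm (1 - cos x) \<le> 2" for x :: real
      using cos_le_one[of x] cos_ge_minus_one[of x] unfolding real_norm_def by linarith
    then show "AE x in M \<Otimes>\<^sub>M unit_lborel. norm (case x of (\<omega>, r) \<Rightarrow> 1 - cos (r * Z \<omega>)) \<le> 2"
      by auto
  qed fact
  have "(\<integral>\<omega>. (Z \<omega>)\<^sup>2 / (1 + (Z \<omega>)\<^sup>2) \<partial>M) \<le> (\<integral>\<omega>. 8 * (\<integral>r. 1 - cos (r * Z \<omega>) \<partial>unit_lborel) \<partial>M)"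
  proof (rule integral_mono)
    have "y\<^sup>2 / (1 + y\<^sup>2) \<le> 1" for y :: real by (simp add: divide_le_eq add_pos_nonneg)
    then show "integrable M (\<lambda>\<omega>. (Z \<omega>)\<^sup>2 / (1 + (Z \<omega>)\<^sup>2))"
      by (intro integrable_const_bound[where B=1]) auto
    show "integrable M (\<lambda>\<omega>. 8 * (\<integral>r. 1 - cos (r * Z \<omega>) \<partial>unit_lborel))"
      using P.integrable_fst[OF int] by simp
  qed (rule quadratic_ratio_le_integral_cos)
  also have "\<dots> = 8 * (\<integral>r. \<integral>\<omega>. 1 - cos (r * Z \<omega>) \<partial>M \<partial>unit_lborel)"
    using P.Fubini_integral[OF int] by simp
  also have "\<dots> = 8 * (\<integral>r. 1 - Re (\<integral>\<omega>. iexp (r * Z \<omega>) \<partial>M) \<partial>unit_lborel)"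
    by (subst one_minus_Re_integral_iexp) auto
  finally show ?thesis .
qed

text \<open>Applied to Z/R: beyond R the ratio y^2/(1+y^2) is at least 1/2, which doubles the
  constant 8.\<close>

lemma tail_prob_le_integral_iexp:
  assumes [measurable]: "Z \<in> borel_measurable M" and R: "0 < R"
  shows "prob {\<omega>\<in>space M. R < \<bar>Z \<omega>\<bar>} \<le>
    16 * (\<integral>r. 1 - Re (\<integral>\<omega>. iexp (r / R * Z \<omega>) \<partial>M) \<partial>unit_lborel)"
proof -
  have "prob {\<omega>\<in>space M. R < \<bar>Z \<omega>\<bar>} = (\<integral>\<omega>. indicator {\<omega>\<in>space M. R < \<bar>Z \<omega>\<bar>} \<omega> \<partial>M)"
    by simp
  also have "\<dots> \<le> (\<integral>\<omega>. 2 * ((Z \<omega> / R)\<^sup>2 / (1 + (Z \<omega> / R)\<^sup>2)) \<partial>M)"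
  proof (rule integral_mono)
    show "integrable M (indicator {\<omega>\<in>space M. R < \<bar>Z \<omega>\<bar>} :: _ \<Rightarrow> real)"
      by (rule integrable_const_bound[where B=1]) auto
    show "integrable M (\<lambda>\<omega>. 2 * ((Z \<omega> / R)\<^sup>2 / (1 + (Z \<omega> / R)\<^sup>2)))"
    proof (intro integrable_mult_right integrable_const_bound[where B=1])
      have "y\<^sup>2 / (1 + y\<^sup>2) \<le> 1" for y :: real by (simp add: divide_le_eq add_pos_nonneg)
      then show "AE x in M. norm ((Z x / R)\<^sup>2 / (1 + (Z x / R)\<^sup>2)) \<le> 1" by simp
    qed auto
    fix \<omega>
    show "indicator {\<omega>\<in>space M. R < \<bar>Z \<omega>\<bar>} \<omega> \<le> 2 * ((Z \<omega> / R)\<^sup>2 / (1 + (Z \<omega> / R)\<^sup>2))"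
    proof (cases "R < \<bar>Z \<omega>\<bar>")
      case True
      then have "1 \<le> \<bar>Z \<omega> / R\<bar>" using R by simp
      then have "1 \<le> (Z \<omega> / R)\<^sup>2" using abs_le_square_iff[of 1 "Z \<omega> / R"] by simp
      then have "1 \<le> 2 * ((Z \<omega> / R)\<^sup>2 / (1 + (Z \<omega> / R)\<^sup>2))" by (simp add: le_divide_eq add_pos_nonneg)
      then show ?thesis by (simp add: indicator_def)
    qed (simp add: indicator_def)
  qed
  also have "\<dots> \<le> 2 * (8 * (\<integral>r. 1 - Re (\<integral>\<omega>. iexp (r * (Z \<omega> / R)) \<partial>M) \<partial>unit_lborel))"
    unfolding integral_mult_right_zero
    by (intro mult_left_mono expectation_quadratic_ratio_le) auto
  finally show ?thesis by (simp add: field_simps)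
qed

end

lemma borel_measurable_linear_form:
  assumes "sets \<mu> = sets (PiM I (\<lambda>_. borel))"
  shows "(\<lambda>x. \<Sum>i\<in>I. u i * x i :: real) \<in> borel_measurable \<mu>"
  using assms by (subst measurable_cong_sets[OF assms refl]) measurable

lemma continuous_on_linear_form:
  "continuous_on UNIV (\<lambda>x :: 'i \<Rightarrow> real. \<Sum>i\<in>I. u i * x i)"
  by (intro continuous_intros continuous_on_product_coordinates)

lemma sum_single_coordinate:
  fixes x :: "'i \<Rightarrow> real"
  assumes "finite I" "i \<in> I"
  shows "(\<Sum>j\<in>I. (if j = i then r else 0) * x j) = r * x i"
proof -
  have "(\<Sum>j\<in>I. (if j = i then r else 0) * x j) = (\<Sum>j\<in>I. if j = i then r * x j else 0)"
    by (intro sum.cong) auto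
  also have "\<dots> = r * x i" using assms by simp
  finally show ?thesis .
qed

section \<open>Levy's continuity theorem in several dimensions\<close>

text \<open>Continuity at 0 is required along the coordinate axes, matching tightness, which
  \<open>multivariate_helly\<close> asks for one coordinate at a time. Any subsequential weak limit
  then has the characteristic function \<phi>.\<close>

lemma multivariate_levy_continuity:
  fixes I :: "'i set" and \<mu> :: "nat \<Rightarrow> ('i \<Rightarrow> real) measure"
  assumes I: "finite I"
    and prob: "\<And>n. prob_space (\<mu> n)"
    and sets: "\<And>n. sets (\<mu> n) = sets (PiM I (\<lambda>_. borel))"
    and lim: "\<And>u. (\<lambda>n. mchar I (\<mu> n) u) \<longlonglongrightarrow> \<phi> u"
    and cont: "\<And>i. i \<in> I \<Longrightarrow> ((\<lambda>r. \<phi> (\<lambda>j. if j = i then r else 0)) \<longlongrightarrow> 1) (at 0)"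
  obtains \<nu> where "prob_space \<nu>" "sets \<nu> = sets (PiM I (\<lambda>_. borel))" "\<And>u. mchar I \<nu> u = \<phi> u"
proof -
  interpret U: prob_space unit_lborel by (rule prob_space_unit_lborel)
  have tight: "\<exists>R>0. \<forall>\<^sub>F n in sequentially. measure (\<mu> n) {x\<in>space (\<mu> n). R < \<bar>x i\<bar>} \<le> \<epsilon>"
    if i: "i \<in> I" and \<epsilon>: "0 < \<epsilon>" for i and \<epsilon> :: real
  proof -
    define \<psi> where "\<psi> r = \<phi> (\<lambda>j. if j = i then r else 0)" for r
    have coord: "(\<lambda>x. x i) \<in> borel_measurable (\<mu> n)" for n
      using i by (simp add: measurable_cong_sets[OF sets refl])
    define c where "c n r = (\<integral>x. iexp (r * x i) \<partial>\<mu> n)" for n r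
    have c_lim: "(\<lambda>n. c n r) \<longlonglongrightarrow> \<psi> r" for r
      using lim[of "\<lambda>j. if j = i then r else 0"]
      unfolding mchar_def sum_single_coordinate[OF I i] by (simp add: c_def \<psi>_def)
    have c_norm: "norm (c n r) \<le> 1" for n r
      unfolding c_def using coord by (intro prob_space.norm_integral_iexp_le_1 prob) simp
    have c_meas: "c n \<in> borel_measurable borel" for n
    proof -
      have "real_distribution (distr (\<mu> n) borel (\<lambda>x. x i))"
        by (intro prob_space.real_distribution_distr prob coord)
      then have "char (distr (\<mu> n) borel (\<lambda>x. x i)) \<in> borel_measurable borel"
        by (rule real_distribution.char_measurable)
      also have "char (distr (\<mu> n) borel (\<lambda>x. x i)) = c n"
        by (simp add: fun_eq_iff char_def c_def integral_distr coord)
      finally show ?thesis .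
    qed
    have \<psi>0: "\<psi> 0 = 1"
    proof -
      have "c n 0 = 1" for n
        unfolding c_def using prob_space.prob_space[OF prob] by simp
      then show ?thesis using c_lim[of 0] by (simp add: LIMSEQ_const_iff)
    qed
    have "((\<lambda>r. \<psi> r) \<longlongrightarrow> 1) (at 0)" using cont[OF i] by (simp add: \<psi>_def)
    \<comment> \<open>The tail bound carries the factor 16. Asking for \<epsilon>/32 keeps the
      limiting integral strictly below \<epsilon>/16, so that the strict bound passes to all large
      n.\<close>
    then obtain \<delta> where \<delta>: "0 < \<delta>" "\<And>r. r \<noteq> 0 \<Longrightarrow> \<bar>r\<bar> < \<delta> \<Longrightarrow> norm (\<psi> r - 1) < \<epsilon> / 32"
      using \<epsilon> LIM_D[of \<psi> 1 0 "\<epsilon> / 32"] by auto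
    \<comment> \<open>The frequencies r/R with r in [0,1] are at most \<delta>/2, hence strictly
      inside the \<delta>-neighbourhood.\<close>
    define R where "R = 2 / \<delta>"
    have R: "0 < R" using \<delta> by (simp add: R_def)
    have small: "norm (1 - Re (\<psi> (r / R))) \<le> \<epsilon> / 32" if "r \<in> {0..1}" for r
    proof (cases "r = 0")
      case False
      have "\<bar>r / R\<bar> < \<delta>" using that \<delta>(1) mult_right_mono[of r 1 \<delta>] by (simp add: R_def)
      then have "norm (\<psi> (r / R) - 1) < \<epsilon> / 32" using False R by (intro \<delta>(2)) auto
      moreover have "norm (1 - Re (\<psi> (r / R))) \<le> norm (\<psi> (r / R) - 1)"
        using abs_Re_le_cmod[of "\<psi> (r / R) - 1"] by simp
      ultimately show ?thesis by linarith
    qed (use \<psi>0 \<epsilon> in simp)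
    have \<psi>_meas: "\<psi> \<in> borel_measurable borel"
      by (rule borel_measurable_LIMSEQ_metric[OF c_meas c_lim])
    have meas: "(\<lambda>r. 1 - Re (f (r / R))) \<in> borel_measurable unit_lborel"
      if "f \<in> borel_measurable borel" for f :: "real \<Rightarrow> complex"
    proof (intro measurable_restrict_space1)
      have "(\<lambda>r. f (r / R)) \<in> borel_measurable borel"
        by (rule measurable_compose[OF _ that]) measurable
      then show "(\<lambda>r. 1 - Re (f (r / R))) \<in> borel_measurable lborel" by simp
    qed
    have "(\<lambda>n. \<integral>r. 1 - Re (c n (r / R)) \<partial>unit_lborel) \<longlonglongrightarrow> (\<integral>r. 1 - Re (\<psi> (r / R)) \<partial>unit_lborel)"
    proof (rule integral_dominated_convergence[where w="\<lambda>_. 2"])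
      have "norm (1 - Re (c n s)) \<le> 2" for n s
        using abs_Re_le_cmod[of "c n s"] c_norm[of n s] unfolding real_norm_def by linarith
      then show "AE r in unit_lborel. norm (1 - Re (c n (r / R))) \<le> 2" for n by simp
      show "AE r in unit_lborel. (\<lambda>n. 1 - Re (c n (r / R))) \<longlonglongrightarrow> 1 - Re (\<psi> (r / R))"
        by (intro AE_I2 tendsto_intros c_lim)
    qed (use meas[OF c_meas] meas[OF \<psi>_meas] in auto)
    moreover have "(\<integral>r. 1 - Re (\<psi> (r / R)) \<partial>unit_lborel) \<le> (\<integral>r. \<epsilon> / 32 \<partial>unit_lborel)"
    proof (rule integral_mono)
      have small': "norm (1 - Re (\<psi> (r / R))) \<le> \<epsilon> / 32" if "r \<in> space unit_lborel" for r
        using small that by (simp add: space_restrict_space)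
      show "integrable unit_lborel (\<lambda>r. 1 - Re (\<psi> (r / R)))"
        by (rule U.integrable_const_bound[where B="\<epsilon>/32", OF AE_I2[OF small'] meas[OF \<psi>_meas]])
      show "1 - Re (\<psi> (r / R)) \<le> \<epsilon> / 32" if "r \<in> space unit_lborel" for r
        using small'[OF that] unfolding real_norm_def by linarith
    qed simp
    then have "(\<integral>r. 1 - Re (\<psi> (r / R)) \<partial>unit_lborel) < \<epsilon> / 16"
      using \<epsilon> U.prob_space by simp
    ultimately have "\<forall>\<^sub>F n in sequentially. (\<integral>r. 1 - Re (c n (r / R)) \<partial>unit_lborel) < \<epsilon> / 16"
      by (rule order_tendstoD)
    then have "\<forall>\<^sub>F n in sequentially. measure (\<mu> n) {x\<in>space (\<mu> n). R < \<bar>x i\<bar>} \<le> \<epsilon>"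
    proof eventually_elim
      case (elim n)
      then show ?case
        using prob_space.tail_prob_le_integral_iexp[OF prob coord R, of n] by (simp add: c_def)
    qed
    then show ?thesis using R by blast
  qed
  obtain r :: "nat \<Rightarrow> nat" and \<nu> where r: "strict_mono r" and \<nu>: "prob_space \<nu>"
    "sets \<nu> = sets (PiM I (\<lambda>_. borel))" and conv:
    "\<And>(g :: ('i \<Rightarrow> real) \<Rightarrow> complex) B. continuous_on UNIV g \<Longrightarrow> g \<in> borel_measurable (PiM I (\<lambda>_. borel)) \<Longrightarrow>
       (\<And>x. norm (g x) \<le> B) \<Longrightarrow> (\<lambda>n. \<integral>x. g x \<partial>\<mu> (r n)) \<longlonglongrightarrow> (\<integral>x. g x \<partial>\<nu>)"
    using multivariate_helly[OF I prob sets tight] by blast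
  have "mchar I \<nu> u = \<phi> u" for u
  proof (rule LIMSEQ_unique)
    show "(\<lambda>n. mchar I (\<mu> (r n)) u) \<longlonglongrightarrow> mchar I \<nu> u"
      unfolding mchar_def
    proof (rule conv[of _ 1])
      show "continuous_on UNIV (\<lambda>x. iexp (\<Sum>i\<in>I. u i * x i))"
        by (intro continuous_intros continuous_on_linear_form)
      show "(\<lambda>x. iexp (\<Sum>i\<in>I. u i * x i)) \<in> borel_measurable (PiM I (\<lambda>_. borel))"
        using borel_measurable_linear_form[of "PiM I (\<lambda>_. borel)" I u] by measurable
      show "norm (iexp (\<Sum>i\<in>I. u i * x i)) \<le> 1" for x by (simp del: of_real_sum)
    qed
    show "(\<lambda>n. mchar I (\<mu> (r n)) u) \<longlonglongrightarrow> \<phi> u"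
      using LIMSEQ_subseq_LIMSEQ[OF lim r] by (simp add: comp_def)
  qed
  with \<nu> show ?thesis by (rule that)
qed


section \<open>Uniqueness of the law with a given characteristic function\<close>

text \<open>Divided by their common total mass c, which the hypothesis at r = 0 identifies, the
  weights are probability densities, and Levy's uniqueness theorem on the line applies to the laws
  of f1 and f2. If c = 0 both weights vanish almost everywhere.\<close>

lemma weighted_law_unique:
  fixes f1 :: "'a \<Rightarrow> real" and f2 :: "'b \<Rightarrow> real"
    and W1 :: "'a \<Rightarrow> real" and W2 :: "'b \<Rightarrow> real"
  assumes [measurable]: "f1 \<in> borel_measurable M1" "f2 \<in> borel_measurable M2"
    and int: "integrable M1 W1" "integrable M2 W2"
    and nonneg: "\<And>x. 0 \<le> W1 x" "\<And>x. 0 \<le> W2 x"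
    and eq: "\<And>r. (\<integral>x. W1 x * iexp (r * f1 x) \<partial>M1) = (\<integral>x. W2 x * iexp (r * f2 x) \<partial>M2)"
    and [measurable]: "A \<in> sets borel"
  shows "(\<integral>x. W1 x * indicator A (f1 x) \<partial>M1) = (\<integral>x. W2 x * indicator A (f2 x) \<partial>M2)"
proof -
  note [measurable] = borel_measurable_integrable[OF int(1)] borel_measurable_integrable[OF int(2)]
  define c where "c = (\<integral>x. W1 x \<partial>M1)"
  have c2: "(\<integral>x. W2 x \<partial>M2) = c"
  proof -
    have "complex_of_real (\<integral>x. W2 x \<partial>M2) = complex_of_real c"
      using eq[of 0] by (simp add: c_def)
    then show ?thesis by (simp only: of_real_eq_iff)
  qed
  have c0: "0 \<le> c" unfolding c_def by (intro integral_nonneg_AE) (simp add: nonneg)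
  show ?thesis
  proof (cases "c = 0")
    case True
    have "AE x in M1. W1 x = 0"
      using True nonneg(1) by (subst (asm) c_def, subst (asm) integral_nonneg_eq_0_iff_AE[OF int(1)]) auto
    then have "(\<integral>x. W1 x * indicator A (f1 x) \<partial>M1) = (\<integral>x. 0 \<partial>M1)"
      by (intro integral_cong_AE) auto
    moreover have "AE x in M2. W2 x = 0"
      using True nonneg(2) by (subst (asm) c2[symmetric], subst (asm) integral_nonneg_eq_0_iff_AE[OF int(2)]) auto
    then have "(\<integral>x. W2 x * indicator A (f2 x) \<partial>M2) = (\<integral>x. 0 \<partial>M2)"
      by (intro integral_cong_AE) auto
    ultimately show ?thesis by simp
  next
    case False
    then have c: "0 < c" using c0 by simp
    have ps: "prob_space (density N (\<lambda>x. ennreal (W x / c)))"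
      if "integrable N W" "\<And>x. 0 \<le> W x" "(\<integral>x. W x \<partial>N) = c" for N :: "'c measure" and W
    proof (rule prob_spaceI)
      note [measurable] = borel_measurable_integrable[OF that(1)]
      have "emeasure (density N (\<lambda>x. ennreal (W x / c))) (space (density N (\<lambda>x. ennreal (W x / c)))) =
        (\<integral>\<^sup>+x. ennreal (W x / c) \<partial>N)"
        by (simp add: emeasure_density cong: nn_integral_cong)
      also have "\<dots> = ennreal (\<integral>x. W x / c \<partial>N)"
        using that c by (intro nn_integral_eq_integral) auto
      also have "\<dots> = 1" using that c by simp
      finally show "emeasure (density N (\<lambda>x. ennreal (W x / c))) (space (density N (\<lambda>x. ennreal (W x / c)))) = 1" .
    qed
    define D1 where "D1 = density M1 (\<lambda>x. ennreal (W1 x / c))"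
    define D2 where "D2 = density M2 (\<lambda>x. ennreal (W2 x / c))"
    interpret D1: prob_space D1 unfolding D1_def by (rule ps) (use int nonneg in \<open>auto simp: c_def\<close>)
    interpret D2: prob_space D2 unfolding D2_def by (rule ps) (use int nonneg c2 in auto)
    have f1: "f1 \<in> borel_measurable D1" and f2: "f2 \<in> borel_measurable D2"
      by (auto simp: D1_def D2_def)
    have i1: "(\<integral>x. g (f1 x) \<partial>D1) = (\<integral>x. (W1 x / c) *\<^sub>R g (f1 x) \<partial>M1)"
      if [measurable]: "g \<in> borel_measurable borel" for g :: "real \<Rightarrow> 'c::{banach,second_countable_topology}"
      unfolding D1_def using c nonneg by (subst integral_density) auto
    have i2: "(\<integral>x. g (f2 x) \<partial>D2) = (\<integral>x. (W2 x / c) *\<^sub>R g (f2 x) \<partial>M2)"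
      if [measurable]: "g \<in> borel_measurable borel" for g :: "real \<Rightarrow> 'c::{banach,second_countable_topology}"
      unfolding D2_def using c nonneg by (subst integral_density) auto
    have "distr D1 borel f1 = distr D2 borel f2"
    proof (rule Levy_uniqueness)
      show "real_distribution (distr D1 borel f1)" "real_distribution (distr D2 borel f2)"
        using f1 f2 by (auto intro: D1.real_distribution_distr D2.real_distribution_distr)
      show "char (distr D1 borel f1) = char (distr D2 borel f2)"
      proof
        fix r
        have "char (distr D1 borel f1) r = (\<integral>x. iexp (r * f1 x) \<partial>D1)"
          unfolding char_def by (rule integral_distr[OF f1]) measurable
        also have "\<dots> = (\<integral>x. (W1 x / c) *\<^sub>R iexp (r * f1 x) \<partial>M1)"
          by (rule i1[of "\<lambda>y. iexp (r * y)"]) measurable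
        also have "\<dots> = (\<integral>x. (W2 x / c) *\<^sub>R iexp (r * f2 x) \<partial>M2)"
          using eq[of r] by (simp add: scaleR_conv_of_real)
        also have "\<dots> = (\<integral>x. iexp (r * f2 x) \<partial>D2)"
          by (rule i2[of "\<lambda>y. iexp (r * y)", symmetric]) measurable
        also have "\<dots> = char (distr D2 borel f2) r"
          unfolding char_def by (rule integral_distr[OF f2, symmetric]) measurable
        finally show "char (distr D1 borel f1) r = char (distr D2 borel f2) r" .
      qed
    qed
    then have "(\<integral>y. indicator A y \<partial>distr D1 borel f1) = (\<integral>y. indicator A y \<partial>distr D2 borel f2 :: real)" by simp
    then have "(\<integral>x. indicator A (f1 x) \<partial>D1) = (\<integral>x. indicator A (f2 x) \<partial>D2 :: real)"
      by (simp only: integral_distr[OF f1] integral_distr[OF f2] borel_measurable_indicator assms)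
    then have "(\<integral>x. (W1 x / c) *\<^sub>R indicator A (f1 x) \<partial>M1) = (\<integral>x. (W2 x / c) *\<^sub>R indicator A (f2 x) \<partial>M2 :: real)"
      by (simp only: i1 i2 borel_measurable_indicator assms)
    then show ?thesis using c by simp
  qed
qed

text \<open>The coordinates are treated one at a time, turning an exponential factor into an indicator.
  The weights 1 + cos are nonnegative, so that uniqueness on the line applies to them.\<close>

lemma mchar_unique:
  fixes I :: "'i set"
  assumes I: "finite I"
    and prob: "prob_space \<mu>" "prob_space \<nu>"
    and sets: "sets \<mu> = sets (PiM I (\<lambda>_. borel))" "sets \<nu> = sets (PiM I (\<lambda>_. borel))"
    and eq: "\<And>u. mchar I \<mu> u = mchar I \<nu> u"
  shows "\<mu> = \<nu>"
proof -
  interpret \<mu>: prob_space \<mu> by fact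
  interpret \<nu>: prob_space \<nu> by fact
  define L where "L u x = (\<Sum>i\<in>I. u i * x i)" for u x :: "'i \<Rightarrow> real"
  define J where "J A S x = (\<Prod>i\<in>S. indicator (A i) (x i) :: real)" for A :: "'i \<Rightarrow> real set" and S x
  have J01: "0 \<le> J A S x" "J A S x \<le> 1" for A S x
    by (auto simp: J_def intro!: prod_nonneg prod_le_1)
  note mc = measurable_cong_sets[OF sets(1) refl] measurable_cong_sets[OF sets(2) refl]
  have J_meas: "J A S \<in> borel_measurable (PiM I (\<lambda>_. borel))"
    if S: "S \<subseteq> I" and A: "\<And>i. A i \<in> sets borel" for A S
    unfolding J_def
  proof (intro borel_measurable_prod)
    fix i assume "i \<in> S"
    then have "(\<lambda>x. x i) \<in> borel_measurable (PiM I (\<lambda>_. borel :: real measure))" using S by auto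
    then show "(\<lambda>x. indicator (A i) (x i) :: real) \<in> borel_measurable (PiM I (\<lambda>_. borel))"
      by (rule measurable_compose) (use A in simp)
  qed
  have L_meas: "L u \<in> borel_measurable (PiM I (\<lambda>_. borel))" for u
    unfolding L_def by measurable
  \<comment> \<open>S is the set of coordinates already turned into indicators. For S = I and u = 0
    this is the measure of a product set.\<close>
  have key: "(\<integral>x. J A S x * iexp (L u x) \<partial>\<mu>) = (\<integral>x. J A S x * iexp (L u x) \<partial>\<nu>)"
    if "finite S" "S \<subseteq> I" and A: "\<And>i. A i \<in> sets borel" for S A u
    using that(1,2)
  proof (induction S arbitrary: u rule: finite_induct)
    case empty
    then show ?case using eq[of u] by (simp add: J_def mchar_def L_def)
  next
    case (insert j S)
    have jS: "j \<in> I" "S \<subseteq> I" using insert by auto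
    have coord: "(\<lambda>x. x j) \<in> borel_measurable (PiM I (\<lambda>_. borel))" using jS by auto
    note ms = J_meas[OF jS(2) A] L_meas coord
    have Jint: "integrable \<mu> (\<lambda>x. of_real (J A S x) * iexp (g x))" "integrable \<nu> (\<lambda>x. of_real (J A S x) * iexp (g x))"
      if "g \<in> borel_measurable (PiM I (\<lambda>_. borel))" for g
      using J01 that ms
      by (auto intro!: \<mu>.integrable_const_bound[where B=1] \<nu>.integrable_const_bound[where B=1]
           simp: norm_mult mc)
    \<comment> \<open>The exponent is again a linear form in x, so the induction hypothesis applies
      with another u; s = 0, 1 and -1 are the values that occur.\<close>
    have Jexp: "(\<integral>x. J A S x * iexp (s * L u x + r * x j) \<partial>\<mu>) = (\<integral>x. J A S x * iexp (s * L u x + r * x j) \<partial>\<nu>)" for r s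
    proof -
      have "s * L u x + r * x j = L (\<lambda>i. s * u i + (if i = j then r else 0)) x" for x
        using sum_single_coordinate[OF I jS(1), of r x]
        by (simp add: L_def distrib_right sum.distrib sum_distrib_left mult.assoc)
      then show ?thesis using insert.IH[OF jS(2)] by simp
    qed
    \<comment> \<open>Written with exponentials, 1 + cos(L u x + \<theta>) has the frequencies 0, 1
      and -1 in L u x, all covered by \<open>Jexp\<close>. The phase \<theta> is left free in order
      to reach both cosine and sine.\<close>
    define W where "W \<theta> x = J A S x * (1 + cos (L u x + \<theta>))" for \<theta> x
    have W0: "0 \<le> W \<theta> x" for \<theta> x
    proof -
      have "0 \<le> 1 + cos (L u x + \<theta>)" using cos_ge_minus_one[of "L u x + \<theta>"] by linarith
      then show ?thesis using J01 by (simp add: W_def)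
    qed
    have W2: "\<bar>W \<theta> x\<bar> \<le> 1 * 2" for \<theta> x
      unfolding W_def abs_mult using J01[of A S x] cos_le_one[of "L u x + \<theta>"] cos_ge_minus_one[of "L u x + \<theta>"]
      by (intro mult_mono) linarith+
    have Wm: "W \<theta> \<in> borel_measurable (PiM I (\<lambda>_. borel))" for \<theta>
      unfolding W_def using ms by measurable
    have Wint: "integrable \<mu> (W \<theta>)" "integrable \<nu> (W \<theta>)" for \<theta>
      using W2[of \<theta>] Wm[of \<theta>]
      by (auto intro!: \<mu>.integrable_const_bound[where B=2] \<nu>.integrable_const_bound[where B=2] simp: mc)
    have Weq: "(\<integral>x. W \<theta> x * iexp (r * x j) \<partial>\<mu>) = (\<integral>x. W \<theta> x * iexp (r * x j) \<partial>\<nu>)" for \<theta> r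
    proof -
      have exp_eq: "of_real (W \<theta> x) * iexp (r * x j) = J A S x * iexp (0 * L u x + r * x j)
          + iexp \<theta> / 2 * (J A S x * iexp (1 * L u x + r * x j))
          + iexp (-\<theta>) / 2 * (J A S x * iexp ((-1) * L u x + r * x j))" for x
      proof -
        have c: "complex_of_real (cos t) = (iexp t + iexp (- t)) / 2" for t
          by (simp add: complex_eq_iff Re_exp Im_exp)
        have m: "iexp (s + t) = iexp s * iexp t" for s t
          by (simp add: distrib_left exp_add)
        show ?thesis
          unfolding W_def of_real_mult of_real_add of_real_1 c minus_add_distrib m mult_1_left
            mult_zero_left mult_minus1
          by (simp add: exp_add exp_diff exp_minus field_simps)
      qed
      have g: "(\<lambda>x. s * L u x + r * x j) \<in> borel_measurable (PiM I (\<lambda>_. borel))" for s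
        using ms by measurable
      have "(\<integral>x. f x + a * f' x + b * f'' x \<partial>N) = (\<integral>x. f x \<partial>N) + a * (\<integral>x. f' x \<partial>N) + b * (\<integral>x. f'' x \<partial>N)"
        if "integrable N f" "integrable N f'" "integrable N f''"
        for N :: "('i \<Rightarrow> real) measure" and f f' f'' :: "_ \<Rightarrow> complex" and a b
        using that by simp
      note lin = this[OF Jint(1) Jint(1) Jint(1), OF g g g] this[OF Jint(2) Jint(2) Jint(2), OF g g g]
      show ?thesis
        unfolding exp_eq lin Jexp ..
    qed
    have WA: "(\<integral>x. W \<theta> x * indicator (A j) (x j) \<partial>\<mu>) = (\<integral>x. W \<theta> x * indicator (A j) (x j) \<partial>\<nu>)" for \<theta>
      by (rule weighted_law_unique[OF _ _ Wint W0 W0 Weq A]) (use coord in \<open>auto simp: mc\<close>)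
    \<comment> \<open>The summand 1 of the weight alone; it is subtracted below to isolate the
      cosine.\<close>
    have JA: "(\<integral>x. J A S x * indicator (A j) (x j) \<partial>\<mu>) = (\<integral>x. J A S x * indicator (A j) (x j) \<partial>\<nu>)"
    proof (rule weighted_law_unique[OF _ _ _ _ J01(1) J01(1) _ A])
      show "integrable \<mu> (J A S)" "integrable \<nu> (J A S)"
        using ms J01 by (auto intro!: \<mu>.integrable_const_bound[where B=1] \<nu>.integrable_const_bound[where B=1] simp: mc)
      show "(\<integral>x. J A S x * iexp (r * x j) \<partial>\<mu>) = (\<integral>x. J A S x * iexp (r * x j) \<partial>\<nu>)" for r
        using Jexp[of 0 r] by simp
    qed (use coord in \<open>auto simp: mc\<close>)
    define K where "K x = J A S x * indicator (A j) (x j)" for x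
    have K01: "0 \<le> K x" "K x \<le> 1" for x using J01[of A S x] by (auto simp: K_def indicator_def)
    have Km: "K \<in> borel_measurable (PiM I (\<lambda>_. borel))"
      unfolding K_def using ms measurable_compose[OF coord borel_measurable_indicator[OF A[of j]]] by measurable
    have Kint: "integrable \<mu> K" "integrable \<nu> K"
      using Km K01 by (auto intro!: \<mu>.integrable_const_bound[where B=1] \<nu>.integrable_const_bound[where B=1] simp: mc)
    have Kcint: "integrable \<mu> (\<lambda>x. K x * cos (L u x + \<theta>))" "integrable \<nu> (\<lambda>x. K x * cos (L u x + \<theta>))" for \<theta>
    proof -
      have m: "(\<lambda>x. K x * cos (L u x + \<theta>)) \<in> borel_measurable (PiM I (\<lambda>_. borel))" using Km ms by measurable
      have "\<bar>K x * cos (L u x + \<theta>)\<bar> \<le> 1" for x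
        using mult_mono[of "\<bar>K x\<bar>" 1 "\<bar>cos (L u x + \<theta>)\<bar>" 1] K01[of x] by (simp add: abs_mult)
      then show "integrable \<mu> (\<lambda>x. K x * cos (L u x + \<theta>))" "integrable \<nu> (\<lambda>x. K x * cos (L u x + \<theta>))"
        using m by (auto intro!: \<mu>.integrable_const_bound[where B=1] \<nu>.integrable_const_bound[where B=1] simp: mc)
    qed
    have Kcos: "(\<integral>x. K x * cos (L u x + \<theta>) \<partial>\<mu>) = (\<integral>x. K x * cos (L u x + \<theta>) \<partial>\<nu>)" for \<theta>
    proof -
      have "W \<theta> x * indicator (A j) (x j) = K x + K x * cos (L u x + \<theta>)" for x
        by (simp add: W_def K_def algebra_simps)
      then have "(\<integral>x. K x \<partial>\<mu>) + (\<integral>x. K x * cos (L u x + \<theta>) \<partial>\<mu>) = (\<integral>x. K x \<partial>\<nu>) + (\<integral>x. K x * cos (L u x + \<theta>) \<partial>\<nu>)"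
        using WA[of \<theta>] by (simp add: Kint Kcint)
      then show ?thesis using JA by (simp add: K_def)
    qed
    \<comment> \<open>The phase 0 yields the real part and -pi/2 the imaginary part of the
      exponential factor.\<close>
    have K_eq: "of_real (J A (insert j S) x) * iexp (L u x) =
        of_real (K x * cos (L u x + 0)) + \<i> * of_real (K x * cos (L u x + (- (pi/2))))" for x
    proof -
      have "cos (L u x + (- (pi/2))) = sin (L u x)"
        by (simp add: cos_diff)
      moreover have "J A (insert j S) x = K x"
        using insert by (simp add: J_def K_def)
      ultimately show ?thesis by (simp add: complex_eq_iff Re_exp Im_exp)
    qed
    have "(\<integral>x. of_real (f x) + \<i> * of_real (f' x) \<partial>N) = of_real (\<integral>x. f x \<partial>N) + \<i> * of_real (\<integral>x. f' x \<partial>N)"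
      if "integrable N f" "integrable N f'" for N :: "('i \<Rightarrow> real) measure" and f f' :: "_ \<Rightarrow> real"
      using that by simp
    note lin = this[OF Kcint(1) Kcint(1)] this[OF Kcint(2) Kcint(2)]
    show ?case
      unfolding K_eq lin Kcos ..
  qed
  have "emeasure \<mu> (Pi\<^sub>E I A) = emeasure \<nu> (Pi\<^sub>E I A)" if A: "\<And>i. i \<in> I \<Longrightarrow> A i \<in> sets borel" for A
  proof -
    \<comment> \<open>\<open>key\<close> expects measurable sets at all indices, including those
      outside I.\<close>
    define B where "B i = (if i \<in> I then A i else {})" for i
    have B: "B i \<in> sets borel" for i using A by (auto simp: B_def)
    have PB: "Pi\<^sub>E I A = Pi\<^sub>E I B" by (auto simp: B_def intro!: PiE_cong)
    have Pset: "Pi\<^sub>E I B \<in> sets (PiM I (\<lambda>_. borel))" using I B by (intro sets_PiM_I_finite) auto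
    have JB: "J B I x = indicator (Pi\<^sub>E I B) x" if xs: "x \<in> space (PiM I (\<lambda>_. borel))" for x
    proof (cases "x \<in> Pi\<^sub>E I B")
      case True
      then show ?thesis by (auto simp: J_def indicator_def PiE_iff intro!: prod.neutral)
    next
      case False
      then obtain i where "i \<in> I" "x i \<notin> B i" using xs by (auto simp: space_PiM PiE_iff)
      then show ?thesis using I False by (auto simp: J_def intro!: prod_zero bexI[of _ i])
    qed
    have "(\<integral>x. of_real (J B I x) \<partial>\<mu> :: complex) = (\<integral>x. of_real (J B I x) \<partial>\<nu>)"
      using key[of I B "\<lambda>_. 0", OF I subset_refl B] by (simp add: L_def)
    then have "(\<integral>x. J B I x \<partial>\<mu>) = (\<integral>x. J B I x \<partial>\<nu>)" by simp
    moreover have "(\<integral>x. J B I x \<partial>\<mu>) = (\<integral>x. indicator (Pi\<^sub>E I B) x \<partial>\<mu>)"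
      by (rule Bochner_Integration.integral_cong) (simp_all add: JB sets_eq_imp_space_eq[OF sets(1)])
    moreover have "(\<integral>x. J B I x \<partial>\<nu>) = (\<integral>x. indicator (Pi\<^sub>E I B) x \<partial>\<nu>)"
      by (rule Bochner_Integration.integral_cong) (simp_all add: JB sets_eq_imp_space_eq[OF sets(2)])
    ultimately have "measure \<mu> (Pi\<^sub>E I B) = measure \<nu> (Pi\<^sub>E I B)"
      using Pset by (simp add: sets)
    then show ?thesis by (simp add: PB \<mu>.emeasure_eq_measure \<nu>.emeasure_eq_measure)
  qed
  then show ?thesis
  proof (rule measure_eqI_PiM_finite[OF I sets, where A="\<lambda>_. space (PiM I (\<lambda>_. borel))"])
    show "range (\<lambda>_::nat. space (PiM I (\<lambda>_. borel))) \<subseteq> prod_algebra I (\<lambda>_. borel)"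
      using I by (auto simp: space_PiM intro!: prod_algebraI_finite)
  qed (auto simp: \<mu>.emeasure_eq_measure)
qed

subsection \<open>Continuous families of roots\<close>


lemma continuous_log_normalised:
  fixes g :: "real \<Rightarrow> complex"
  assumes "continuous_on UNIV g" "\<And>r. g r \<noteq> 0" "g 0 = 1"
  obtains h where "continuous_on UNIV h" "h 0 = 0" "\<And>r. g r = exp (h r)"
proof -
  obtain k where k: "continuous_on UNIV k" "\<And>r. g r = exp (k r)"
    using continuous_logarithm_on_contractible[OF assms(1) convex_imp_contractible[OF convex_UNIV] assms(2)]
    by auto
  show ?thesis
  proof
    show "continuous_on UNIV (\<lambda>r. k r - k 0)" by (intro continuous_intros k)
    show "g r = exp (k r - k 0)" for r using k(2)[of r] k(2)[of 0] assms(3) by (simp add: exp_diff)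
  qed simp
qed

text \<open>The values of d lie in 2 pi i times the integers, where distinct points are at least 2
  pi apart, so a continuous d is constant.\<close>

lemma continuous_exp_eq_1_imp_zero:
  fixes d :: "real \<Rightarrow> complex"
  assumes cont: "continuous_on UNIV d" and "d 0 = 0" and e1: "\<And>r. exp (d r) = 1"
  shows "d r = 0"
proof -
  have "d constant_on UNIV"
  proof (rule continuous_discrete_range_constant[OF connected_UNIV cont])
    fix x
    have "2 * pi \<le> norm (d y - d x)" if ne: "d y \<noteq> d x" for y
    proof -
      obtain m where m: "Re (d x) = 0" "Im (d x) = of_int (2 * m) * pi" using e1[of x] by (auto simp: exp_eq_1)
      obtain n where n: "Re (d y) = 0" "Im (d y) = of_int (2 * n) * pi" using e1[of y] by (auto simp: exp_eq_1)
      have "n \<noteq> m" using ne m n by (auto simp: complex_eq_iff)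
      then have "1 \<le> \<bar>of_int (n - m) :: real\<bar>" by (simp flip: of_int_abs)
      then have "2 * pi * 1 \<le> 2 * pi * \<bar>of_int (n - m)\<bar>" by (intro mult_left_mono) auto
      also have "\<dots> = \<bar>2 * pi * of_int (n - m)\<bar>" by (simp add: abs_mult)
      also have "2 * pi * of_int (n - m) = Im (d y - d x)" using m n by (simp add: algebra_simps)
      also have "\<bar>Im (d y - d x)\<bar> \<le> norm (d y - d x)" by (rule abs_Im_le_cmod)
      finally show ?thesis by simp
    qed
    then show "\<exists>e>0. \<forall>y. y \<in> UNIV \<and> d y \<noteq> d x \<longrightarrow> e \<le> norm (d y - d x)"
      by (intro exI[of _ "2 * pi"]) auto
  qed
  then show ?thesis using assms(2) by (metis UNIV_I constant_on_def)
qed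

text \<open>By the case n = 2, f 0 takes values in {0,1}, and continuity with f 0 0 = 1 makes it
  identically 1. Since f s is the n-th power of f (s/n) and f (s/n) tends to f 0, no value is 0 and
  continuous logarithms in r exist. Those of f 1 and f (1/q) are compared, which gives rational s,
  and continuity in s does the rest.\<close>

lemma stable_family_exponent:
  fixes f :: "real \<Rightarrow> real \<Rightarrow> complex"
  assumes pow: "\<And>n s r. n \<ge> 2 \<Longrightarrow> 0 \<le> s \<Longrightarrow> f (real n * s) r = f s r ^ n"
    and cr: "\<And>s. 0 \<le> s \<Longrightarrow> continuous_on UNIV (f s)"
    and cs: "\<And>r. continuous_on {0..} (\<lambda>s. f s r)"
    and f_0: "\<And>s. 0 \<le> s \<Longrightarrow> f s 0 = 1"
  obtains \<psi> where "continuous_on UNIV \<psi>" "\<psi> 0 = 0" "\<And>s r. 0 \<le> s \<Longrightarrow> f s r = exp (of_real s * \<psi> r)"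
proof -
  have pow1: "f (real n * s) r = f s r ^ n" if "n \<ge> 1" "0 \<le> s" for n s r
    using pow[of n s r] that by (cases "n = 1") auto
  have f0: "f 0 r = 1" for r
  proof -
    have "f 0 r \<in> {0,1}" for r
    proof -
      have "f 0 r * f 0 r = f 0 r" using pow[of 2 0 r] by (simp add: power2_eq_square)
      then have "f 0 r * (f 0 r - 1) = 0" by (simp add: right_diff_distrib)
      then show ?thesis by simp
    qed
    then have "range (f 0) \<subseteq> {0,1}" by blast
    then have "finite (range (f 0))" by (rule finite_subset) simp
    then have "f 0 constant_on UNIV"
      by (intro continuous_finite_range_constant[OF connected_UNIV cr]) auto
    then show ?thesis using f_0[of 0] by (metis UNIV_I constant_on_def order_refl)
  qed
  have nz: "f s r \<noteq> 0" if s: "0 \<le> s" for s r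
  proof -
    have "(\<lambda>n. f (s / real (Suc n)) r) \<longlonglongrightarrow> f 0 r"
    proof (rule continuous_on_tendsto_compose[OF cs])
      show "(\<lambda>n. s / real (Suc n)) \<longlonglongrightarrow> 0"
        using tendsto_mult[OF tendsto_const LIMSEQ_inverse_real_of_nat, of s] by (simp add: divide_inverse)
    qed (use s in auto)
    then have "\<forall>\<^sub>F n in sequentially. f (s / real (Suc n)) r \<noteq> 0"
      by (rule tendsto_imp_eventually_ne) (simp add: f0)
    then obtain n where "f (s / real (Suc n)) r \<noteq> 0" by (auto simp: eventually_sequentially)
    moreover have "f s r = f (s / real (Suc n)) r ^ Suc n"
      using pow1[of "Suc n" "s / real (Suc n)" r] s by (simp del: of_nat_Suc)
    ultimately show ?thesis by simp
  qed
  obtain \<psi> where \<psi>: "continuous_on UNIV \<psi>" "\<psi> 0 = 0" "\<And>r. f 1 r = exp (\<psi> r)"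
    using continuous_log_normalised[of "f 1"] cr nz f_0 by auto
  have inv_n: "f (1 / real q) r = exp (\<psi> r / of_nat q)" if q: "q \<ge> 1" for q r
  proof -
    obtain h where h: "continuous_on UNIV h" "h 0 = 0" "\<And>r. f (1 / real q) r = exp (h r)"
      using continuous_log_normalised[of "f (1 / real q)"] cr nz f_0 by auto
    \<comment> \<open>Both q h and \<psi> are continuous logarithms of f 1 that vanish at 0, so they
      agree; this singles out the right q-th root.\<close>
    have "of_nat q * h r - \<psi> r = 0"
    proof (rule continuous_exp_eq_1_imp_zero[of "\<lambda>r. of_nat q * h r - \<psi> r"])
      show "continuous_on UNIV (\<lambda>r. of_nat q * h r - \<psi> r)" by (intro continuous_intros h \<psi>)
      fix r
      have "exp (of_nat q * h r) = f 1 r"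
        using pow1[OF q, of "1 / real q" r] q by (simp add: h(3) exp_of_nat_mult)
      then show "exp (of_nat q * h r - \<psi> r) = 1" using nz[of 1 r] by (simp add: exp_diff \<psi>(3))
    qed (simp add: h \<psi>)
    then have "h r = \<psi> r / of_nat q" using q by (simp add: field_simps)
    then show ?thesis using h(3) by simp
  qed
  have rat: "f (real p / real q) r = exp (of_real (real p / real q) * \<psi> r)" if q: "q \<ge> 1" for p q r
  proof (cases "p = 0")
    case False
    have "f (real p * (1 / real q)) r = exp (\<psi> r / of_nat q) ^ p"
      using pow1[of p "1 / real q" r] False inv_n[OF q] by simp
    then show ?thesis by (simp add: field_simps flip: exp_of_nat_mult)
  qed (simp add: f0)
  show ?thesis
  proof
    fix s r :: real assume s: "0 \<le> s"
    \<comment> \<open>Nonnegative rationals with denominator n + 1 that approach s from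
      below.\<close>
    define t where "t n = real (nat \<lfloor>s * real (Suc n)\<rfloor>) / real (Suc n)" for n
    have t0: "0 \<le> t n" for n by (simp add: t_def)
    have t_lim: "t \<longlonglongrightarrow> s"
    proof (rule tendsto_sandwich[of "\<lambda>n. s - 1 / real (Suc n)" _ _ "\<lambda>_. s"])
      have tn: "t n = of_int \<lfloor>s * real (Suc n)\<rfloor> / real (Suc n)" for n
        using s by (simp add: t_def)
      have "s - 1 / real (Suc n) \<le> t n" for n
      proof -
        have "s * real (Suc n) - 1 \<le> of_int \<lfloor>s * real (Suc n)\<rfloor>" by linarith
        then have "(s * real (Suc n) - 1) / real (Suc n) \<le> t n" unfolding tn by (rule divide_right_mono) simp
        then show ?thesis by (simp add: diff_divide_distrib)
      qed
      then show "\<forall>\<^sub>F n in sequentially. s - 1 / real (Suc n) \<le> t n" by simp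
      have "t n \<le> s" for n
        unfolding tn by (simp add: divide_le_eq)
      then show "\<forall>\<^sub>F n in sequentially. t n \<le> s" by simp
      show "(\<lambda>n. s - 1 / real (Suc n)) \<longlonglongrightarrow> s"
        using tendsto_diff[OF tendsto_const LIMSEQ_inverse_real_of_nat, of s] by (simp add: inverse_eq_divide)
    qed simp
    have "(\<lambda>n. f (t n) r) \<longlonglongrightarrow> f s r"
      by (rule continuous_on_tendsto_compose[OF cs t_lim]) (use s t0 in auto)
    moreover have "f (t n) r = exp (of_real (t n) * \<psi> r)" for n
      unfolding t_def by (rule rat) simp
    moreover have "(\<lambda>n. exp (of_real (t n) * \<psi> r)) \<longlonglongrightarrow> exp (of_real s * \<psi> r)"
      by (intro tendsto_intros t_lim)
    ultimately show "f s r = exp (of_real s * \<psi> r)" using LIMSEQ_unique by auto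
  qed (use \<psi> in auto)
qed

section \<open>Completion of a measure of mass at most 1 by a point mass\<close>

text \<open>P tosses a coin with success probability c = M(space M) and draws from M/c or returns z.
  For c = 0 there is nothing to normalise and the point mass alone serves. The completion makes
  theorems on probability measures available for finite measures; functions vanishing at z do not
  see the added mass.\<close>

lemma exists_mixture_with_point_mass:
  assumes "finite_measure M" "emeasure M (space M) \<le> 1" "z \<in> space M"
  obtains P where "prob_space P" "sets P = sets M"
    "\<And>(g :: 'a \<Rightarrow> complex) B. g \<in> borel_measurable M \<Longrightarrow> (\<And>x. norm (g x) \<le> B) \<Longrightarrow>
      (\<integral>x. g x \<partial>P) = (\<integral>x. g x \<partial>M) + of_real (1 - measure M (space M)) * g z"
    "\<And>A. A \<in> sets M \<Longrightarrow> z \<notin> A \<Longrightarrow> measure P A = measure M A"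
proof -
  interpret M: finite_measure M by fact
  define c where "c = measure M (space M)"
  have c: "0 \<le> c" "c \<le> 1" using assms(2) by (auto simp: c_def M.emeasure_eq_measure)
  show ?thesis
  proof (cases "c = 0")
    case True
    show ?thesis
    proof
      show "prob_space (return M z)" by (rule prob_space_return) fact
      have M0: "AE x in M. False"
        using True by (intro AE_I[of _ _ "space M"]) (auto simp: c_def M.emeasure_eq_measure)
      fix g :: "'a \<Rightarrow> complex" and B assume g: "g \<in> borel_measurable M"
      have "(\<integral>x. g x \<partial>M) = (\<integral>x. 0 \<partial>M)" using g M0 by (intro integral_cong_AE) auto
      then show "(\<integral>x. g x \<partial>return M z) = (\<integral>x. g x \<partial>M) + of_real (1 - measure M (space M)) * g z"
        using True g assms(3) by (simp add: integral_return c_def)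
    next
      fix A assume A: "A \<in> sets M" "z \<notin> A"
      have "measure M A \<le> c" unfolding c_def by (rule M.bounded_measure)
      then show "measure (return M z) A = measure M A" using True A by (simp add: measure_return measure_le_0_iff)
    qed simp
  next
    case False
    then have c0: "0 < c" using c by simp
    define Q where "Q = density M (\<lambda>_. ennreal (1 / c))"
    have Q: "prob_space Q"
    proof (rule prob_spaceI)
      show "emeasure Q (space Q) = 1"
        using c0 by (simp add: Q_def emeasure_density nn_integral_cmult M.emeasure_eq_measure ennreal_mult[symmetric] flip: c_def)
    qed
    define K where "K b = (if b then Q else return M z)" for b
    have K: "K \<in> measurable (measure_pmf (bernoulli_pmf c)) (subprob_algebra M)"
      using Q prob_space_return[OF assms(3)]
      by (auto simp: K_def space_subprob_algebra Q_def prob_space_imp_subprob_space)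
    define P where "P = measure_pmf (bernoulli_pmf c) \<bind> K"
    have sP: "sets P = sets M" unfolding P_def
      by (rule sets_bind[where N=M]) (auto simp: K_def Q_def)
    have P: "prob_space P" unfolding P_def
      by (rule measure_pmf.prob_space_bind[OF _ K])
         (use Q prob_space_return[OF assms(3)] in \<open>auto simp: K_def\<close>)
    have rint: "(\<integral>x. g x \<partial>P) = (\<integral>x. g x \<partial>M) + (1 - c) * g z"
      if g: "g \<in> borel_measurable M" "\<And>x. \<bar>g x\<bar> \<le> B" for g :: "'a \<Rightarrow> real" and B
    proof -
      have "(\<integral>x. g x \<partial>P) = (\<integral>b. \<integral>x. g x \<partial>K b \<partial>measure_pmf (bernoulli_pmf c))"
        unfolding P_def
        by (rule integral_bind[OF g(1) g(2) K, where B'=1])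
           (use Q prob_space_return[OF assms(3)] in
             \<open>auto simp: K_def prob_space.emeasure_space_1 measure_pmf.finite_measure_axioms\<close>)
      also have "\<dots> = (\<integral>x. g x \<partial>Q) * c + g z * (1 - c)"
        using c g(1) assms(3) by (simp add: K_def integral_return)
      also have "(\<integral>x. g x \<partial>Q) * c = (\<integral>x. g x \<partial>M)"
        using c0 g(1) by (simp add: Q_def integral_density)
      finally show ?thesis by simp
    qed
    have int: "(\<integral>x. g x \<partial>P) = (\<integral>x. g x \<partial>M) + of_real (1 - c) * g z"
      if g: "g \<in> borel_measurable M" "\<And>x. norm (g x) \<le> B" for g :: "'a \<Rightarrow> complex" and B
    proof -
      interpret P: prob_space P by (rule P)
      have iM: "integrable M g" by (rule M.integrable_const_bound[where B=B]) (use g in auto)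
      have iP: "integrable P g"
        by (rule P.integrable_const_bound[where B=B]) (use g in \<open>auto simp: measurable_cong_sets[OF sP refl]\<close>)
      have "\<bar>Re (g x)\<bar> \<le> B" "\<bar>Im (g x)\<bar> \<le> B" for x
        using g(2)[of x] abs_Re_le_cmod[of "g x"] abs_Im_le_cmod[of "g x"] by linarith+
      then show ?thesis
        using rint[of "\<lambda>x. Re (g x)" B] rint[of "\<lambda>x. Im (g x)" B] g(1)
        by (simp add: complex_eq_iff integral_Re[OF iM] integral_Re[OF iP] integral_Im[OF iM] integral_Im[OF iP])
    qed
    show ?thesis
    proof
      show "prob_space P" "sets P = sets M" by fact+
      show "(\<integral>x. g x \<partial>P) = (\<integral>x. g x \<partial>M) + of_real (1 - measure M (space M)) * g z"
        if "g \<in> borel_measurable M" "\<And>x. norm (g x) \<le> B" for g :: "'a \<Rightarrow> complex" and B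
        using int[OF that] by (simp add: c_def)
      fix A assume A: "A \<in> sets M" "z \<notin> A"
      have "(\<integral>x. complex_of_real (indicator A x) \<partial>P) = (\<integral>x. complex_of_real (indicator A x) \<partial>M)"
        using int[of "\<lambda>x. complex_of_real (indicator A x)" 1] A by simp
      then have "complex_of_real (measure P A) = complex_of_real (measure M A)"
        using A sP by simp
      then show "measure P A = measure M A" by (simp only: of_real_eq_iff)
    qed
  qed
qed

subsection \<open>Time-stable processes\<close>


lemma mchar_distr:
  assumes "\<And>i. i \<in> I \<Longrightarrow> Y i \<in> borel_measurable M"
  shows "mchar I (distr M (PiM I (\<lambda>_. borel)) (\<lambda>\<omega>. \<lambda>i\<in>I. Y i \<omega>)) u = (\<integral>\<omega>. iexp (\<Sum>i\<in>I. u i * Y i \<omega>) \<partial>M)"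
proof -
  have "(\<lambda>\<omega>. \<lambda>i\<in>I. Y i \<omega>) \<in> measurable M (PiM I (\<lambda>_. borel))"
    using assms by (intro measurable_restrict)
  moreover have "(\<lambda>x. iexp (\<Sum>i\<in>I. u i * x i)) \<in> borel_measurable (PiM I (\<lambda>_. borel))"
    using borel_measurable_linear_form[of "PiM I (\<lambda>_. borel)" I u] by measurable
  ultimately show ?thesis
    unfolding mchar_def by (subst integral_distr) (auto intro!: Bochner_Integration.integral_cong sum.cong)
qed

lemma (in prob_space) integral_iexp_iid_sum:
  fixes n :: nat
  assumes Z: "Z \<in> borel_measurable M"
  shows "(\<integral>\<omega>. iexp (\<Sum>j<n. Z (\<omega> j)) \<partial>PiM {..<n} (\<lambda>_. M)) = (\<integral>\<omega>. iexp (Z \<omega>) \<partial>M) ^ n"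
proof -
  interpret product_sigma_finite "\<lambda>_::nat. M" ..
  have "(\<integral>\<omega>. iexp (\<Sum>j<n. Z (\<omega> j)) \<partial>PiM {..<n} (\<lambda>_. M)) = (\<integral>\<omega>. (\<Prod>j<n. iexp (Z (\<omega> j))) \<partial>PiM {..<n} (\<lambda>_. M))"
    by (simp add: sum_distrib_left exp_sum)
  also have "\<dots> = (\<Prod>j<n. \<integral>\<omega>. iexp (Z \<omega>) \<partial>M)"
    by (rule product_integral_prod) (auto intro!: integrable_iexp_rv Z)
  finally show ?thesis by simp
qed

lemma borel_measurable_iid_sum:
  fixes n :: nat
  assumes "Z \<in> borel_measurable M"
  shows "(\<lambda>\<omega>. \<Sum>j<n. Z (\<omega> j) :: real) \<in> borel_measurable (PiM {..<n} (\<lambda>_. M))"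
  by (intro borel_measurable_sum measurable_compose[OF _ assms] measurable_component_singleton)

lemma time_stableD:
  assumes "time_stable M X"
  shows "prob_space M" "\<And>t. 0 \<le> t \<Longrightarrow> X t \<in> borel_measurable M" "stoch_continuous M X"
  using assms by (auto simp: time_stable_def)

lemma time_stable_fdd:
  fixes n k :: nat
  assumes "time_stable M X" "2 \<le> n" "\<And>i. i < k \<Longrightarrow> 0 \<le> ts i"
  shows "fdd (PiM {..<n} (\<lambda>_. M)) (\<lambda>t \<omega>. \<Sum>j<n. X t (\<omega> j)) k ts = fdd M X k (\<lambda>i. real n * ts i)"
proof -
  have "\<forall>n::nat\<ge>2. \<forall>k ts. (\<forall>i<k. ts i \<ge> 0) \<longrightarrow>
      fdd (PiM {..<n} (\<lambda>_. M)) (\<lambda>t \<omega>. \<Sum>j<n. X t (\<omega> j)) k ts = fdd M X k (\<lambda>i. real n * ts i)"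
    using assms(1) unfolding time_stable_def by (elim conjE)
  with assms(2,3) show ?thesis by simp
qed

lemma borel_measurable_linear_comb:
  fixes Y :: "'i \<Rightarrow> 'a \<Rightarrow> real"
  assumes "\<And>i. i \<in> I \<Longrightarrow> Y i \<in> borel_measurable M"
  shows "(\<lambda>\<omega>. \<Sum>i\<in>I. u i * Y i \<omega>) \<in> borel_measurable M"
  using assms by (intro borel_measurable_sum borel_measurable_times) auto

text \<open>The definition speaks of times listed by \<open>{..<k}\<close>; a bijection carries it
  over to any finite index set. Exchanging the two sums turns the linear form of the summed copies
  into a sum of n independent copies of one linear form.\<close>

lemma time_stable_char_power:
  fixes I :: "'i set" and n :: nat
  assumes ts: "time_stable M X" and I: "finite I" and t0: "\<And>i. i \<in> I \<Longrightarrow> 0 \<le> t i" and n: "2 \<le> n"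
  shows "(\<integral>\<omega>. iexp (\<Sum>i\<in>I. u i * X (real n * t i) \<omega>) \<partial>M) = (\<integral>\<omega>. iexp (\<Sum>i\<in>I. u i * X (t i) \<omega>) \<partial>M) ^ n"
proof -
  interpret prob_space M using time_stableD[OF ts] by auto
  note Xm = time_stableD(2)[OF ts]
  obtain h where h: "bij_betw h {0..<card I} I" using ex_bij_betw_nat_finite[OF I] by blast
  define k where "k = card I"
  have h: "bij_betw h {..<k} I" using h by (simp add: k_def atLeast0LessThan)
  have hI: "h j \<in> I" if "j < k" for j using h that by (auto simp: bij_betw_def)
  have re: "(\<Sum>i\<in>I. g i) = (\<Sum>j<k. g (h j))" for g :: "'i \<Rightarrow> real"
    by (rule sum.reindex_bij_betw[OF h, symmetric])
  let ?N = "PiM {..<n} (\<lambda>_. M)"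
  have Sm: "(\<lambda>\<omega>. \<Sum>j<n. X (t (h l)) (\<omega> j)) \<in> borel_measurable ?N" if "l < k" for l
    by (rule borel_measurable_iid_sum) (use Xm t0 hI that in auto)
  have fdd: "fdd ?N (\<lambda>t \<omega>. \<Sum>j<n. X t (\<omega> j)) k (\<lambda>l. t (h l)) = fdd M X k (\<lambda>l. real n * t (h l))"
    by (rule time_stable_fdd[OF ts n]) (use t0 hI in auto)
  have "(\<integral>\<omega>. iexp (\<Sum>i\<in>I. u i * X (real n * t i) \<omega>) \<partial>M) = mchar {..<k} (fdd M X k (\<lambda>l. real n * t (h l))) (\<lambda>l. u (h l))"
    unfolding fdd_def re by (subst mchar_distr) (use Xm t0 hI in auto)
  also have "\<dots> = (\<integral>\<omega>. iexp (\<Sum>l<k. u (h l) * (\<Sum>j<n. X (t (h l)) (\<omega> j))) \<partial>?N)"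
    unfolding fdd[symmetric] unfolding fdd_def by (subst mchar_distr) (use Sm in auto)
  also have "\<dots> = (\<integral>\<omega>. iexp (\<Sum>j<n. \<Sum>l<k. u (h l) * X (t (h l)) (\<omega> j)) \<partial>?N)"
    by (subst sum.swap) (simp add: sum_distrib_left)
  also have "\<dots> = (\<integral>\<omega>. iexp (\<Sum>l<k. u (h l) * X (t (h l)) \<omega>) \<partial>M) ^ n"
    by (rule integral_iexp_iid_sum) (use Xm t0 hI in \<open>auto intro!: borel_measurable_linear_comb\<close>)
  finally show ?thesis unfolding re .
qed

section \<open>Stochastic continuity expressed through characteristic functions\<close>

lemma norm_iexp_diff_le: "norm (iexp a - iexp b) \<le> \<bar>a - b\<bar>"
proof -
  have "iexp a - iexp b = iexp b * (iexp (a - b) - 1)"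
    by (simp add: right_diff_distrib flip: exp_add)
  then have "norm (iexp a - iexp b) = norm (iexp (a - b) - 1)"
    by (simp add: norm_mult del: of_real_diff)
  also have "\<dots> \<le> \<bar>a - b\<bar>" using iexp_approx1[of "a - b" 0] by simp
  finally show ?thesis .
qed

lemma norm_iexp_diff_le_2: "norm (iexp a - iexp b) \<le> 2"
  using norm_triangle_ineq4[of "iexp a" "iexp b"] by simp

text \<open>The integrand is at most \<bar>u\<bar> \<epsilon> where the increment is at most
  \<epsilon> and never exceeds 2, so convergence in probability becomes convergence in mean.\<close>

lemma stoch_continuous_iexp:
  assumes "prob_space M" and Xm: "\<And>t. 0 \<le> t \<Longrightarrow> X t \<in> borel_measurable M"
    and sc: "stoch_continuous M X"
    and t: "0 \<le> t" "\<And>n. 0 \<le> s n" "s \<longlonglongrightarrow> t"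
  shows "(\<lambda>n. \<integral>\<omega>. norm (iexp (u * X (s n) \<omega>) - iexp (u * X t \<omega>)) \<partial>M) \<longlonglongrightarrow> 0"
proof -
  interpret prob_space M by fact
  have lim: "(\<lambda>n. prob {\<omega>\<in>space M. \<epsilon> < \<bar>X (s n) \<omega> - X t \<omega>\<bar>}) \<longlonglongrightarrow> 0" if "0 < \<epsilon>" for \<epsilon>
  proof -
    let ?D = "\<lambda>s. prob {\<omega>\<in>space M. \<epsilon> < \<bar>X s \<omega> - X t \<omega>\<bar>}"
    \<comment> \<open>The limit in \<open>stoch_continuous\<close> excludes the point t itself.
      Since the probability is 0 there, it is continuity at t, which admits sequences that hit
      t.\<close>
    have D0: "?D t = 0" using that by simp
    have "(?D \<longlongrightarrow> ?D t) (at t within {0..})"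
      using sc that t(1) D0 unfolding stoch_continuous_def by simp
    then have "continuous (at t within {0..}) ?D" by (simp add: continuous_within)
    from continuous_within_tendsto_compose'[OF this _ t(3)] show ?thesis
      using t(2) unfolding D0 by simp
  qed
  have bound: "(\<integral>\<omega>. norm (iexp (u * X s \<omega>) - iexp (u * X t \<omega>)) \<partial>M) \<le>
      \<bar>u\<bar> * \<epsilon> + 2 * prob {\<omega>\<in>space M. \<epsilon> < \<bar>X s \<omega> - X t \<omega>\<bar>}" if "0 < \<epsilon>" "0 \<le> s" for s \<epsilon>
  proof -
    have [measurable]: "X s \<in> borel_measurable M" "X t \<in> borel_measurable M" using Xm t that by auto
    let ?E = "{\<omega>\<in>space M. \<epsilon> < \<bar>X s \<omega> - X t \<omega>\<bar>}"
    have E: "?E \<in> sets M" by measurable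
    have iE: "integrable M (\<lambda>\<omega>. indicator ?E \<omega> :: real)"
      by (rule integrable_const_bound[where B=1]) (use E in auto)
    have "(\<integral>\<omega>. norm (iexp (u * X s \<omega>) - iexp (u * X t \<omega>)) \<partial>M) \<le> (\<integral>\<omega>. \<bar>u\<bar> * \<epsilon> + 2 * indicator ?E \<omega> \<partial>M)"
    proof (rule integral_mono)
      show "integrable M (\<lambda>\<omega>. norm (iexp (u * X s \<omega>) - iexp (u * X t \<omega>)))"
        by (rule integrable_const_bound[where B=2]) (auto intro!: norm_iexp_diff_le_2 simp del: of_real_mult)
      show "integrable M (\<lambda>\<omega>. \<bar>u\<bar> * \<epsilon> + 2 * indicator ?E \<omega>)" using iE by simp
      fix \<omega> assume w: "\<omega> \<in> space M"
      show "norm (iexp (u * X s \<omega>) - iexp (u * X t \<omega>)) \<le> \<bar>u\<bar> * \<epsilon> + 2 * indicator ?E \<omega>"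
      proof (cases "\<omega> \<in> ?E")
        case True
        have "0 \<le> \<bar>u\<bar> * \<epsilon>" using that by simp
        then show ?thesis using True norm_iexp_diff_le_2[of "u * X s \<omega>" "u * X t \<omega>"] by simp
      next
        case False
        have "norm (iexp (u * X s \<omega>) - iexp (u * X t \<omega>)) \<le> \<bar>u * X s \<omega> - u * X t \<omega>\<bar>"
          by (rule norm_iexp_diff_le)
        also have "\<dots> = \<bar>u\<bar> * \<bar>X s \<omega> - X t \<omega>\<bar>" by (simp flip: abs_mult right_diff_distrib)
        also have "\<dots> \<le> \<bar>u\<bar> * \<epsilon>" using False w by (intro mult_left_mono) auto
        finally show ?thesis using False by simp
      qed
    qed
    also have "\<dots> = \<bar>u\<bar> * \<epsilon> + 2 * prob ?E" using iE E by (simp add: prob_space)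
    finally show ?thesis .
  qed
  show ?thesis
  proof (rule LIMSEQ_I)
    fix e :: real assume e: "0 < e"
    \<comment> \<open>The summand 1 keeps the denominator positive for u = 0.\<close>
    define \<epsilon> where "\<epsilon> = e / (2 * (\<bar>u\<bar> + 1))"
    have \<epsilon>: "0 < \<epsilon>" using e by (simp add: \<epsilon>_def)
    have ue: "\<bar>u\<bar> * \<epsilon> < e / 2"
    proof -
      have "\<bar>u\<bar> * \<epsilon> < (\<bar>u\<bar> + 1) * \<epsilon>" using \<epsilon> by simp
      also have "\<dots> = e / 2" by (simp add: \<epsilon>_def field_simps add_pos_nonneg)
      finally show ?thesis .
    qed
    obtain N where N: "\<And>n. n \<ge> N \<Longrightarrow> prob {\<omega>\<in>space M. \<epsilon> < \<bar>X (s n) \<omega> - X t \<omega>\<bar>} < e / 4"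
      using LIMSEQ_D[OF lim[OF \<epsilon>], of "e/4"] e by auto
    show "\<exists>no. \<forall>n\<ge>no. norm ((\<integral>\<omega>. norm (iexp (u * X (s n) \<omega>) - iexp (u * X t \<omega>)) \<partial>M) - 0) < e"
    proof (intro exI[of _ N] allI impI)
      fix n assume "N \<le> n"
      have "0 \<le> (\<integral>\<omega>. norm (iexp (u * X (s n) \<omega>) - iexp (u * X t \<omega>)) \<partial>M)"
        by (intro integral_nonneg_AE) simp
      moreover have "(\<integral>\<omega>. norm (iexp (u * X (s n) \<omega>) - iexp (u * X t \<omega>)) \<partial>M) < e"
        using bound[OF \<epsilon> t(2)[of n]] ue N[OF \<open>N \<le> n\<close>] by linarith
      ultimately show "norm ((\<integral>\<omega>. norm (iexp (u * X (s n) \<omega>) - iexp (u * X t \<omega>)) \<partial>M) - 0) < e" by simp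
    qed
  qed
qed

lemma norm_iexp_sum_diff_le:
  assumes "finite I"
  shows "norm (iexp (\<Sum>i\<in>I. a i) - iexp (\<Sum>i\<in>I. b i)) \<le> (\<Sum>i\<in>I. norm (iexp (a i) - iexp (b i)))"
  using norm_prod_diff[of I "\<lambda>i. iexp (a i)" "\<lambda>i. iexp (b i)"] assms
  by (simp add: sum_distrib_left exp_sum)

text \<open>Writing the exponential of a sum as a product of factors of modulus 1 bounds the
  difference by the sum of the coordinatewise differences, so stochastic continuity of the single
  variables is enough for joint characteristic functions.\<close>

lemma stoch_continuous_linear_iexp:
  fixes I :: "'i set"
  assumes M: "prob_space M" and Xm: "\<And>t. 0 \<le> t \<Longrightarrow> X t \<in> borel_measurable M"
    and sc: "stoch_continuous M X" and I: "finite I"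
    and t: "\<And>i. i \<in> I \<Longrightarrow> 0 \<le> t i" "\<And>n i. i \<in> I \<Longrightarrow> 0 \<le> s n i" "\<And>i. i \<in> I \<Longrightarrow> (\<lambda>n. s n i) \<longlonglongrightarrow> t i"
  shows "(\<lambda>n. \<integral>\<omega>. iexp (\<Sum>i\<in>I. u i * X (s n i) \<omega>) \<partial>M) \<longlonglongrightarrow> (\<integral>\<omega>. iexp (\<Sum>i\<in>I. u i * X (t i) \<omega>) \<partial>M)"
proof -
  interpret prob_space M by fact
  let ?d = "\<lambda>n i. \<integral>\<omega>. norm (iexp (u i * X (s n i) \<omega>) - iexp (u i * X (t i) \<omega>)) \<partial>M"
  have "(\<lambda>n. \<Sum>i\<in>I. ?d n i) \<longlonglongrightarrow> (\<Sum>i\<in>I. 0)"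
    by (intro tendsto_sum stoch_continuous_iexp[OF M Xm sc]) (use t in auto)
  then have lim: "(\<lambda>n. \<Sum>i\<in>I. ?d n i) \<longlonglongrightarrow> 0" by simp
  have "norm ((\<integral>\<omega>. iexp (\<Sum>i\<in>I. u i * X (s n i) \<omega>) \<partial>M) - (\<integral>\<omega>. iexp (\<Sum>i\<in>I. u i * X (t i) \<omega>) \<partial>M)) \<le> (\<Sum>i\<in>I. ?d n i)" for n
  proof -
    have m: "X (s n i) \<in> borel_measurable M" "X (t i) \<in> borel_measurable M" if "i \<in> I" for i
      using Xm t that by auto
    have m': "(\<lambda>\<omega>. \<Sum>i\<in>I. u i * X (s n i) \<omega>) \<in> borel_measurable M" "(\<lambda>\<omega>. \<Sum>i\<in>I. u i * X (t i) \<omega>) \<in> borel_measurable M"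
      using m by (auto intro!: borel_measurable_linear_comb)
    have int: "integrable M (\<lambda>\<omega>. norm (iexp (u i * X (s n i) \<omega>) - iexp (u i * X (t i) \<omega>)))" if "i \<in> I" for i
      by (rule integrable_const_bound[where B=2]) (use m[OF that] in \<open>auto intro!: norm_iexp_diff_le_2 simp del: of_real_mult\<close>)
    have "norm ((\<integral>\<omega>. iexp (\<Sum>i\<in>I. u i * X (s n i) \<omega>) \<partial>M) - (\<integral>\<omega>. iexp (\<Sum>i\<in>I. u i * X (t i) \<omega>) \<partial>M))
      = norm (\<integral>\<omega>. iexp (\<Sum>i\<in>I. u i * X (s n i) \<omega>) - iexp (\<Sum>i\<in>I. u i * X (t i) \<omega>) \<partial>M)"
      by (subst Bochner_Integration.integral_diff) (intro integrable_iexp_rv m' refl)+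
    also have "\<dots> \<le> (\<integral>\<omega>. norm (iexp (\<Sum>i\<in>I. u i * X (s n i) \<omega>) - iexp (\<Sum>i\<in>I. u i * X (t i) \<omega>)) \<partial>M)"
      by (rule integral_norm_bound)
    also have "\<dots> \<le> (\<integral>\<omega>. (\<Sum>i\<in>I. norm (iexp (u i * X (s n i) \<omega>) - iexp (u i * X (t i) \<omega>))) \<partial>M)"
    proof (intro integral_mono norm_iexp_sum_diff_le I)
      show "integrable M (\<lambda>\<omega>. norm (iexp (\<Sum>i\<in>I. u i * X (s n i) \<omega>) - iexp (\<Sum>i\<in>I. u i * X (t i) \<omega>)))"
        by (intro integrable_norm Bochner_Integration.integrable_diff integrable_iexp_rv m')
      show "integrable M (\<lambda>\<omega>. \<Sum>i\<in>I. norm (iexp (u i * X (s n i) \<omega>) - iexp (u i * X (t i) \<omega>)))"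
        using int by (intro Bochner_Integration.integrable_sum)
    qed
    also have "\<dots> = (\<Sum>i\<in>I. ?d n i)" using int by (intro Bochner_Integration.integral_sum)
    finally show ?thesis .
  qed
  then have "(\<lambda>n. (\<integral>\<omega>. iexp (\<Sum>i\<in>I. u i * X (s n i) \<omega>) \<partial>M) - (\<integral>\<omega>. iexp (\<Sum>i\<in>I. u i * X (t i) \<omega>) \<partial>M)) \<longlonglongrightarrow> 0"
    by (intro Lim_null_comparison[OF _ lim]) simp
  then show ?thesis by (simp add: LIM_zero_iff)
qed

lemma (in prob_space) continuous_on_integral_iexp:
  assumes Z: "Z \<in> borel_measurable M"
  shows "continuous_on UNIV (\<lambda>r. \<integral>\<omega>. iexp (r * Z \<omega>) \<partial>M)"
proof -
  have "isCont (char (distr M borel Z)) r" for r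
    by (rule real_distribution.isCont_char[OF real_distribution_distr[OF Z]])
  moreover have "char (distr M borel Z) = (\<lambda>r. \<integral>\<omega>. iexp (r * Z \<omega>) \<partial>M)"
    by (simp add: fun_eq_iff char_def integral_distr Z)
  ultimately show ?thesis by (simp add: continuous_at_imp_continuous_on)
qed

text \<open>One linear form, followed along the ray s \<mapsto> s t, is a family as in
  \<open>stable_family_exponent\<close>. The frequency factor r remains a variable because
  continuity in r selects the branch of the logarithm.\<close>

lemma time_stable_exponent:
  fixes I :: "'i set"
  assumes ts: "time_stable M X" and I: "finite I" and t0: "\<And>i. i \<in> I \<Longrightarrow> 0 \<le> t i"
  obtains \<psi> where "continuous_on UNIV \<psi>" "\<psi> 0 = 0"
    "\<And>s r. 0 \<le> s \<Longrightarrow> (\<integral>\<omega>. iexp (r * (\<Sum>i\<in>I. u i * X (s * t i) \<omega>)) \<partial>M) = exp (of_real s * \<psi> r)"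
proof -
  interpret prob_space M using time_stableD[OF ts] by auto
  note Xm = time_stableD(2)[OF ts]
  have re: "r * (\<Sum>i\<in>I. u i * X (s * t i) \<omega>) = (\<Sum>i\<in>I. (r * u i) * X (s * t i) \<omega>)" for r s \<omega>
    by (simp add: sum_distrib_left mult.assoc)
  define f where "f s r = (\<integral>\<omega>. iexp (r * (\<Sum>i\<in>I. u i * X (s * t i) \<omega>)) \<partial>M)" for s r
  have pow: "f (real n * s) r = f s r ^ n" if "2 \<le> n" "0 \<le> s" for n s r
    unfolding f_def re using time_stable_char_power[OF ts I, of "\<lambda>i. s * t i" n "\<lambda>i. r * u i"] t0 that
    by (simp add: mult.assoc)
  have cr: "continuous_on UNIV (f s)" if "0 \<le> s" for s
    unfolding f_def[abs_def]
    by (intro continuous_on_integral_iexp borel_measurable_linear_comb Xm) (use t0 that in auto)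
  have cs: "continuous_on {0..} (\<lambda>s. f s r)" for r
    unfolding continuous_on_sequentially comp_def
  proof safe
    fix s and a :: real assume a: "\<forall>n. s n \<in> {0..}" "a \<ge> 0" "s \<longlonglongrightarrow> a"
    show "(\<lambda>n. f (s n) r) \<longlonglongrightarrow> f a r"
      unfolding f_def re
      by (rule stoch_continuous_linear_iexp[OF prob_space_axioms Xm time_stableD(3)[OF ts] I])
         (use a t0 in \<open>auto intro!: tendsto_intros\<close>)
  qed
  have "f s 0 = 1" for s by (simp add: f_def prob_space)
  then obtain \<psi> where "continuous_on UNIV \<psi>" "\<psi> 0 = 0" "\<And>s r. 0 \<le> s \<Longrightarrow> f s r = exp (of_real s * \<psi> r)"
    using stable_family_exponent[of f, OF pow cr cs] by blast
  then show ?thesis using that by (simp add: f_def)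
qed

subsection \<open>The Levy--Khintchine formula\<close>


definition sqn :: "'i set \<Rightarrow> ('i \<Rightarrow> real) \<Rightarrow> real" where
  "sqn I x = (\<Sum>i\<in>I. (x i)\<^sup>2)"

text \<open>A continuous substitute for the minimum of 1 and |x|^2, comparable to it up to the
  factor 2 by \<open>wt_bounds\<close>.\<close>

definition wt :: "'i set \<Rightarrow> ('i \<Rightarrow> real) \<Rightarrow> real" where
  "wt I x = sqn I x / (1 + sqn I x)"

abbreviation lform :: "'i set \<Rightarrow> ('i \<Rightarrow> real) \<Rightarrow> ('i \<Rightarrow> real) \<Rightarrow> real" where
  "lform I u x \<equiv> (\<Sum>i\<in>I. u i * x i)"

definition lk_integrand :: "'i set \<Rightarrow> ('i \<Rightarrow> real) \<Rightarrow> ('i \<Rightarrow> real) \<Rightarrow> complex" where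
  "lk_integrand I u x = iexp (lform I u x) - 1
     - \<i> * complex_of_real (lform I u x * (if sqrt (sqn I x) \<le> 1 then 1 else 0))"

text \<open>Centring with the smooth factor 1/(1+|x|^2) instead of an indicator, and removal of the
  quadratic term as well, give a continuous function of third order at 0. Its quotient by
  \<open>wt\<close> is therefore continuous and bounded, as weak convergence requires.\<close>

definition lk_remainder :: "'i set \<Rightarrow> ('i \<Rightarrow> real) \<Rightarrow> ('i \<Rightarrow> real) \<Rightarrow> complex" where
  "lk_remainder I u x = iexp (lform I u x) - 1 - \<i> * complex_of_real (lform I u x / (1 + sqn I x))
     + complex_of_real ((lform I u x)\<^sup>2 / (1 + sqn I x)) / 2"

definition levy_meas :: "'i set \<Rightarrow> ('i \<Rightarrow> real) measure \<Rightarrow> bool" where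
  "levy_meas I \<nu> \<longleftrightarrow> sets \<nu> = sets (PiM I (\<lambda>_. borel)) \<and>
     emeasure \<nu> {x\<in>space \<nu>. \<forall>i\<in>I. x i = 0} = 0 \<and>
     (\<integral>\<^sup>+ x. ennreal (min 1 (sqn I x)) \<partial>\<nu>) < \<infinity>"

lemma sqn_nonneg: "0 \<le> sqn I x" by (simp add: sqn_def sum_nonneg)

lemma wt_bounds: "0 \<le> wt I x" "wt I x \<le> 1" "wt I x \<le> min 1 (sqn I x)" "min 1 (sqn I x) \<le> 2 * wt I x"
proof -
  have S: "0 \<le> sqn I x" by (rule sqn_nonneg)
  then show "0 \<le> wt I x" by (simp add: wt_def)
  show le1: "wt I x \<le> 1" using S by (simp add: wt_def divide_le_eq)
  have "wt I x \<le> sqn I x" using S mult_left_mono[of 1 "1 + sqn I x" "sqn I x"] by (simp add: wt_def divide_le_eq)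
  with le1 show "wt I x \<le> min 1 (sqn I x)" by simp
  show "min 1 (sqn I x) \<le> 2 * wt I x"
  proof (cases "sqn I x \<le> 1")
    case True
    then have "sqn I x * (1 + sqn I x) \<le> sqn I x * 2" using S by (intro mult_left_mono) auto
    then show ?thesis using S True by (simp add: wt_def le_divide_eq mult.commute)
  next
    case False
    then show ?thesis using S by (simp add: wt_def le_divide_eq)
  qed
qed

lemma lform_square_le: "(lform I u x)\<^sup>2 \<le> sqn I u * sqn I x"
  unfolding sqn_def by (rule Cauchy_Schwarz_ineq_sum)

lemma coordinate_square_le: "finite I \<Longrightarrow> i \<in> I \<Longrightarrow> (x i)\<^sup>2 \<le> sqn I x"
  unfolding sqn_def by (rule member_le_sum) auto

lemma measurable_lk [measurable]:
  "sqn I \<in> borel_measurable (PiM I (\<lambda>_. borel))"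
  "wt I \<in> borel_measurable (PiM I (\<lambda>_. borel))"
  "lform I u \<in> borel_measurable (PiM I (\<lambda>_. borel))"
  "lk_integrand I u \<in> borel_measurable (PiM I (\<lambda>_. borel))"
  "lk_remainder I u \<in> borel_measurable (PiM I (\<lambda>_. borel))"
proof -
  show s [measurable]: "sqn I \<in> borel_measurable (PiM I (\<lambda>_. borel))"
    unfolding sqn_def[abs_def] by measurable
  show "wt I \<in> borel_measurable (PiM I (\<lambda>_. borel))"
    unfolding wt_def[abs_def] by measurable
  show l [measurable]: "lform I u \<in> borel_measurable (PiM I (\<lambda>_. borel))"
    by measurable
  show "lk_integrand I u \<in> borel_measurable (PiM I (\<lambda>_. borel))"
    unfolding lk_integrand_def[abs_def] using s l by measurable
  show "lk_remainder I u \<in> borel_measurable (PiM I (\<lambda>_. borel))"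
    unfolding lk_remainder_def[abs_def] using s l by measurable
qed

lemma iexp_second_order: "norm (iexp y - 1 - \<i> * of_real y) \<le> y\<^sup>2 / 2"
  using iexp_approx1[of y 1] by (simp add: numeral_2_eq_2 algebra_simps)

lemma iexp_third_order: "norm (iexp y - 1 - \<i> * of_real y + of_real (y\<^sup>2) / 2) \<le> \<bar>y\<bar> ^ 3 / 6"
proof -
  have "(\<Sum>k\<le>2. (\<i> * complex_of_real y) ^ k / fact k) = 1 + \<i> * of_real y - of_real (y\<^sup>2) / 2"
    by (simp add: numeral_2_eq_2 power2_eq_square algebra_simps)
  then show ?thesis using iexp_approx1[of y 2] by (simp add: algebra_simps fact_numeral eval_nat_numeral)
qed

lemma norm_iexp_minus_1_le_2: "norm (iexp y - 1) \<le> 2"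
  using norm_triangle_ineq4[of "iexp y" 1] by simp

text \<open>Inside the unit ball the second-order Taylor bound and |x|^2 \<le> 2 wt give the
  coefficient |u|^2; outside, the modulus is at most 2 while wt is at least 1/2, which gives
  4.\<close>

lemma norm_lk_integrand_le: "norm (lk_integrand I u x) \<le> (4 + sqn I u) * wt I x"
proof (cases "sqn I x \<le> 1")
  case True
  have "norm (lk_integrand I u x) \<le> (lform I u x)\<^sup>2 / 2"
    using iexp_second_order[of "lform I u x"] True by (simp add: lk_integrand_def)
  also have "\<dots> \<le> sqn I u * (sqn I x / 2)" using lform_square_le[of u x I] by simp
  also have "\<dots> \<le> sqn I u * wt I x"
    using wt_bounds(4)[of I x] True by (intro mult_left_mono sqn_nonneg) auto
  also have "\<dots> \<le> (4 + sqn I u) * wt I x"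
    using wt_bounds(1)[of I x] by (intro mult_right_mono) auto
  finally show ?thesis .
next
  case False
  have "norm (lk_integrand I u x) \<le> 2"
    using norm_iexp_minus_1_le_2[of "lform I u x"] False by (simp add: lk_integrand_def)
  also have "\<dots> \<le> 4 * wt I x" using wt_bounds(4)[of I x] False by simp
  also have "\<dots> \<le> (4 + sqn I u) * wt I x"
    using wt_bounds(1)[of I x] sqn_nonneg[of I u] by (intro mult_right_mono) auto
  finally show ?thesis .
qed

text \<open>Here w * sqrt w behaves like |x|^3 near 0. For S \<le> 1, y has order sqrt w, and
  1/(1+S) = 1 - w shows that the smooth factors alter the third-order Taylor remainder only by y w
  and y^2 w / 2. For S > 1 one has sqrt w \<ge> w \<ge> 1/2, so w * sqrt w \<ge> 1/4 absorbs all
  bounded terms. The polynomial in U is large enough for both cases.\<close>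

lemma lk_remainder_scalar_bound:
  fixes S U y :: real
  assumes S: "0 \<le> S" and U: "0 \<le> U" and y: "y\<^sup>2 \<le> U\<^sup>2 * S"
  defines "w \<equiv> S / (1 + S)"
  shows "norm (iexp y - 1 - \<i> * of_real (y / (1 + S)) + of_real (y\<^sup>2 / (1 + S)) / 2)
    \<le> (8 + 4 * U + 4 * U\<^sup>2 + U ^ 3) * (w * sqrt w)"
proof -
  define m where "m = sqrt w"
  have w0: "0 \<le> w" and w1: "w \<le> 1" using S by (auto simp: w_def)
  have m0: "0 \<le> m" and m1: "m \<le> 1" and mm: "m * m = w" using w0 w1 by (auto simp: m_def)
  have wm: "w \<le> m" using mm m0 m1 mult_left_mono[of m 1 m] by simp
  have chi: "1 / (1 + S) = 1 - w" using S by (simp add: w_def field_simps)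
  have wm0: "0 \<le> w * m" using w0 m0 by simp
  have Up: "0 \<le> U\<^sup>2" "0 \<le> U ^ 3" using U by auto
  have ya: "\<bar>y\<bar> \<le> U * sqrt S"
  proof -
    have "\<bar>y\<bar> \<le> sqrt (U\<^sup>2 * S)" using real_sqrt_le_mono[OF y] by simp
    then show ?thesis using U by (simp add: real_sqrt_mult)
  qed
  show ?thesis
  proof (cases "S \<le> 1")
    case True
    have "S * (1 + S) \<le> S * 2" using S True by (intro mult_left_mono) auto
    then have S2: "S \<le> 2 * w" using S by (simp add: w_def le_divide_eq mult.commute)
    have "sqrt S \<le> sqrt (2 * w)" using S2 by simp
    also have "\<dots> \<le> sqrt (2 * 2 * w)" using w0 by simp
    also have "\<dots> = 2 * m" by (simp add: real_sqrt_mult m_def)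
    finally have "U * sqrt S \<le> U * (2 * m)" using U by (intro mult_left_mono) auto
    with ya have y1: "\<bar>y\<bar> \<le> 2 * U * m" by simp
    have "U\<^sup>2 * S \<le> U\<^sup>2 * (2 * w)" using S2 Up by (intro mult_left_mono) auto
    with y have y2: "y\<^sup>2 \<le> 2 * U\<^sup>2 * w" by simp
    have "\<bar>y\<bar> ^ 3 = \<bar>y\<bar> * y\<^sup>2" by (simp add: eval_nat_numeral abs_mult)
    also have "\<dots> \<le> (2 * U * m) * (2 * U\<^sup>2 * w)" using y1 y2 U m0 by (intro mult_mono) auto
    also have "\<dots> = 4 * (U ^ 3 * (w * m))" by (simp add: eval_nat_numeral)
    finally have y3: "\<bar>y\<bar> ^ 3 / 6 \<le> U ^ 3 * (w * m)" using mult_nonneg_nonneg[OF Up(2) wm0] by linarith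
    have "\<bar>y\<bar> * w \<le> (2 * U * m) * w" using y1 w0 by (rule mult_right_mono)
    then have t2: "\<bar>y\<bar> * w \<le> 2 * U * (w * m)" by (simp add: mult_ac)
    have "y\<^sup>2 * w \<le> (2 * U\<^sup>2 * w) * m" using y2 wm w0 Up by (intro mult_mono) auto
    then have t3: "y\<^sup>2 * w / 2 \<le> U\<^sup>2 * (w * m)" by (simp add: mult_ac)
    have "iexp y - 1 - \<i> * of_real (y / (1 + S)) + of_real (y\<^sup>2 / (1 + S)) / 2
      = (iexp y - 1 - \<i> * of_real y + of_real (y\<^sup>2) / 2) + \<i> * of_real (y * w) - of_real (y\<^sup>2 * w) / 2"
    proof -
      have "y / (1 + S) = y - y * w" "y\<^sup>2 / (1 + S) = y\<^sup>2 - y\<^sup>2 * w"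
        using chi by (metis mult.right_neutral right_diff_distrib times_divide_eq_right)+
      then show ?thesis by (simp only: of_real_diff) (simp add: algebra_simps diff_divide_distrib)
    qed
    also have "norm \<dots> \<le> \<bar>y\<bar> ^ 3 / 6 + \<bar>y\<bar> * w + y\<^sup>2 * w / 2"
    proof (rule order_trans[OF norm_triangle_ineq4 add_mono])
      show "norm (iexp y - 1 - \<i> * of_real y + of_real (y\<^sup>2) / 2 + \<i> * of_real (y * w)) \<le> \<bar>y\<bar> ^ 3 / 6 + \<bar>y\<bar> * w"
        by (rule order_trans[OF norm_triangle_ineq add_mono[OF iexp_third_order]])
           (use w0 in \<open>simp add: norm_mult abs_mult del: of_real_mult\<close>)
      show "norm (complex_of_real (y\<^sup>2 * w) / 2) \<le> y\<^sup>2 * w / 2"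
        using w0 by (simp add: norm_divide del: of_real_mult of_real_power)
    qed
    also have "\<dots> \<le> U ^ 3 * (w * m) + 2 * U * (w * m) + U\<^sup>2 * (w * m)" using y3 t2 t3 by linarith
    also have "\<dots> = (U ^ 3 + 2 * U + U\<^sup>2) * (w * m)" by (simp add: algebra_simps)
    also have "\<dots> \<le> (8 + 4 * U + 4 * U\<^sup>2 + U ^ 3) * (w * m)"
      using U Up wm0 by (intro mult_right_mono) auto
    finally show ?thesis by (simp add: m_def)
  next
    case False
    have w2: "1 / 2 \<le> w" using False by (simp add: w_def field_simps)
    have "1 / 2 * (1 / 2) \<le> w * m" using w2 wm by (intro mult_mono) auto
    then have wm4: "1 \<le> 4 * (w * m)" by simp
    have sS: "sqrt S \<le> 1 + S"
    proof -
      have "sqrt S \<le> S" using False S by (simp add: real_le_lsqrt power2_eq_square mult_le_cancel_left1)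
      then show ?thesis by simp
    qed
    have "\<bar>y\<bar> \<le> U * (1 + S)" using ya mult_left_mono[OF sS U] by linarith
    then have a1: "\<bar>y\<bar> / (1 + S) \<le> U" using S by (simp add: divide_le_eq)
    have "y\<^sup>2 \<le> U\<^sup>2 * (1 + S)" using add_increasing[OF Up(1) y] by (simp add: distrib_left)
    then have a2: "y\<^sup>2 / (1 + S) \<le> U\<^sup>2" using S by (simp add: divide_le_eq)
    have "norm (iexp y - 1 - \<i> * of_real (y / (1 + S)) + of_real (y\<^sup>2 / (1 + S)) / 2)
      \<le> 2 + \<bar>y\<bar> / (1 + S) + y\<^sup>2 / (1 + S) / 2"
    proof (rule order_trans[OF norm_triangle_ineq add_mono])
      show "norm (iexp y - 1 - \<i> * of_real (y / (1 + S))) \<le> 2 + \<bar>y\<bar> / (1 + S)"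
        by (rule order_trans[OF norm_triangle_ineq4 add_mono[OF norm_iexp_minus_1_le_2]])
           (use S in \<open>simp add: norm_mult del: of_real_divide\<close>)
      show "norm (complex_of_real (y\<^sup>2 / (1 + S)) / 2) \<le> y\<^sup>2 / (1 + S) / 2"
        using S by (simp add: norm_divide del: of_real_divide of_real_power)
    qed
    also have "\<dots> \<le> (2 + U + U\<^sup>2) * 1"
    proof -
      have "2 + a + b / 2 \<le> (2 + U + U\<^sup>2) * 1" if "a \<le> U" "b \<le> U\<^sup>2" for a b
        unfolding mult_1_right using that Up(1) by linarith
      then show ?thesis using a1 a2 by blast
    qed
    also have "\<dots> \<le> (2 + U + U\<^sup>2) * (4 * (w * m))" using wm4 U Up by (intro mult_left_mono) auto
    also have "\<dots> = (8 + 4 * U + 4 * U\<^sup>2) * (w * m)" by (simp add: algebra_simps)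
    also have "\<dots> \<le> (8 + 4 * U + 4 * U\<^sup>2 + U ^ 3) * (w * m)"
      using Up wm0 by (intro mult_right_mono) auto
    finally show ?thesis by (simp add: m_def)
  qed
qed

lemma norm_lk_remainder_le:
  obtains C where "0 \<le> C" "\<And>x. norm (lk_remainder I u x) \<le> C * (wt I x * sqrt (wt I x))"
proof
  let ?U = "sqrt (sqn I u)"
  show "0 \<le> 8 + 4 * ?U + 4 * ?U\<^sup>2 + ?U ^ 3" by (simp add: sqn_nonneg)
  show "norm (lk_remainder I u x) \<le> (8 + 4 * ?U + 4 * ?U\<^sup>2 + ?U ^ 3) * (wt I x * sqrt (wt I x))" for x
    unfolding lk_remainder_def wt_def
    by (rule lk_remainder_scalar_bound) (use lform_square_le[of u x I] in \<open>auto simp: sqn_nonneg\<close>)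
qed

lemma continuous_on_sqn: "continuous_on UNIV (sqn I)"
  unfolding sqn_def[abs_def] by (intro continuous_intros continuous_on_product_coordinates)

lemma continuous_on_wt: "continuous_on UNIV (wt I)"
  unfolding wt_def[abs_def] using sqn_nonneg[of I]
  by (intro continuous_intros continuous_on_sqn) (smt (verit))

lemma continuous_on_lk_remainder: "continuous_on UNIV (lk_remainder I u)"
proof -
  have "1 + sqn I x \<noteq> 0" for x using sqn_nonneg[of I x] by linarith
  then show ?thesis
    unfolding lk_remainder_def[abs_def]
    by (intro continuous_intros continuous_on_sqn continuous_on_linear_form) auto
qed

text \<open>At a zero of d the quotient is 0 by the convention on division, and C * sqrt (d x)
  dominates it nearby, so the convention yields the continuous extension.\<close>

lemma continuous_on_quotient_vanishing:
  fixes f :: "'a::topological_space \<Rightarrow> complex"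
  assumes f: "continuous_on UNIV f" and d: "continuous_on UNIV d" and "\<And>x. 0 \<le> d x"
    and bound: "\<And>x. norm (f x) \<le> C * (d x * sqrt (d x))"
  shows "continuous_on UNIV (\<lambda>x. f x / of_real (d x))"
proof -
  have "((\<lambda>y. f y / of_real (d y)) \<longlongrightarrow> f x / of_real (d x)) (at x)" for x
  proof (cases "d x = 0")
    case False
    then show ?thesis
      using f d by (intro tendsto_intros) (auto simp: continuous_on_def)
  next
    case True
    have le: "norm (f y / of_real (d y)) \<le> C * sqrt (d y)" for y
    proof (cases "d y = 0")
      case False
      then have "0 < d y" using assms(3)[of y] by simp
      then show ?thesis using bound[of y] by (simp add: norm_divide divide_le_eq mult_ac)
    qed simp
    have "((\<lambda>y. C * sqrt (d y)) \<longlongrightarrow> C * sqrt (d x)) (at x)"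
      using d by (intro tendsto_intros) (auto simp: continuous_on_def)
    then have "((\<lambda>y. f y / of_real (d y)) \<longlongrightarrow> 0) (at x)"
      using True by (intro Lim_null_comparison[OF always_eventually[OF allI[OF le]]]) simp
    then show ?thesis using True by simp
  qed
  then show ?thesis by (simp add: continuous_on_def)
qed

lemma levy_meas_integrable_wt:
  assumes "levy_meas I \<nu>"
  shows "integrable \<nu> (wt I)"
proof -
  have s: "sets \<nu> = sets (PiM I (\<lambda>_. borel))" and fin: "(\<integral>\<^sup>+ x. ennreal (min 1 (sqn I x)) \<partial>\<nu>) < \<infinity>"
    using assms by (auto simp: levy_meas_def)
  have "(\<integral>\<^sup>+ x. ennreal (wt I x) \<partial>\<nu>) \<le> (\<integral>\<^sup>+ x. ennreal (min 1 (sqn I x)) \<partial>\<nu>)"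
    by (intro nn_integral_mono ennreal_leI wt_bounds)
  then show ?thesis
    using fin by (intro integrableI_bounded) (auto simp: measurable_cong_sets[OF s refl] wt_bounds)
qed

lemma levy_meas_integrable:
  fixes f :: "('i \<Rightarrow> real) \<Rightarrow> 'b::{banach,second_countable_topology}"
  assumes "levy_meas I \<nu>" "f \<in> borel_measurable (PiM I (\<lambda>_. borel))" "\<And>x. norm (f x) \<le> c * wt I x"
  shows "integrable \<nu> f"
proof (rule Bochner_Integration.integrable_bound)
  show "integrable \<nu> (\<lambda>x. c * wt I x)" using levy_meas_integrable_wt[OF assms(1)] by simp
  have s: "sets \<nu> = sets (PiM I (\<lambda>_. borel))" using assms(1) by (simp add: levy_meas_def)
  show "f \<in> borel_measurable \<nu>" using assms(2) by (simp add: measurable_cong_sets[OF s refl])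
  show "AE x in \<nu>. norm (f x) \<le> norm (c * wt I x)"
    using order_trans[OF assms(3) abs_ge_self] by simp
qed

lemma levy_meas_integrable_lk:
  "levy_meas I \<nu> \<Longrightarrow> integrable \<nu> (lk_integrand I u)"
  by (rule levy_meas_integrable[OF _ _ norm_lk_integrand_le]) measurable

text \<open>There is no mass at the origin because there K / wt I x = K / 0 = 0.\<close>

lemma levy_meas_density:
  assumes P: "prob_space P" "sets P = sets (PiM I (\<lambda>_. borel))" and K: "0 \<le> K"
  shows "levy_meas I (density P (\<lambda>x. ennreal (K / wt I x)))"
proof -
  interpret prob_space P by fact
  have [measurable]: "wt I \<in> borel_measurable P" "sqn I \<in> borel_measurable P"
    by (simp_all add: measurable_cong_sets[OF P(2) refl])
  show ?thesis
    unfolding levy_meas_def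
  proof (intro conjI)
    show "sets (density P (\<lambda>x. ennreal (K / wt I x))) = sets (PiM I (\<lambda>_. borel))" by (simp add: P)
    have z: "{x\<in>space P. \<forall>i\<in>I. x i = 0} \<subseteq> {x\<in>space P. wt I x = 0}"
      by (auto simp: wt_def sqn_def)
    have "emeasure (density P (\<lambda>x. ennreal (K / wt I x))) {x\<in>space P. wt I x = 0}
      = (\<integral>\<^sup>+x. ennreal (K / wt I x) * indicator {x\<in>space P. wt I x = 0} x \<partial>P)"
      by (rule emeasure_density) measurable
    also have "\<dots> = (\<integral>\<^sup>+x. 0 \<partial>P)" by (intro nn_integral_cong) (auto simp: indicator_def)
    finally show "emeasure (density P (\<lambda>x. ennreal (K / wt I x))) {x\<in>space (density P (\<lambda>x. ennreal (K / wt I x))). \<forall>i\<in>I. x i = 0} = 0"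
      using emeasure_mono[OF z, of "density P (\<lambda>x. ennreal (K / wt I x))"] by simp
    have "(\<integral>\<^sup>+ x. ennreal (min 1 (sqn I x)) \<partial>density P (\<lambda>x. ennreal (K / wt I x)))
      = (\<integral>\<^sup>+ x. ennreal (K / wt I x) * ennreal (min 1 (sqn I x)) \<partial>P)"
      by (rule nn_integral_density) measurable
    also have "\<dots> \<le> (\<integral>\<^sup>+ x. ennreal (2 * K) \<partial>P)"
    proof (intro nn_integral_mono)
      fix x
      have "K / wt I x * min 1 (sqn I x) \<le> 2 * K"
      proof (cases "wt I x = 0")
        case False
        then have w: "0 < wt I x" using wt_bounds(1)[of I x] by simp
        have "K / wt I x * min 1 (sqn I x) \<le> K / wt I x * (2 * wt I x)"
          using K w wt_bounds(4)[of I x] by (intro mult_left_mono) auto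
        then show ?thesis using w by simp
      qed (use K in simp)
      then show "ennreal (K / wt I x) * ennreal (min 1 (sqn I x)) \<le> ennreal (2 * K)"
        using K wt_bounds(1)[of I x] sqn_nonneg[of I x] by (simp flip: ennreal_mult add: ennreal_leI)
    qed
    also have "\<dots> < \<infinity>" by (simp add: emeasure_space_1)
    finally show "(\<integral>\<^sup>+ x. ennreal (min 1 (sqn I x)) \<partial>density P (\<lambda>x. ennreal (K / wt I x))) < \<infinity>" .
  qed
qed

lemma lk_remainder_split:
  "lk_remainder I u x = lk_integrand I u x
     + \<i> * (\<Sum>i\<in>I. of_real (u i) * of_real (x i * ((if sqrt (sqn I x) \<le> 1 then 1 else 0) - 1 / (1 + sqn I x))))
     + (\<Sum>i\<in>I. \<Sum>j\<in>I. of_real (u i * u j) * of_real (x i * x j / (1 + sqn I x))) / 2"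
proof -
  define e :: real where "e = (if sqrt (sqn I x) \<le> 1 then 1 else 0)"
  define c where "c = 1 / (1 + sqn I x)"
  have 1: "(\<Sum>i\<in>I. complex_of_real (u i) * of_real (x i * (e - c))) = of_real (lform I u x) * of_real (e - c)"
    unfolding of_real_sum sum_distrib_right by (simp add: mult_ac)
  have 2: "(\<Sum>i\<in>I. \<Sum>j\<in>I. complex_of_real (u i * u j) * of_real (x i * x j / (1 + sqn I x))) = of_real ((lform I u x)\<^sup>2 * c)"
    unfolding power2_eq_square sum_product by (simp add: sum_distrib_right sum_distrib_left c_def mult_ac)
  show ?thesis
    unfolding lk_remainder_def lk_integrand_def e_def[symmetric] c_def[symmetric] 1 2
    by (simp add: algebra_simps c_def)
qed

text \<open>A change of centring only shifts the drift and the matrix. The coefficients \<tau> and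
  \<kappa> are the integrals of x_i times the difference of the two truncation factors and of x_i
  x_j/(1+|x|^2); both integrands are bounded by \<open>wt\<close>.\<close>

lemma levy_meas_integral_lk_remainder:
  assumes I: "finite I" and \<nu>: "levy_meas I \<nu>"
  obtains \<tau> :: "'i \<Rightarrow> real" and \<kappa> :: "'i \<Rightarrow> 'i \<Rightarrow> real" where "\<And>i j. \<kappa> i j = \<kappa> j i"
    "\<And>u. (\<integral>x. lk_remainder I u x \<partial>\<nu>) = (\<integral>x. lk_integrand I u x \<partial>\<nu>)
       + \<i> * of_real (\<Sum>i\<in>I. u i * \<tau> i) + of_real (\<Sum>i\<in>I. \<Sum>j\<in>I. u i * u j * \<kappa> i j) / 2"
proof -
  define f where "f i x = x i * ((if sqrt (sqn I x) \<le> 1 then 1 else 0) - 1 / (1 + sqn I x))" for i x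
  define g where "g i j x = x i * x j / (1 + sqn I x)" for i j and x :: "'i \<Rightarrow> real"
  have xi: "\<bar>x i\<bar> \<le> sqrt (sqn I x)" if "i \<in> I" for i x
    using real_sqrt_le_mono[OF coordinate_square_le[OF I that, of x]] by simp
  have pos: "0 < 1 + sqn I x" for x using sqn_nonneg[of I x] by simp
  have "integrable \<nu> (f i)" if i: "i \<in> I" for i
  proof (rule levy_meas_integrable[OF \<nu>])
    show "f i \<in> borel_measurable (PiM I (\<lambda>_. borel))"
      unfolding f_def[abs_def] using i by measurable
    show "norm (f i x) \<le> 1 * wt I x" for x
    proof (cases "sqrt (sqn I x) \<le> 1")
      case True
      have "1 - 1 / (1 + sqn I x) = wt I x" using pos[of x] by (simp add: wt_def field_simps)
      then have "norm (f i x) = \<bar>x i\<bar> * wt I x" using True wt_bounds(1)[of I x] by (simp add: f_def abs_mult)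
      also have "\<dots> \<le> 1 * wt I x"
        by (rule mult_right_mono[OF order_trans[OF xi[OF i] True] wt_bounds(1)])
      finally show ?thesis .
    next
      case False
      define q where "q = sqrt (sqn I x)"
      have q: "1 < q" "q\<^sup>2 = sqn I x" using False sqn_nonneg[of I x] by (auto simp: q_def)
      have "norm (f i x) = \<bar>x i\<bar> / (1 + sqn I x)" using False pos[of x] by (simp add: f_def abs_mult)
      also have "\<dots> \<le> q / (1 + sqn I x)" using xi[OF i, of x] pos[of x] by (intro divide_right_mono) (auto simp: q_def)
      also have "\<dots> \<le> q\<^sup>2 / (1 + sqn I x)" using q(1) pos[of x]
        by (intro divide_right_mono) (auto simp: power2_eq_square mult_le_cancel_left1)
      finally show ?thesis by (simp add: wt_def q)
    qed
  qed
  moreover have "integrable \<nu> (g i j)" if ij: "i \<in> I" "j \<in> I" for i j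
  proof (rule levy_meas_integrable[OF \<nu>])
    show "g i j \<in> borel_measurable (PiM I (\<lambda>_. borel))"
      unfolding g_def[abs_def] using ij by measurable
    show "norm (g i j x) \<le> 1 * wt I x" for x
    proof -
      have "\<bar>x i\<bar> * \<bar>x j\<bar> \<le> sqrt (sqn I x) * sqrt (sqn I x)" using xi ij sqn_nonneg[of I x] by (intro mult_mono) auto
      then have "\<bar>x i * x j\<bar> \<le> sqn I x" using sqn_nonneg[of I x] by (simp add: abs_mult)
      then show ?thesis using pos[of x] by (simp add: g_def wt_def divide_right_mono)
    qed
  qed
  ultimately have eq: "(\<integral>x. lk_remainder I u x \<partial>\<nu>) = (\<integral>x. lk_integrand I u x \<partial>\<nu>)
       + \<i> * (\<Sum>i\<in>I. of_real (u i) * of_real (\<integral>x. f i x \<partial>\<nu>))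
       + (\<Sum>i\<in>I. \<Sum>j\<in>I. of_real (u i * u j) * of_real (\<integral>x. g i j x \<partial>\<nu>)) / 2" for u
    unfolding lk_remainder_split f_def[symmetric] g_def[symmetric]
    by (simp add: levy_meas_integrable_lk[OF \<nu>])
  show ?thesis
  proof
    show "(\<integral>x. g i j x \<partial>\<nu>) = (\<integral>x. g j i x \<partial>\<nu>)" for i j by (simp add: g_def mult.commute)
    show "(\<integral>x. lk_remainder I u x \<partial>\<nu>) = (\<integral>x. lk_integrand I u x \<partial>\<nu>)
       + \<i> * of_real (\<Sum>i\<in>I. u i * (\<integral>x. f i x \<partial>\<nu>)) + of_real (\<Sum>i\<in>I. \<Sum>j\<in>I. u i * u j * (\<integral>x. g i j x \<partial>\<nu>)) / 2" for u
      unfolding eq by simp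
  qed
qed


section \<open>The exponent as a limit over n-th roots\<close>

lemma norm_exp_minus_1_le: "norm (exp z - 1) \<le> exp (norm z) * norm (z :: complex)"
proof -
  have "norm (exp z - 1) \<le> exp \<bar>Re z\<bar> * norm z" using Taylor_exp[of z 0] by simp
  also have "\<dots> \<le> exp (norm z) * norm z"
    using abs_Re_le_cmod[of z] by (intro mult_right_mono) auto
  finally show ?thesis .
qed

lemma exp_scaled_tendsto:
  fixes z :: complex
  shows "(\<lambda>n. of_nat (Suc n) * (exp (z / of_nat (Suc n)) - 1)) \<longlonglongrightarrow> z"
proof (cases "z = 0")
  case False
  have "((\<lambda>h. (exp h - 1) / h) \<longlongrightarrow> 1) (at (0::complex))"
    using DERIV_exp[of "0::complex"] by (simp add: DERIV_def)
  moreover have "filterlim (\<lambda>n. z / of_nat (Suc n)) (at 0) sequentially"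
    unfolding filterlim_at
  proof
    show "\<forall>\<^sub>F n in sequentially. z / of_nat (Suc n) \<in> UNIV \<and> z / of_nat (Suc n) \<noteq> 0"
      using False by (simp del: of_nat_Suc)
    show "(\<lambda>n. z / of_nat (Suc n)) \<longlonglongrightarrow> 0"
      using tendsto_mult[OF tendsto_const tendsto_of_real[OF LIMSEQ_inverse_real_of_nat], of z]
      by (simp add: divide_inverse del: of_nat_Suc)
  qed
  ultimately have "(\<lambda>n. (exp (z / of_nat (Suc n)) - 1) / (z / of_nat (Suc n))) \<longlonglongrightarrow> 1"
    by (rule filterlim_compose)
  from tendsto_mult[OF tendsto_const this, of z]
  have "(\<lambda>n. z * ((exp (z / of_nat (Suc n)) - 1) / (z / of_nat (Suc n)))) \<longlonglongrightarrow> z" by simp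
  moreover have "z * (a / (z / N)) = N * a" for a N :: complex using False by (cases "N = 0") auto
  ultimately show ?thesis by (simp only:)
qed simp

text \<open>The measures with density (n/K) wt with respect to the n-th roots are completed to probability
  measures by mass at 0, where the quotient of lk_remainder and wt vanishes. Their weak limit
  determines the remainder term; the linear and quadratic terms then converge because all other
  terms of the exponent do.\<close>

lemma levy_khintchine_of_roots:
  fixes I :: "'i set" and \<mu> :: "nat \<Rightarrow> ('i \<Rightarrow> real) measure"
  assumes I: "finite I"
    and prob: "\<And>n. prob_space (\<mu> n)"
    and sets: "\<And>n. sets (\<mu> n) = sets (PiM I (\<lambda>_. borel))"
    and root: "\<And>n u. mchar I (\<mu> n) u = exp (\<Psi> u / of_nat (Suc n))"
    and \<Psi>_0: "\<Psi> (\<lambda>_. 0) = 0"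
    and cont: "\<And>i. i \<in> I \<Longrightarrow> continuous_on UNIV (\<lambda>r. \<Psi> (\<lambda>j. if j = i then r else 0))"
  obtains b :: "'i \<Rightarrow> real" and A :: "'i \<Rightarrow> 'i \<Rightarrow> real" and \<nu> where
    "levy_meas I \<nu>" "\<And>i j. A i j = A j i"
    "\<And>u. \<Psi> u = \<i> * of_real (\<Sum>i\<in>I. b i * u i) - of_real (\<Sum>i\<in>I. \<Sum>j\<in>I. u i * u j * A i j) / 2
       + (\<integral>x. lk_integrand I u x \<partial>\<nu>)"
proof -
  interpret \<mu>: prob_space "\<mu> n" for n by (rule prob)
  interpret U: prob_space unit_lborel by (rule prob_space_unit_lborel)
  note mc = measurable_cong_sets[OF sets refl]
  define \<psi> where "\<psi> i r = \<Psi> (\<lambda>j. if j = i then r else 0)" for i r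
  have \<psi>_cont: "continuous_on UNIV (\<psi> i)" if "i \<in> I" for i
    using cont[OF that] by (simp add: \<psi>_def[abs_def])
  have \<psi>_0: "\<psi> i 0 = 0" for i using \<Psi>_0 by (simp add: \<psi>_def)
  have coord: "(\<lambda>x. x i) \<in> borel_measurable (\<mu> n)" if "i \<in> I" for i n
    using that by (simp add: mc)
  have coord_char: "(\<integral>x. iexp (r * x i) \<partial>\<mu> n) = exp (\<psi> i r / of_nat (Suc n))" if i: "i \<in> I" for i r n
    using root[of n "\<lambda>j. if j = i then r else 0"]
    unfolding mchar_def sum_single_coordinate[OF I i] by (simp add: \<psi>_def)
  \<comment> \<open>A bound uniform in n: the factor n = Suc n roots is compensated by the division
    of the exponent by the same number. It feeds both the mass bound and the tail bound
    below.\<close>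
  have root_diff: "real (Suc n) * (1 - Re (exp (z / of_nat (Suc n)))) \<le> exp B * B"
    if "norm z \<le> B" for z n B
  proof -
    have N: "real (Suc n) > 0" by simp
    have "1 - Re (exp (z / of_nat (Suc n))) \<le> norm (exp (z / of_nat (Suc n)) - 1)"
      using abs_Re_le_cmod[of "exp (z / of_nat (Suc n)) - 1"] by simp
    also have "\<dots> \<le> exp (norm (z / of_nat (Suc n))) * norm (z / of_nat (Suc n))"
      by (rule norm_exp_minus_1_le)
    also have "norm (z / of_nat (Suc n)) = norm z / real (Suc n)"
      by (simp add: norm_divide del: of_nat_Suc)
    finally have "real (Suc n) * (1 - Re (exp (z / of_nat (Suc n)))) \<le>
        real (Suc n) * (exp (norm z / real (Suc n)) * (norm z / real (Suc n)))"
      using N by (intro mult_left_mono) auto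
    also have "\<dots> = exp (norm z / real (Suc n)) * norm z" using N by simp
    also have "\<dots> \<le> exp B * B"
    proof (intro mult_mono)
      have "norm z / real (Suc n) \<le> norm z" by (simp add: divide_le_eq mult_le_cancel_left1)
      then show "exp (norm z / real (Suc n)) \<le> exp B" using that by simp
    qed (use that in auto)
    finally show ?thesis .
  qed
  have U_meas: "(\<lambda>r. f (r * d)) \<in> borel_measurable unit_lborel"
    if "continuous_on UNIV f" for f :: "real \<Rightarrow> real" and d
  proof (rule measurable_restrict_space1)
    have "continuous_on UNIV (\<lambda>r. f (r * d))"
      by (rule continuous_on_compose2[OF that]) (auto intro!: continuous_intros)
    then show "(\<lambda>r. f (r * d)) \<in> borel_measurable lborel" by (simp add: borel_measurable_continuous_onI)
  qed
  have U_bound: "real (Suc n) * (\<integral>r. 1 - Re (exp (\<psi> i (r * d) / of_nat (Suc n))) \<partial>unit_lborel) \<le> exp B * B"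
    if i: "i \<in> I" and B: "\<And>r. r \<in> {0..1} \<Longrightarrow> norm (\<psi> i (r * d)) \<le> B" for i n d B
  proof -
    let ?f = "\<lambda>r. real (Suc n) * (1 - Re (exp (\<psi> i (r * d) / of_nat (Suc n))))"
    have fm: "?f \<in> borel_measurable unit_lborel"
      by (rule U_meas[of "\<lambda>y. real (Suc n) * (1 - Re (exp (\<psi> i y / of_nat (Suc n))))"])
         (intro continuous_intros \<psi>_cont[OF i], simp del: of_nat_Suc)
    have "norm (exp (\<psi> i r / of_nat (Suc n))) \<le> 1" for r
      using \<mu>.norm_integral_iexp_le_1[of "\<lambda>x. r * x i" n] coord[OF i, of n] coord_char[OF i, of n r] by simp
    then have f0: "0 \<le> ?f r" for r
      using complex_Re_le_cmod[of "exp (\<psi> i (r * d) / of_nat (Suc n))"]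
      by (intro mult_nonneg_nonneg) (auto intro: order_trans)
    have fB: "?f r \<le> exp B * B" if "r \<in> space unit_lborel" for r
      using that by (intro root_diff B) (simp add: space_restrict_space)
    have "(\<integral>r. ?f r \<partial>unit_lborel) \<le> (\<integral>r. exp B * B \<partial>unit_lborel)"
    proof (rule integral_mono)
      show "integrable unit_lborel ?f"
        by (rule U.integrable_const_bound[where B="exp B * B", OF AE_I2 fm]) (use f0 fB in auto)
    qed (use fB in auto)
    then show ?thesis using U.prob_space by simp
  qed

  have tail: "\<exists>R>0. \<forall>n. real (Suc n) * measure (\<mu> n) {x\<in>space (\<mu> n). R < \<bar>x i\<bar>} \<le> \<epsilon>"
    if i: "i \<in> I" and \<epsilon>: "0 < \<epsilon>" for i and \<epsilon> :: real
  proof -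
    \<comment> \<open>48 is 16 from the tail estimate times 3, an upper bound for exp \<eta> when
      \<eta> \<le> 1.\<close>
    define \<eta> where "\<eta> = min 1 (\<epsilon> / 48)"
    have \<eta>: "0 < \<eta>" "\<eta> \<le> 1" "48 * \<eta> \<le> \<epsilon>" using \<epsilon> by (auto simp: \<eta>_def)
    have "(\<psi> i \<longlongrightarrow> \<psi> i 0) (at 0)" using \<psi>_cont[OF i] by (auto simp: continuous_on_def)
    then obtain \<delta> where \<delta>: "0 < \<delta>" "\<And>r. r \<noteq> 0 \<Longrightarrow> \<bar>r\<bar> < \<delta> \<Longrightarrow> norm (\<psi> i r) < \<eta>"
      using LIM_D[of "\<psi> i" 0 0 \<eta>] \<eta>(1) by (auto simp: \<psi>_0)
    define R where "R = 2 / \<delta>"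
    have R: "0 < R" using \<delta> by (simp add: R_def)
    have small: "norm (\<psi> i (r * (1 / R))) \<le> \<eta>" if "r \<in> {0..1}" for r
    proof (cases "r = 0")
      case False
      have "\<bar>r * (1 / R)\<bar> < \<delta>" using that \<delta>(1) mult_right_mono[of r 1 \<delta>] by (simp add: R_def)
      then show ?thesis using False R by (intro less_imp_le \<delta>(2)) auto
    qed (use \<eta> in \<open>simp add: \<psi>_0\<close>)
    have "real (Suc n) * measure (\<mu> n) {x\<in>space (\<mu> n). R < \<bar>x i\<bar>} \<le> \<epsilon>" for n
    proof -
      have "real (Suc n) * measure (\<mu> n) {x\<in>space (\<mu> n). R < \<bar>x i\<bar>} \<le>
        real (Suc n) * (16 * (\<integral>r. 1 - Re (\<integral>x. iexp (r / R * x i) \<partial>\<mu> n) \<partial>unit_lborel))"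
        by (intro mult_left_mono \<mu>.tail_prob_le_integral_iexp coord[OF i] R) auto
      also have "\<dots> = 16 * (real (Suc n) * (\<integral>r. 1 - Re (exp (\<psi> i (r * (1 / R)) / of_nat (Suc n))) \<partial>unit_lborel))"
        unfolding coord_char[OF i] by simp
      also have "\<dots> \<le> 16 * (exp \<eta> * \<eta>)"
        by (intro mult_left_mono U_bound[OF i] small) auto
      also have "\<dots> \<le> 16 * (3 * \<eta>)"
      proof -
        have "exp \<eta> \<le> exp 1" using \<eta> by simp
        then have "exp \<eta> \<le> 3" using exp_le by linarith
        then show ?thesis using \<eta>(1) by (intro mult_left_mono mult_right_mono) auto
      qed
      also have "\<dots> \<le> \<epsilon>" using \<eta>(3) by simp
      finally show ?thesis .
    qed
    then show ?thesis using R by blast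
  qed

  have "\<exists>B\<ge>0. \<forall>r\<in>{0..1}. norm (\<psi> i r) \<le> B" if i: "i \<in> I" for i
  proof -
    have "compact (\<psi> i ` {0..1})"
      by (intro compact_continuous_image continuous_on_subset[OF \<psi>_cont[OF i]]) auto
    then obtain B where "\<forall>y\<in>\<psi> i ` {0..1}. norm y \<le> B"
      using compact_imp_bounded bounded_iff by metis
    then show ?thesis by (intro exI[of _ "max 0 B"]) (auto simp: le_max_iff_disj)
  qed
  then obtain B where B: "\<And>i. i \<in> I \<Longrightarrow> 0 \<le> B i" "\<And>i r. i \<in> I \<Longrightarrow> r \<in> {0..1} \<Longrightarrow> norm (\<psi> i r) \<le> B i"
    by metis
  \<comment> \<open>Bounds the mass of the weighted roots, with the 8 of
    \<open>expectation_quadratic_ratio_le\<close> in every coordinate. The leading 1 makes K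
    positive, so that one can divide by it.\<close>
  define K where "K = 1 + (\<Sum>i\<in>I. 8 * (exp (B i) * B i))"
  have K: "0 < K" unfolding K_def using B by (intro add_pos_nonneg sum_nonneg) auto
  have wt_le: "wt I x \<le> (\<Sum>i\<in>I. (x i)\<^sup>2 / (1 + (x i)\<^sup>2))" for x
  proof -
    have "wt I x = (\<Sum>i\<in>I. (x i)\<^sup>2 / (1 + sqn I x))"
      by (simp add: wt_def sqn_def sum_divide_distrib)
    also have "\<dots> \<le> (\<Sum>i\<in>I. (x i)\<^sup>2 / (1 + (x i)\<^sup>2))"
      using coordinate_square_le[OF I, of _ x] by (intro sum_mono divide_left_mono) (auto simp: add_pos_nonneg sqn_nonneg)
    finally show ?thesis .
  qed
  have wt_meas: "wt I \<in> borel_measurable (\<mu> n)" for n by (simp add: mc)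
  have wt_int: "integrable (\<mu> n) (wt I)" for n
    by (rule \<mu>.integrable_const_bound[where B=1]) (use wt_meas in \<open>auto simp: abs_of_nonneg[OF wt_bounds(1)] wt_bounds(2)\<close>)
  have mass: "real (Suc n) * (\<integral>x. wt I x \<partial>\<mu> n) \<le> K" for n
  proof -
    have ci: "integrable (\<mu> n) (\<lambda>x. (x i)\<^sup>2 / (1 + (x i)\<^sup>2))" if "i \<in> I" for i
    proof -
      have "y\<^sup>2 / (1 + y\<^sup>2) \<le> 1" for y :: real by (simp add: divide_le_eq add_pos_nonneg)
      then show ?thesis
        using coord[OF that, of n] by (intro \<mu>.integrable_const_bound[where B=1]) auto
    qed
    have "real (Suc n) * (\<integral>x. wt I x \<partial>\<mu> n) \<le> real (Suc n) * (\<integral>x. (\<Sum>i\<in>I. (x i)\<^sup>2 / (1 + (x i)\<^sup>2)) \<partial>\<mu> n)"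
      by (intro mult_left_mono integral_mono wt_int wt_le Bochner_Integration.integrable_sum ci) auto
    also have "\<dots> = (\<Sum>i\<in>I. real (Suc n) * (\<integral>x. (x i)\<^sup>2 / (1 + (x i)\<^sup>2) \<partial>\<mu> n))"
      using ci by (simp add: sum_distrib_left del: of_nat_Suc)
    also have "\<dots> \<le> (\<Sum>i\<in>I. 8 * (exp (B i) * B i))"
    proof (rule sum_mono)
      fix i assume i: "i \<in> I"
      have "real (Suc n) * (\<integral>x. (x i)\<^sup>2 / (1 + (x i)\<^sup>2) \<partial>\<mu> n) \<le>
        real (Suc n) * (8 * (\<integral>r. 1 - Re (\<integral>x. iexp (r * x i) \<partial>\<mu> n) \<partial>unit_lborel))"
        by (intro mult_left_mono \<mu>.expectation_quadratic_ratio_le coord[OF i]) auto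
      also have "\<dots> = 8 * (real (Suc n) * (\<integral>r. 1 - Re (exp (\<psi> i (r * 1) / of_nat (Suc n))) \<partial>unit_lborel))"
        unfolding coord_char[OF i] by simp
      also have "\<dots> \<le> 8 * (exp (B i) * B i)"
        by (intro mult_left_mono U_bound[OF i]) (use B(2)[OF i] in auto)
      finally show "real (Suc n) * (\<integral>x. (x i)\<^sup>2 / (1 + (x i)\<^sup>2) \<partial>\<mu> n) \<le> 8 * (exp (B i) * B i)" .
    qed
    finally show ?thesis by (simp add: K_def)
  qed

  \<comment> \<open>The origin as an extensional function, as membership in the product space
    demands.\<close>
  define z :: "'i \<Rightarrow> real" where "z = (\<lambda>i\<in>I. 0)"
  have z_space: "z \<in> space (\<mu> n)" for n
    by (simp add: z_def sets_eq_imp_space_eq[OF sets] space_PiM)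
  have z_wt: "wt I z = 0" by (simp add: wt_def sqn_def z_def)
  define D where "D n = density (\<mu> n) (\<lambda>x. ennreal (real (Suc n) / K * wt I x))" for n
  have D_sets: "sets (D n) = sets (PiM I (\<lambda>_. borel))" for n by (simp add: D_def sets)
  have D_mass: "emeasure (D n) (space (D n)) \<le> 1" for n
  proof -
    have "emeasure (D n) (space (D n)) = (\<integral>\<^sup>+x. ennreal (real (Suc n) / K * wt I x) \<partial>\<mu> n)"
      using wt_meas[of n] by (simp add: D_def emeasure_density cong: nn_integral_cong)
    also have "\<dots> = ennreal (\<integral>x. real (Suc n) / K * wt I x \<partial>\<mu> n)"
      using wt_int[of n] K by (intro nn_integral_eq_integral) (auto simp: wt_bounds(1))
    also have "(\<integral>x. real (Suc n) / K * wt I x \<partial>\<mu> n) \<le> 1"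
      using mass[of n] K by (simp add: divide_le_eq del: of_nat_Suc)
    finally show ?thesis by (simp add: ennreal_leI)
  qed
  have D_fin: "finite_measure (D n)" for n
    using D_mass[of n] by (intro finite_measureI) (auto simp: top_unique)
  have "\<exists>P. prob_space P \<and> sets P = sets (D n) \<and>
    (\<forall>(g :: ('i \<Rightarrow> real) \<Rightarrow> complex) B. g \<in> borel_measurable (D n) \<longrightarrow> (\<forall>x. norm (g x) \<le> B) \<longrightarrow>
      (\<integral>x. g x \<partial>P) = (\<integral>x. g x \<partial>D n) + of_real (1 - measure (D n) (space (D n))) * g z) \<and>
    (\<forall>A. A \<in> sets (D n) \<longrightarrow> z \<notin> A \<longrightarrow> measure P A = measure (D n) A)" for n
    using exists_mixture_with_point_mass[OF D_fin D_mass, of z n] z_space[of n] by (auto simp: D_def) metis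
  then obtain P where P: "\<And>n. prob_space (P n)" "\<And>n. sets (P n) = sets (D n)"
    and P_int: "\<And>n (g :: ('i \<Rightarrow> real) \<Rightarrow> complex) B. g \<in> borel_measurable (D n) \<Longrightarrow> (\<And>x. norm (g x) \<le> B) \<Longrightarrow>
      (\<integral>x. g x \<partial>P n) = (\<integral>x. g x \<partial>D n) + of_real (1 - measure (D n) (space (D n))) * g z"
    and P_meas: "\<And>n A. A \<in> sets (D n) \<Longrightarrow> z \<notin> A \<Longrightarrow> measure (P n) A = measure (D n) A"
    by metis
  have P_sets: "sets (P n) = sets (PiM I (\<lambda>_. borel))" for n by (simp add: P D_sets)

  have P_tight: "\<exists>R>0. \<forall>\<^sub>F n in sequentially. measure (P n) {x\<in>space (P n). R < \<bar>x i\<bar>} \<le> \<epsilon>"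
    if i: "i \<in> I" and \<epsilon>: "0 < \<epsilon>" for i and \<epsilon> :: real
  proof -
    obtain R where R: "0 < R" "\<And>n. real (Suc n) * measure (\<mu> n) {x\<in>space (\<mu> n). R < \<bar>x i\<bar>} \<le> K * \<epsilon>"
      using tail[OF i, of "K * \<epsilon>"] K \<epsilon> by auto
    have "measure (P n) {x\<in>space (P n). R < \<bar>x i\<bar>} \<le> \<epsilon>" for n
    proof -
      let ?E = "{x\<in>space (\<mu> n). R < \<bar>x i\<bar>}"
      have sp: "space (P n) = space (\<mu> n)"
        by (simp add: sets_eq_imp_space_eq[OF P_sets] sets_eq_imp_space_eq[OF sets])
      have E: "?E \<in> sets (\<mu> n)" using coord[OF i, of n] by measurable
      \<comment> \<open>The added mass is not seen: z is outside this set because R > 0.\<close>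
      have "measure (P n) ?E = measure (D n) ?E"
        by (rule P_meas) (use E R(1) i in \<open>auto simp: D_def z_def\<close>)
      also have "\<dots> \<le> real (Suc n) / K * measure (\<mu> n) ?E"
      proof -
        have "emeasure (D n) ?E = (\<integral>\<^sup>+x. ennreal (real (Suc n) / K * wt I x) * indicator ?E x \<partial>\<mu> n)"
          unfolding D_def using E wt_meas[of n] by (intro emeasure_density) auto
        also have "\<dots> \<le> (\<integral>\<^sup>+x. ennreal (real (Suc n) / K) * indicator ?E x \<partial>\<mu> n)"
        proof (intro nn_integral_mono mult_right_mono ennreal_leI)
          show "real (Suc n) / K * wt I x \<le> real (Suc n) / K" for x
            using mult_left_mono[OF wt_bounds(2)[of I x], of "real (Suc n) / K"] K by simp
        qed simp
        also have "\<dots> = ennreal (real (Suc n) / K * measure (\<mu> n) ?E)"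
          using E K by (simp add: nn_integral_cmult \<mu>.emeasure_eq_measure ennreal_mult[symmetric] del: of_nat_Suc)
        finally show ?thesis
          using K by (simp add: finite_measure.emeasure_eq_measure[OF D_fin] del: of_nat_Suc)
      qed
      also have "\<dots> \<le> \<epsilon>" using R(2)[of n] K by (simp add: divide_le_eq mult.commute del: of_nat_Suc)
      finally show ?thesis by (simp add: sp)
    qed
    then show ?thesis using R(1) by (intro exI[of _ R]) auto
  qed
  obtain r :: "nat \<Rightarrow> nat" and Q where r: "strict_mono r" and Q: "prob_space Q"
    "sets Q = sets (PiM I (\<lambda>_. borel))" and conv:
    "\<And>(g :: ('i \<Rightarrow> real) \<Rightarrow> complex) B. continuous_on UNIV g \<Longrightarrow> g \<in> borel_measurable (PiM I (\<lambda>_. borel)) \<Longrightarrow>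
       (\<And>x. norm (g x) \<le> B) \<Longrightarrow> (\<lambda>n. \<integral>x. g x \<partial>P (r n)) \<longlonglongrightarrow> (\<integral>x. g x \<partial>Q)"
    using multivariate_helly[OF I P(1) P_sets P_tight] by blast
  \<comment> \<open>The density undoes both the weighting and the normalisation by K. Whatever mass
    Q has at 0 is discarded; its effect is recovered through the quadratic term.\<close>
  define \<nu> where "\<nu> = density Q (\<lambda>x. ennreal (K / wt I x))"
  have \<nu>: "levy_meas I \<nu>" unfolding \<nu>_def using Q K by (intro levy_meas_density) auto

  have rem_conv: "(\<lambda>n. of_nat (Suc (r n)) * (\<integral>x. lk_remainder I u x \<partial>\<mu> (r n))) \<longlonglongrightarrow> (\<integral>x. lk_remainder I u x \<partial>\<nu>)" for u
  proof -
    obtain C where C: "0 \<le> C" "\<And>x. norm (lk_remainder I u x) \<le> C * (wt I x * sqrt (wt I x))"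
      using norm_lk_remainder_le by blast
    define g where "g x = lk_remainder I u x / of_real (wt I x)" for x
    have g_cont: "continuous_on UNIV g" unfolding g_def[abs_def]
      by (rule continuous_on_quotient_vanishing[where C=C])
         (rule continuous_on_lk_remainder continuous_on_wt wt_bounds(1) C(2))+
    have g_meas: "g \<in> borel_measurable (PiM I (\<lambda>_. borel))" unfolding g_def[abs_def] by measurable
    have rem0: "lk_remainder I u x = 0" if "wt I x = 0" for x
      using C(2)[of x] that by simp
    have g_bound: "norm (g x) \<le> C" for x
    proof (cases "wt I x = 0")
      case False
      then have w: "0 < wt I x" using wt_bounds(1)[of I x] by simp
      have "norm (lk_remainder I u x) \<le> C * (wt I x * 1)"
        using C wt_bounds[of I x] by (intro order_trans[OF C(2)] mult_left_mono) auto
      then show ?thesis using w by (simp add: g_def norm_divide divide_le_eq)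
    qed (simp add: g_def C)
    have gz: "g z = 0" by (simp add: g_def z_wt)
    have "of_real K * (\<integral>x. g x \<partial>P n) = of_nat (Suc n) * (\<integral>x. lk_remainder I u x \<partial>\<mu> n)" for n
    proof -
      have "(\<integral>x. g x \<partial>P n) = (\<integral>x. g x \<partial>D n)"
        using P_int[of g n C] g_meas g_bound gz by (simp add: measurable_cong_sets[OF D_sets refl])
      also have "\<dots> = (\<integral>x. (real (Suc n) / K * wt I x) *\<^sub>R g x \<partial>\<mu> n)"
        unfolding D_def using g_meas wt_meas[of n] K wt_bounds(1)[of I]
        by (intro integral_density) (auto simp: mc)
      also have "\<dots> = (\<integral>x. of_real (real (Suc n) / K) * lk_remainder I u x \<partial>\<mu> n)"
        using rem0 by (intro Bochner_Integration.integral_cong refl) (auto simp: g_def scaleR_conv_of_real)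
      also have "\<dots> = of_real (real (Suc n) / K) * (\<integral>x. lk_remainder I u x \<partial>\<mu> n)" by simp
      finally show ?thesis using K by (simp del: of_nat_Suc)
    qed
    moreover have "of_real K * (\<integral>x. g x \<partial>Q) = (\<integral>x. lk_remainder I u x \<partial>\<nu>)"
    proof -
      have "(\<integral>x. lk_remainder I u x \<partial>\<nu>) = (\<integral>x. (K / wt I x) *\<^sub>R lk_remainder I u x \<partial>Q)"
        unfolding \<nu>_def using K wt_bounds(1)[of I]
        by (intro integral_density) (auto simp: measurable_cong_sets[OF Q(2) refl])
      also have "\<dots> = (\<integral>x. of_real K * g x \<partial>Q)"
        by (intro Bochner_Integration.integral_cong refl) (simp add: g_def scaleR_conv_of_real)
      finally show ?thesis by simp
    qed
    moreover have "(\<lambda>n. of_real K * (\<integral>x. g x \<partial>P (r n))) \<longlonglongrightarrow> of_real K * (\<integral>x. g x \<partial>Q)"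
      by (intro tendsto_mult tendsto_const conv[OF g_cont g_meas g_bound])
    ultimately show ?thesis by simp
  qed

  define \<beta> where "\<beta> u n = real (Suc n) * (\<integral>x. lform I u x / (1 + sqn I x) \<partial>\<mu> n)" for u n
  define \<alpha> where "\<alpha> u n = real (Suc n) * (\<integral>x. (lform I u x)\<^sup>2 / (1 + sqn I x) \<partial>\<mu> n)" for u n
  have pos: "0 < 1 + sqn I x" for x using sqn_nonneg[of I x] by simp
  have sq_bound: "(lform I u x)\<^sup>2 / (1 + sqn I x) \<le> sqn I u" for u x
  proof -
    have "(lform I u x)\<^sup>2 \<le> sqn I u * (1 + sqn I x)"
      using lform_square_le[of u x I] sqn_nonneg[of I u] by (simp add: distrib_left)
    then show ?thesis using pos[of x] by (simp add: divide_le_eq)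
  qed
  have int2: "integrable (\<mu> n) (\<lambda>x. (lform I u x)\<^sup>2 / (1 + sqn I x))" for n u
    by (rule \<mu>.integrable_const_bound[where B="sqn I u"])
       (use sq_bound[of u] sqn_nonneg[of I] in \<open>auto simp: mc\<close>)
  have int1: "integrable (\<mu> n) (\<lambda>x. lform I u x / (1 + sqn I x))" for n u
  proof (rule \<mu>.integrable_const_bound[where B="1 + sqn I u"])
    have "\<bar>lform I u x / (1 + sqn I x)\<bar> \<le> 1 + sqn I u" for x
    proof -
      have "\<bar>y\<bar> \<le> 1 + y\<^sup>2" for y :: real
        using zero_le_power2[of "\<bar>y\<bar> - 1"] by (cases "\<bar>y\<bar> \<le> 1") (auto simp: power2_eq_square algebra_simps mult_le_cancel_left1 intro: order_trans[of _ "1 + 0"])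
      then have "\<bar>lform I u x\<bar> / (1 + sqn I x) \<le> (1 + (lform I u x)\<^sup>2) / (1 + sqn I x)"
        using pos[of x] by (intro divide_right_mono) auto
      also have "\<dots> = 1 / (1 + sqn I x) + (lform I u x)\<^sup>2 / (1 + sqn I x)" by (rule add_divide_distrib)
      also have "\<dots> \<le> 1 + sqn I u"
        using sq_bound[of u x] pos[of x] sqn_nonneg[of I x] by (intro add_mono) auto
      finally show ?thesis using pos[of x] by simp
    qed
    then show "AE x in \<mu> n. norm (lform I u x / (1 + sqn I x)) \<le> 1 + sqn I u" by simp
  qed (simp add: mc)
  have decomp: "of_nat (Suc n) * (mchar I (\<mu> n) u - 1) =
    of_nat (Suc n) * (\<integral>x. lk_remainder I u x \<partial>\<mu> n) + \<i> * of_real (\<beta> u n) - of_real (\<alpha> u n) / 2" for n u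
  proof -
    have ie: "integrable (\<mu> n) (\<lambda>x. iexp (lform I u x))"
      by (rule \<mu>.integrable_iexp_rv) (simp add: mc)
    have ilk: "(\<integral>x. lk_remainder I u x \<partial>\<mu> n) = mchar I (\<mu> n) u - 1
      - \<i> * of_real (\<integral>x. lform I u x / (1 + sqn I x) \<partial>\<mu> n) + of_real (\<integral>x. (lform I u x)\<^sup>2 / (1 + sqn I x) \<partial>\<mu> n) / 2"
      unfolding lk_remainder_def mchar_def
      using ie integrable_of_real[OF int1[of n u], where 'a=complex] integrable_of_real[OF int2[of n u], where 'a=complex]
      by (simp add: \<mu>.prob_space del: of_real_sum of_real_divide of_real_mult of_real_power)
    show ?thesis unfolding ilk \<beta>_def \<alpha>_def by (simp add: algebra_simps)
  qed
  define L where "L u = \<Psi> u - (\<integral>x. lk_remainder I u x \<partial>\<nu>)" for u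
  have L_conv: "(\<lambda>n. \<i> * of_real (\<beta> u (r n)) - of_real (\<alpha> u (r n)) / 2) \<longlonglongrightarrow> L u" for u
  proof -
    have "(\<lambda>n. of_nat (Suc (r n)) * (exp (\<Psi> u / of_nat (Suc (r n))) - 1)) \<longlonglongrightarrow> \<Psi> u"
      using LIMSEQ_subseq_LIMSEQ[OF exp_scaled_tendsto r, of "\<Psi> u"] by (simp add: comp_def)
    then have "(\<lambda>n. of_nat (Suc (r n)) * (mchar I (\<mu> (r n)) u - 1)) \<longlonglongrightarrow> \<Psi> u" by (simp only: root)
    from tendsto_diff[OF this rem_conv[of u]] show ?thesis
      unfolding decomp L_def by (simp add: algebra_simps)
  qed
  \<comment> \<open>\<alpha> and \<beta> are real, so real and imaginary parts separate the limits
    of the quadratic and the linear term.\<close>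
  have \<alpha>_conv: "(\<lambda>n. \<alpha> u (r n)) \<longlonglongrightarrow> - 2 * Re (L u)" for u
    using tendsto_mult[OF tendsto_const tendsto_Re[OF L_conv[of u]], of "-2"] by simp
  have \<beta>_conv: "(\<lambda>n. \<beta> u (r n)) \<longlonglongrightarrow> Im (L u)" for u
    using tendsto_Im[OF L_conv[of u]] by simp
  define e where "e i = (\<lambda>j. if j = i then 1 else 0 :: real)" for i :: 'i
  have e_lform: "lform I (e i) x = x i" if "i \<in> I" for i x
    using sum_single_coordinate[OF I that, of 1 x] by (simp add: e_def)
  define b0 where "b0 i = Im (L (e i))" for i
  \<comment> \<open>Polarisation: half of the limit -2 Re L at e i + e j, less the same limits at e
    i and at e j.\<close>
  define A0 where "A0 i j = - Re (L (\<lambda>k. e i k + e j k)) + Re (L (e i)) + Re (L (e j))" for i j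
  have \<beta>_lin: "\<beta> u n = (\<Sum>i\<in>I. u i * \<beta> (e i) n)" for u n
  proof -
    have "(\<integral>x. lform I u x / (1 + sqn I x) \<partial>\<mu> n) = (\<integral>x. (\<Sum>i\<in>I. u i * (lform I (e i) x / (1 + sqn I x))) \<partial>\<mu> n)"
      by (simp add: e_lform sum_divide_distrib)
    also have "\<dots> = (\<Sum>i\<in>I. \<integral>x. u i * (lform I (e i) x / (1 + sqn I x)) \<partial>\<mu> n)"
      by (rule Bochner_Integration.integral_sum) (intro integrable_mult_right int1)
    also have "\<dots> = (\<Sum>i\<in>I. u i * (\<integral>x. lform I (e i) x / (1 + sqn I x) \<partial>\<mu> n))"
      by (simp only: integral_mult_right_zero)
    finally show ?thesis by (simp add: \<beta>_def sum_distrib_left mult_ac)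
  qed
  have L_Im: "Im (L u) = (\<Sum>i\<in>I. u i * b0 i)" for u
  proof (rule LIMSEQ_unique[OF \<beta>_conv])
    show "(\<lambda>n. \<beta> u (r n)) \<longlonglongrightarrow> (\<Sum>i\<in>I. u i * b0 i)"
      unfolding \<beta>_lin[of u] b0_def by (intro tendsto_intros \<beta>_conv)
  qed
  have polar: "p * q / d = ((p + q)\<^sup>2 / d - p\<^sup>2 / d - q\<^sup>2 / d) / 2" for p q d :: real
    by (cases "d = 0") (auto simp: power2_eq_square field_simps)
  define a where "a i j n = real (Suc n) * (\<integral>x. x i * x j / (1 + sqn I x) \<partial>\<mu> n)" for i j n
  have a_eq: "a i j n = (\<alpha> (\<lambda>k. e i k + e j k) n - \<alpha> (e i) n - \<alpha> (e j) n) / 2" if ij: "i \<in> I" "j \<in> I" for i j n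
  proof -
    have eij: "lform I (\<lambda>k. e i k + e j k) x = x i + x j" for x
      using e_lform[OF ij(1), of x] e_lform[OF ij(2), of x] by (simp add: distrib_right sum.distrib)
    have "x i * x j / (1 + sqn I x) = ((lform I (\<lambda>k. e i k + e j k) x)\<^sup>2 / (1 + sqn I x)
      - (lform I (e i) x)\<^sup>2 / (1 + sqn I x) - (lform I (e j) x)\<^sup>2 / (1 + sqn I x)) / 2" for x
      unfolding eij e_lform[OF ij(1)] e_lform[OF ij(2)] by (rule polar)
    moreover have "(\<integral>x. (f x - g x - h x) / 2 \<partial>\<mu> n) = ((\<integral>x. f x \<partial>\<mu> n) - (\<integral>x. g x \<partial>\<mu> n) - (\<integral>x. h x \<partial>\<mu> n)) / 2"
      if "integrable (\<mu> n) f" "integrable (\<mu> n) g" "integrable (\<mu> n) h" for f g h :: "_ \<Rightarrow> real"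
      using that by simp
    note this[OF int2 int2 int2]
    ultimately have "(\<integral>x. x i * x j / (1 + sqn I x) \<partial>\<mu> n) = ((\<integral>x. (lform I (\<lambda>k. e i k + e j k) x)\<^sup>2 / (1 + sqn I x) \<partial>\<mu> n)
      - (\<integral>x. (lform I (e i) x)\<^sup>2 / (1 + sqn I x) \<partial>\<mu> n) - (\<integral>x. (lform I (e j) x)\<^sup>2 / (1 + sqn I x) \<partial>\<mu> n)) / 2"
      by (simp only:)
    then show ?thesis
      unfolding a_def \<alpha>_def by (simp only: right_diff_distrib times_divide_eq_right)
  qed
  have a_conv: "(\<lambda>n. a i j (r n)) \<longlonglongrightarrow> A0 i j" if "i \<in> I" "j \<in> I" for i j
  proof -
    have "(\<lambda>n. (\<alpha> (\<lambda>k. e i k + e j k) (r n) - \<alpha> (e i) (r n) - \<alpha> (e j) (r n)) / 2) \<longlonglongrightarrow>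
      (- 2 * Re (L (\<lambda>k. e i k + e j k)) - (- 2 * Re (L (e i))) - (- 2 * Re (L (e j)))) / 2"
      by (intro tendsto_intros \<alpha>_conv) simp
    moreover have "(- 2 * p - (- 2 * q) - (- 2 * s)) / 2 = - p + q + s" for p q s :: real by simp
    ultimately show ?thesis unfolding a_eq[OF that] A0_def by (simp only:)
  qed
  have \<alpha>_bilin: "\<alpha> u n = (\<Sum>i\<in>I. \<Sum>j\<in>I. u i * u j * a i j n)" for u n
  proof -
    have ia: "integrable (\<mu> n) (\<lambda>x. x i * x j / (1 + sqn I x))" if ij: "i \<in> I" "j \<in> I" for i j
    proof -
      have eij: "lform I (\<lambda>k. e i k + e j k) x = x i + x j" for x
        using e_lform[OF ij(1), of x] e_lform[OF ij(2), of x] by (simp add: distrib_right sum.distrib)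
      have "(\<lambda>x. x i * x j / (1 + sqn I x)) = (\<lambda>x. ((lform I (\<lambda>k. e i k + e j k) x)\<^sup>2 / (1 + sqn I x)
        - (lform I (e i) x)\<^sup>2 / (1 + sqn I x) - (lform I (e j) x)\<^sup>2 / (1 + sqn I x)) / 2)"
        unfolding eij e_lform[OF ij(1)] e_lform[OF ij(2)] by (intro ext polar)
      then show ?thesis using int2 by simp
    qed
    have "(\<integral>x. (lform I u x)\<^sup>2 / (1 + sqn I x) \<partial>\<mu> n) = (\<integral>x. (\<Sum>i\<in>I. \<Sum>j\<in>I. u i * u j * (x i * x j / (1 + sqn I x))) \<partial>\<mu> n)"
      by (simp add: power2_eq_square sum_product sum_divide_distrib mult_ac)
    also have "\<dots> = (\<Sum>i\<in>I. \<Sum>j\<in>I. \<integral>x. u i * u j * (x i * x j / (1 + sqn I x)) \<partial>\<mu> n)"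
      by (subst Bochner_Integration.integral_sum, intro Bochner_Integration.integrable_sum integrable_mult_right ia, assumption+)
         (intro sum.cong refl Bochner_Integration.integral_sum integrable_mult_right ia, assumption+)
    also have "\<dots> = (\<Sum>i\<in>I. \<Sum>j\<in>I. u i * u j * (\<integral>x. x i * x j / (1 + sqn I x) \<partial>\<mu> n))"
      by (simp only: integral_mult_right_zero)
    finally show ?thesis by (simp add: \<alpha>_def a_def sum_distrib_left mult_ac)
  qed
  have L_Re: "- 2 * Re (L u) = (\<Sum>i\<in>I. \<Sum>j\<in>I. u i * u j * A0 i j)" for u
  proof (rule LIMSEQ_unique[OF \<alpha>_conv])
    show "(\<lambda>n. \<alpha> u (r n)) \<longlonglongrightarrow> (\<Sum>i\<in>I. \<Sum>j\<in>I. u i * u j * A0 i j)"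
      unfolding \<alpha>_bilin[of u] by (intro tendsto_intros a_conv)
  qed
  obtain \<tau> :: "'i \<Rightarrow> real" and \<kappa> :: "'i \<Rightarrow> 'i \<Rightarrow> real" where \<kappa>: "\<And>i j. \<kappa> i j = \<kappa> j i"
    "\<And>u. (\<integral>x. lk_remainder I u x \<partial>\<nu>) = (\<integral>x. lk_integrand I u x \<partial>\<nu>)
       + \<i> * of_real (\<Sum>i\<in>I. u i * \<tau> i) + of_real (\<Sum>i\<in>I. \<Sum>j\<in>I. u i * u j * \<kappa> i j) / 2"
    by (rule levy_meas_integral_lk_remainder[OF I \<nu>]) (rule that)
  show ?thesis
  proof
    show "levy_meas I \<nu>" by (rule \<nu>)
    \<comment> \<open>A0 collects the full truncated second moments. Subtracting \<kappa>, the share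
      of the jumps, leaves the Gaussian matrix, and \<tau> corrects the drift for the return to the
      indicator truncation.\<close>
    have "A0 i j = A0 j i" for i j by (simp add: A0_def add.commute)
    then show "A0 i j - \<kappa> i j = A0 j i - \<kappa> j i" for i j using \<kappa>(1)[of i j] by simp
    fix u
    have "L u = \<i> * of_real (\<Sum>i\<in>I. u i * b0 i) - of_real (\<Sum>i\<in>I. \<Sum>j\<in>I. u i * u j * A0 i j) / 2"
      using L_Im[of u] L_Re[of u] by (simp add: complex_eq_iff)
    then have "\<Psi> u = \<i> * of_real (\<Sum>i\<in>I. u i * b0 i) - of_real (\<Sum>i\<in>I. \<Sum>j\<in>I. u i * u j * A0 i j) / 2
      + (\<integral>x. lk_remainder I u x \<partial>\<nu>)" by (simp add: L_def algebra_simps)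
    also have "\<dots> = \<i> * of_real (\<Sum>i\<in>I. (b0 i + \<tau> i) * u i)
      - of_real (\<Sum>i\<in>I. \<Sum>j\<in>I. u i * u j * (A0 i j - \<kappa> i j)) / 2 + (\<integral>x. lk_integrand I u x \<partial>\<nu>)"
      unfolding \<kappa>(2) right_diff_distrib sum_subtractf distrib_right sum.distrib of_real_add of_real_diff
      by (simp add: algebra_simps diff_divide_distrib)
    finally show "\<Psi> u = \<i> * of_real (\<Sum>i\<in>I. (b0 i + \<tau> i) * u i)
      - of_real (\<Sum>i\<in>I. \<Sum>j\<in>I. u i * u j * (A0 i j - \<kappa> i j)) / 2 + (\<integral>x. lk_integrand I u x \<partial>\<nu>)" .
  qed
qed


section \<open>The formula for time-stable processes\<close>

text \<open>The value exp z alone determines z up to multiples of 2 pi i; the values along the ray s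
  z remove this ambiguity by continuity in s.\<close>

lemma exponent_unique:
  fixes z w :: complex
  assumes "\<And>s. 0 \<le> s \<Longrightarrow> exp (of_real s * z) = exp (of_real s * w)"
  shows "z = w"
proof -
  have "of_real 1 * (z - w) = 0"
  proof (rule continuous_exp_eq_1_imp_zero[of "\<lambda>s. of_real s * (z - w)"])
    show "continuous_on UNIV (\<lambda>s. complex_of_real s * (z - w))" by (intro continuous_intros)
    have pos: "exp (of_real s * (z - w)) = 1" if "0 \<le> s" for s
      using assms[OF that] by (simp add: right_diff_distrib exp_diff)
    show "exp (of_real s * (z - w)) = 1" for s
    proof (cases "0 \<le> s")
      case False
      then show ?thesis using pos[of "- s"] by (simp add: exp_minus)
    qed (rule pos)
  qed simp
  then show ?thesis by simp
qed

text \<open>The laws at the times t i / (n+1) are the roots to which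
  \<open>levy_khintchine_of_roots\<close> applies. The factor s is kept in the conclusion because
  one representation along the whole ray is what later identifies the Gaussian part.\<close>

lemma time_stable_levy_khintchine:
  fixes I :: "'i set"
  assumes ts: "time_stable M X" and I: "finite I" and t0: "\<And>i. i \<in> I \<Longrightarrow> 0 \<le> t i"
  obtains b :: "'i \<Rightarrow> real" and A :: "'i \<Rightarrow> 'i \<Rightarrow> real" and \<nu> where
    "levy_meas I \<nu>" "\<And>i j. A i j = A j i"
    "\<And>u s. 0 \<le> s \<Longrightarrow> (\<integral>\<omega>. iexp (\<Sum>i\<in>I. u i * X (s * t i) \<omega>) \<partial>M) =
       exp (of_real s * (\<i> * of_real (\<Sum>i\<in>I. b i * u i) - of_real (\<Sum>i\<in>I. \<Sum>j\<in>I. u i * u j * A i j) / 2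
         + (\<integral>x. lk_integrand I u x \<partial>\<nu>)))"
proof -
  interpret prob_space M using time_stableD[OF ts] by auto
  note Xm = time_stableD(2)[OF ts]
  define Q where "Q u \<psi> \<longleftrightarrow> continuous_on UNIV \<psi> \<and> (\<forall>s r. 0 \<le> s \<longrightarrow>
      (\<integral>\<omega>. iexp (r * (\<Sum>i\<in>I. u i * X (s * t i) \<omega>)) \<partial>M) = exp (of_real s * \<psi> r))" for u \<psi>
  have "\<exists>\<psi>. Q u \<psi>" for u
    unfolding Q_def
    by (rule time_stable_exponent[where u=u, OF ts I t0]) (assumption, intro exI conjI allI impI)
  then obtain \<psi> where "\<And>u. Q u (\<psi> u)" by metis
  then have \<psi>_cont: "\<And>u. continuous_on UNIV (\<psi> u)" and
    \<psi>: "\<And>u s r. 0 \<le> s \<Longrightarrow> (\<integral>\<omega>. iexp (r * (\<Sum>i\<in>I. u i * X (s * t i) \<omega>)) \<partial>M) = exp (of_real s * \<psi> u r)"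
    unfolding Q_def by blast+
  define \<Psi> where "\<Psi> u = \<psi> u 1" for u
  have \<Psi>: "(\<integral>\<omega>. iexp (\<Sum>i\<in>I. u i * X (s * t i) \<omega>) \<partial>M) = exp (of_real s * \<Psi> u)" if "0 \<le> s" for s u
    using \<psi>[OF that, of 1 u] by (simp add: \<Psi>_def)
  define \<mu> where "\<mu> n = distr M (PiM I (\<lambda>_. borel)) (\<lambda>\<omega>. \<lambda>i\<in>I. X (1 / real (Suc n) * t i) \<omega>)" for n
  have m: "X (1 / real (Suc n) * t i) \<in> borel_measurable M" if "i \<in> I" for i n
    using t0[OF that] by (intro Xm) simp
  obtain b A \<nu> where lk: "levy_meas I \<nu>" "\<And>i j. A i j = A j i"
    "\<And>u. \<Psi> u = \<i> * of_real (\<Sum>i\<in>I. b i * u i) - of_real (\<Sum>i\<in>I. \<Sum>j\<in>I. u i * u j * A i j) / 2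
       + (\<integral>x. lk_integrand I u x \<partial>\<nu>)"
  proof (rule levy_khintchine_of_roots[OF I, of \<mu> \<Psi>])
    show "prob_space (\<mu> n)" for n
      unfolding \<mu>_def by (intro prob_space_distr measurable_restrict m)
    show "sets (\<mu> n) = sets (PiM I (\<lambda>_. borel))" for n by (simp add: \<mu>_def)
    show "mchar I (\<mu> n) u = exp (\<Psi> u / of_nat (Suc n))" for n u
      unfolding \<mu>_def using m \<Psi>[of "1 / real (Suc n)" u] by (subst mchar_distr) (auto simp del: of_nat_Suc)
    show "\<Psi> (\<lambda>_. 0) = 0"
      by (rule exponent_unique) (simp add: \<Psi>[symmetric] prob_space)
    show "continuous_on UNIV (\<lambda>r. \<Psi> (\<lambda>j. if j = i then r else 0))" if i: "i \<in> I" for i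
    proof -
      \<comment> \<open>The exponents for different u were chosen independently of each other; along
        an axis, uniqueness ties them to the one continuous function belonging to the unit
        vector.\<close>
      have "\<Psi> (\<lambda>j. if j = i then r else 0) = \<psi> (\<lambda>j. if j = i then 1 else 0) r" for r
      proof (rule exponent_unique)
        fix s :: real assume s: "0 \<le> s"
        show "exp (of_real s * \<Psi> (\<lambda>j. if j = i then r else 0)) = exp (of_real s * \<psi> (\<lambda>j. if j = i then 1 else 0) r)"
          unfolding \<Psi>[OF s, symmetric] \<psi>[OF s, symmetric] sum_single_coordinate[OF I i] by simp
      qed
      then show ?thesis using \<psi>_cont by simp
    qed
  qed (rule that)
  show ?thesis
    by (rule that[OF lk(1,2)]) (simp only: \<Psi> lk(3))
qed

section \<open>Existence of laws with a given drift and Levy measure\<close>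

lemma lk_integral_tendsto_0:
  fixes I :: "'i set"
  assumes I: "finite I" and \<nu>: "levy_meas I \<nu>" and i: "i \<in> I"
  shows "((\<lambda>r. \<integral>x. lk_integrand I (\<lambda>j. if j = i then r else 0) x \<partial>\<nu>) \<longlongrightarrow> 0) (at 0)"
  unfolding tendsto_at_iff_sequentially comp_def
proof (intro allI impI)
  fix r :: "nat \<Rightarrow> real" assume r: "r \<longlonglongrightarrow> 0"
  have s: "sets \<nu> = sets (PiM I (\<lambda>_. borel))" using \<nu> by (simp add: levy_meas_def)
  have "Bseq r" using r by (intro convergent_imp_Bseq) (auto simp: convergent_def)
  then obtain B where B: "0 < B" "\<And>n. \<bar>r n\<bar> \<le> B" by (auto simp: Bseq_def)
  have sq: "sqn I (\<lambda>j. if j = i then r n else 0) \<le> B\<^sup>2" for n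
  proof -
    have "sqn I (\<lambda>j. if j = i then r n else 0) = (r n)\<^sup>2"
      using sum_single_coordinate[OF I i, of "r n" "\<lambda>j. if j = i then r n else 0"]
      by (simp add: sqn_def power2_eq_square)
    also have "\<dots> \<le> B\<^sup>2" using B(2)[of n] by (intro power2_le_iff_abs_le[THEN iffD2]) (use B in auto)
    finally show ?thesis .
  qed
  have "(\<lambda>n. \<integral>x. lk_integrand I (\<lambda>j. if j = i then r n else 0) x \<partial>\<nu>) \<longlonglongrightarrow> (\<integral>x. 0 \<partial>\<nu>)"
  proof (rule integral_dominated_convergence[where w="\<lambda>x. (4 + B\<^sup>2) * wt I x"])
    show "integrable \<nu> (\<lambda>x. (4 + B\<^sup>2) * wt I x)" using levy_meas_integrable_wt[OF \<nu>] by simp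
    show "AE x in \<nu>. norm (lk_integrand I (\<lambda>j. if j = i then r n else 0) x) \<le> (4 + B\<^sup>2) * wt I x" for n
      by (intro AE_I2 order_trans[OF norm_lk_integrand_le] mult_right_mono add_left_mono sq wt_bounds(1))
    show "AE x in \<nu>. (\<lambda>n. lk_integrand I (\<lambda>j. if j = i then r n else 0) x) \<longlonglongrightarrow> 0"
    proof (intro AE_I2)
      fix x
      let ?e = "if sqrt (sqn I x) \<le> 1 then 1 else 0 :: real"
      have "(\<lambda>n. iexp (r n * x i) - 1 - \<i> * complex_of_real (r n * x i * ?e)) \<longlonglongrightarrow>
        iexp (0 * x i) - 1 - \<i> * complex_of_real (0 * x i * ?e)"
        by (intro tendsto_intros r)
      then show "(\<lambda>n. lk_integrand I (\<lambda>j. if j = i then r n else 0) x) \<longlonglongrightarrow> 0"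
        unfolding lk_integrand_def sum_single_coordinate[OF I i] by simp
    qed
  qed (simp_all add: measurable_cong_sets[OF s refl])
  then show "(\<lambda>n. \<integral>x. lk_integrand I (\<lambda>j. if j = i then r n else 0) x \<partial>\<nu>) \<longlonglongrightarrow> 0" by simp
qed

text \<open>Both 1 + \<zeta>/N and exp(\<zeta>/N) lie in the closed unit disc, so their N-th powers
  differ by at most N times their difference, and that difference is of second order in
  \<zeta>/N.\<close>

lemma norm_power_minus_exp_le:
  fixes \<zeta> :: complex and N :: nat
  assumes "norm (1 + \<zeta> / of_nat N) \<le> 1" "Re \<zeta> \<le> 0" "norm \<zeta> \<le> real N" "0 < N"
  shows "norm ((1 + \<zeta> / of_nat N) ^ N - exp \<zeta>) \<le> exp 1 * (norm \<zeta>)\<^sup>2 / real N"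
proof -
  define q where "q = \<zeta> / of_nat N"
  have Nq: "of_nat N * q = \<zeta>" using assms(4) by (simp add: q_def)
  have e1: "norm (exp q) \<le> 1" using assms(2) by (simp add: q_def divide_nonpos_nonneg)
  have nq: "norm q = norm \<zeta> / real N" by (simp add: q_def norm_divide)
  have q1: "norm q \<le> 1" unfolding nq using assms(3,4) by (simp add: divide_le_eq)
  have "norm ((1 + q) ^ N - exp q ^ N) \<le> real N * norm ((1 + q) - exp q)"
    using assms(1) e1 by (intro norm_power_diff) (auto simp: q_def)
  also have "norm ((1 + q) - exp q) = norm (exp q - (1 + q))" by (rule norm_minus_commute)
  also have "\<dots> \<le> exp \<bar>Re q\<bar> * (norm q)\<^sup>2"
    using Taylor_exp[of q 1] by (simp add: numeral_2_eq_2)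
  also have "\<dots> \<le> exp 1 * (norm q)\<^sup>2"
    using abs_Re_le_cmod[of q] q1 by (intro mult_right_mono) auto
  finally have "norm ((1 + q) ^ N - exp q ^ N) \<le> real N * (exp 1 * (norm q)\<^sup>2)" by (simp add: mult_left_mono)
  moreover have "exp q ^ N = exp \<zeta>" using Nq by (simp flip: exp_of_nat_mult)
  moreover have "real N * (exp 1 * (norm q)\<^sup>2) = exp 1 * (norm \<zeta>)\<^sup>2 / real N"
    using assms(4) by (simp add: nq power2_eq_square)
  ultimately show ?thesis by (simp add: q_def)
qed

text \<open>A sum of N independent variables that are 0 with probability 1 - mass/N replaces the
  Poissonian number of jumps.\<close>

lemma compound_poisson_approximation:
  fixes I :: "'i set" and n :: nat
  assumes I: "finite I" and \<nu>: "levy_meas I \<nu>"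
  defines "E \<equiv> {x\<in>space \<nu>. 1 / real (Suc n) < wt I x}"
  obtains \<mu> where "prob_space \<mu>" "sets \<mu> = sets (PiM I (\<lambda>_. borel))"
    "\<And>u. norm (mchar I \<mu> u - exp (\<i> * of_real (\<Sum>i\<in>I. b i * u i) + (\<integral>x. indicator E x *\<^sub>R lk_integrand I u x \<partial>\<nu>)))
        \<le> exp 1 / real (Suc n)"
proof -
  have s: "sets \<nu> = sets (PiM I (\<lambda>_. borel))" using \<nu> by (simp add: levy_meas_def)
  note mc = measurable_cong_sets[OF s refl]
  have sp: "space \<nu> = space (PiM I (\<lambda>_. borel))" by (rule sets_eq_imp_space_eq[OF s])
  have wt_m: "wt I \<in> borel_measurable \<nu>" by (simp add: mc)
  have E: "E \<in> sets \<nu>" unfolding E_def using wt_m by measurable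
  have ind_wt: "indicator E x \<le> real (Suc n) * wt I x" for x
    using wt_bounds(1)[of I x] by (auto simp: E_def indicator_def divide_less_eq mult.commute simp del: of_nat_Suc)
  have intE: "integrable \<nu> (\<lambda>x. indicator E x *\<^sub>R f x)"
    if f: "f \<in> borel_measurable (PiM I (\<lambda>_. borel))" and B: "\<And>x. x \<in> E \<Longrightarrow> norm (f x) \<le> B"
    for f :: "('i \<Rightarrow> real) \<Rightarrow> 'c::{banach,second_countable_topology}" and B
  proof (rule levy_meas_integrable[OF \<nu>])
    show "(\<lambda>x. indicator E x *\<^sub>R f x) \<in> borel_measurable (PiM I (\<lambda>_. borel))"
      using f E by (simp add: s)
    show "norm (indicator E x *\<^sub>R f x) \<le> (max 0 B * real (Suc n)) * wt I x" for x
    proof (cases "x \<in> E")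
      case True
      have "norm (indicator E x *\<^sub>R f x) \<le> max 0 B * 1" using B[OF True] True by simp
      also have "\<dots> \<le> max 0 B * (real (Suc n) * wt I x)"
        using ind_wt[of x] True by (intro mult_left_mono) auto
      finally show ?thesis by (simp add: mult.assoc)
    qed (simp add: wt_bounds(1))
  qed
  define mass where "mass = measure \<nu> E"
  have indE: "integrable \<nu> (\<lambda>x. indicator E x :: real)" using intE[of "\<lambda>_. 1 :: real" 1] by simp
  have E_fin: "emeasure \<nu> E < \<infinity>" using indE E by (simp add: integrable_indicator_iff)
  then have E_em: "emeasure \<nu> E = ennreal mass" unfolding mass_def by (intro emeasure_eq_ennreal_measure) auto
  have mass: "0 \<le> mass" by (simp add: mass_def)
  \<comment> \<open>One N serves three purposes: N > 0; 2 * mass \<le> N, so that mass/N is at most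
    1 and the norm of \<zeta> at most N; and (n+1) * (2 * mass)^2 \<le> N, which makes the error at
    most exp 1/(n+1).\<close>
  obtain N :: nat where N0: "real (Suc n) * (4 * mass\<^sup>2) + 2 * mass + 1 \<le> real N" using real_arch_simple by blast
  have sq0: "0 \<le> real (Suc n) * (4 * mass\<^sup>2)" by simp
  have N: "0 < N" "2 * mass \<le> real N" "real (Suc n) * (4 * mass\<^sup>2) \<le> real N"
  proof -
    have "0 < real N" using N0 mass sq0 by linarith
    then show "0 < N" by simp
  qed (use N0 mass sq0 in linarith)+
  define D where "D = density \<nu> (\<lambda>x. ennreal (indicator E x / real N))"
  have D_mass: "emeasure D (space D) = ennreal (mass / real N)"
  proof -
    have "emeasure D (space D) = (\<integral>\<^sup>+x. ennreal (indicator E x / real N) \<partial>\<nu>)"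
      using E by (simp add: D_def emeasure_density cong: nn_integral_cong)
    also have "\<dots> = (\<integral>\<^sup>+x. ennreal (1 / real N) * indicator E x \<partial>\<nu>)"
      by (intro nn_integral_cong) (auto simp: indicator_def)
    also have "\<dots> = ennreal (1 / real N) * emeasure \<nu> E" using E by (simp add: nn_integral_cmult)
    also have "\<dots> = ennreal (mass / real N)" using mass by (simp add: E_em ennreal_mult[symmetric])
    finally show ?thesis .
  qed
  have D_fin: "finite_measure D" using D_mass by (intro finite_measureI) auto
  have D_le: "emeasure D (space D) \<le> 1" using N mass unfolding D_mass by (simp add: divide_le_eq)
  have D_m: "measure D (space D) = mass / real N" using mass D_mass by (simp add: measure_def)
  define z :: "'i \<Rightarrow> real" where "z = (\<lambda>i\<in>I. 0)"
  have z_sp: "z \<in> space D" by (simp add: D_def sp z_def space_PiM)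
  have D_sets: "sets D = sets (PiM I (\<lambda>_. borel))" by (simp add: D_def s)
  obtain P where P: "prob_space P" "sets P = sets D" and
    P_int: "\<And>(g :: ('i \<Rightarrow> real) \<Rightarrow> complex) B. g \<in> borel_measurable D \<Longrightarrow> (\<And>x. norm (g x) \<le> B) \<Longrightarrow>
      (\<integral>x. g x \<partial>P) = (\<integral>x. g x \<partial>D) + of_real (1 - measure D (space D)) * g z"
    using exists_mixture_with_point_mass[OF D_fin D_le z_sp] by metis
  interpret P: prob_space P by fact
  have P_sets: "sets P = sets (PiM I (\<lambda>_. borel))" by (simp add: P D_sets)
  have P_mc: "f \<in> borel_measurable P" if "f \<in> borel_measurable (PiM I (\<lambda>_. borel))" for f :: "_ \<Rightarrow> real"
    using that by (simp add: measurable_cong_sets[OF P_sets refl])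
  define \<zeta> where "\<zeta> u = (\<integral>x. indicator E x *\<^sub>R (iexp (lform I u x) - 1) \<partial>\<nu>)" for u
  have i1: "integrable \<nu> (\<lambda>x. indicator E x *\<^sub>R (iexp (lform I u x) - 1))" for u
    by (rule intE[of _ 2]) (auto intro!: norm_iexp_minus_1_le_2 simp del: of_real_sum)
  have P_char: "(\<integral>x. iexp (lform I u x) \<partial>P) = 1 + \<zeta> u / of_nat N" for u
  proof -
    have "(\<integral>x. iexp (lform I u x) \<partial>P) = (\<integral>x. iexp (lform I u x) \<partial>D) + of_real (1 - mass / real N)"
      using P_int[of "\<lambda>x. iexp (lform I u x)" 1]
      by (simp add: D_m measurable_cong_sets[OF D_sets refl] z_def del: of_real_sum)
    also have "(\<integral>x. iexp (lform I u x) \<partial>D) = (\<integral>x. (indicator E x / real N) *\<^sub>R iexp (lform I u x) \<partial>\<nu>)"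
      unfolding D_def using E[unfolded s] by (intro integral_density) (auto simp: mc)
    also have "\<dots> = (\<integral>x. (indicator E x *\<^sub>R (iexp (lform I u x) - 1) + of_real (indicator E x)) / of_nat N \<partial>\<nu>)"
      by (intro Bochner_Integration.integral_cong refl) (auto simp: indicator_def scaleR_conv_of_real)
    also have "\<dots> = (\<zeta> u + of_real mass) / of_nat N"
      using i1[of u] integrable_of_real[OF indE, where 'a=complex] E
      by (simp add: \<zeta>_def mass_def)
    finally show ?thesis by (simp add: add_divide_distrib)
  qed
  have \<zeta>_norm: "norm (\<zeta> u) \<le> 2 * mass" for u
  proof -
    have "norm (\<zeta> u) \<le> (\<integral>x. norm (indicator E x *\<^sub>R (iexp (lform I u x) - 1)) \<partial>\<nu>)"
      unfolding \<zeta>_def by (rule integral_norm_bound)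
    also have "\<dots> \<le> (\<integral>x. 2 * indicator E x \<partial>\<nu>)"
    proof (rule integral_mono)
      show "norm (indicator E x *\<^sub>R (iexp (lform I u x) - 1)) \<le> 2 * indicator E x" for x
        using norm_iexp_minus_1_le_2[of "lform I u x"] by (simp add: indicator_def del: of_real_sum)
    qed (use integrable_norm[OF i1] indE in auto)
    also have "\<dots> = 2 * mass" using E by (simp add: mass_def)
    finally show ?thesis .
  qed
  have \<zeta>_Re: "Re (\<zeta> u) \<le> 0" for u
  proof -
    have "norm (1 + \<zeta> u / of_nat N) \<le> 1"
      unfolding P_char[symmetric] by (rule P.norm_integral_iexp_le_1) (simp add: P_mc)
    then have "Re (1 + \<zeta> u / of_nat N) \<le> 1" using complex_Re_le_cmod order_trans by blast
    then show ?thesis using N(1) by (simp add: divide_le_0_iff)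
  qed
  \<comment> \<open>The deterministic shift: the compensator of the retained jumps less the
    prescribed drift. It is subtracted from the sum of the N variables.\<close>
  define c where "c i = (\<integral>x. indicator E x *\<^sub>R (x i * (if sqrt (sqn I x) \<le> 1 then 1 else 0)) \<partial>\<nu>) - b i" for i
  have i2: "integrable \<nu> (\<lambda>x. indicator E x *\<^sub>R (x i * (if sqrt (sqn I x) \<le> 1 then 1 else 0)))" if i: "i \<in> I" for i
  proof (rule intE[of _ 1])
    show "(\<lambda>x. x i * (if sqrt (sqn I x) \<le> 1 then 1 else 0)) \<in> borel_measurable (PiM I (\<lambda>_. borel))"
      using i by measurable
    show "norm (x i * (if sqrt (sqn I x) \<le> 1 then 1 else 0)) \<le> 1" for x :: "'i \<Rightarrow> real"
      using order_trans[of "\<bar>x i\<bar>" "sqrt (sqn I x)" 1] real_sqrt_le_mono[OF coordinate_square_le[OF I i, of x]] by auto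
  qed
  have \<zeta>_lk: "\<zeta> u - \<i> * of_real (\<Sum>i\<in>I. u i * c i) = \<i> * of_real (\<Sum>i\<in>I. b i * u i) + (\<integral>x. indicator E x *\<^sub>R lk_integrand I u x \<partial>\<nu>)" for u
  proof -
    let ?f = "\<lambda>i x. indicator E x *\<^sub>R (x i * (if sqrt (sqn I x) \<le> 1 then 1 else 0)) :: real"
    have "indicator E x *\<^sub>R lk_integrand I u x = indicator E x *\<^sub>R (iexp (lform I u x) - 1) - \<i> * of_real (\<Sum>i\<in>I. u i * ?f i x)" for x
      by (simp add: lk_integrand_def indicator_def)
    then have "(\<integral>x. indicator E x *\<^sub>R lk_integrand I u x \<partial>\<nu>) =
        (\<integral>x. indicator E x *\<^sub>R (iexp (lform I u x) - 1) - \<i> * of_real (\<Sum>i\<in>I. u i * ?f i x) \<partial>\<nu>)" by (simp only:)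
    also have "\<dots> = \<zeta> u - (\<integral>x. \<i> * of_real (\<Sum>i\<in>I. u i * ?f i x) \<partial>\<nu>)"
      unfolding \<zeta>_def
      by (intro Bochner_Integration.integral_diff i1 integrable_mult_right integrable_of_real
            Bochner_Integration.integrable_sum i2)
    also have "(\<integral>x. \<i> * of_real (\<Sum>i\<in>I. u i * ?f i x) \<partial>\<nu>) = \<i> * of_real (\<integral>x. (\<Sum>i\<in>I. u i * ?f i x) \<partial>\<nu>)"
      by (simp only: integral_mult_right_zero integral_complex_of_real)
    also have "(\<integral>x. (\<Sum>i\<in>I. u i * ?f i x) \<partial>\<nu>) = (\<Sum>i\<in>I. u i * (\<integral>x. ?f i x \<partial>\<nu>))"
      by (subst Bochner_Integration.integral_sum) (use i2 in \<open>auto simp only: integral_mult_right_zero intro!: integrable_mult_right\<close>)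
    finally show ?thesis
      by (simp add: c_def right_diff_distrib sum_subtractf mult.commute)
  qed
  let ?M = "PiM {..<N} (\<lambda>_. P)"
  interpret PP: prob_space ?M by (rule prob_space_PiM) (rule P(1))
  define Y where "Y i \<omega> = (\<Sum>j<N. (\<omega> j) i) - c i" for i and \<omega> :: "nat \<Rightarrow> 'i \<Rightarrow> real"
  have Y_m: "Y i \<in> borel_measurable ?M" if "i \<in> I" for i
    unfolding Y_def[abs_def] using that
    by (intro borel_measurable_diff borel_measurable_iid_sum[where Z="\<lambda>x. x i"] P_mc) auto
  define \<mu> where "\<mu> = distr ?M (PiM I (\<lambda>_. borel)) (\<lambda>\<omega>. \<lambda>i\<in>I. Y i \<omega>)"
  show ?thesis
  proof
    show "prob_space \<mu>" unfolding \<mu>_def by (intro PP.prob_space_distr measurable_restrict Y_m)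
    show "sets \<mu> = sets (PiM I (\<lambda>_. borel))" by (simp add: \<mu>_def)
    fix u
    have "mchar I \<mu> u = (\<integral>\<omega>. iexp (\<Sum>i\<in>I. u i * Y i \<omega>) \<partial>?M)"
      unfolding \<mu>_def by (rule mchar_distr) (rule Y_m)
    also have "\<dots> = (\<integral>\<omega>. iexp (\<Sum>j<N. lform I u (\<omega> j)) * iexp (- (\<Sum>i\<in>I. u i * c i)) \<partial>?M)"
    proof -
      have "(\<Sum>i\<in>I. u i * Y i \<omega>) = (\<Sum>j<N. lform I u (\<omega> j)) + - (\<Sum>i\<in>I. u i * c i)" for \<omega>
        by (subst sum.swap) (simp add: Y_def right_diff_distrib sum_subtractf sum_distrib_left)
      then show ?thesis by (simp only: of_real_add distrib_left exp_add)
    qed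
    also have "\<dots> = (1 + \<zeta> u / of_nat N) ^ N * iexp (- (\<Sum>i\<in>I. u i * c i))"
      using P.integral_iexp_iid_sum[of "lform I u" N] by (simp add: P_mc P_char del: of_real_sum)
    finally have mu: "mchar I \<mu> u = (1 + \<zeta> u / of_nat N) ^ N * iexp (- (\<Sum>i\<in>I. u i * c i))" .
    have target: "exp (\<i> * of_real (\<Sum>i\<in>I. b i * u i) + (\<integral>x. indicator E x *\<^sub>R lk_integrand I u x \<partial>\<nu>))
      = exp (\<zeta> u) * iexp (- (\<Sum>i\<in>I. u i * c i))"
      unfolding \<zeta>_lk[symmetric] by (simp add: exp_diff exp_minus divide_inverse del: of_real_sum)
    have "norm (mchar I \<mu> u - exp (\<i> * of_real (\<Sum>i\<in>I. b i * u i) + (\<integral>x. indicator E x *\<^sub>R lk_integrand I u x \<partial>\<nu>)))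
      = norm ((1 + \<zeta> u / of_nat N) ^ N - exp (\<zeta> u)) * norm (iexp (- (\<Sum>i\<in>I. u i * c i)))"
      unfolding mu target by (simp only: left_diff_distrib[symmetric] norm_mult)
    also have "\<dots> = norm ((1 + \<zeta> u / of_nat N) ^ N - exp (\<zeta> u))"
      by (simp only: norm_exp_i_times mult_1_right)
    also have "\<dots> \<le> exp 1 * (norm (\<zeta> u))\<^sup>2 / real N"
    proof (rule norm_power_minus_exp_le)
      show "norm (1 + \<zeta> u / of_nat N) \<le> 1"
        unfolding P_char[symmetric] by (rule P.norm_integral_iexp_le_1) (simp add: P_mc)
      show "norm (\<zeta> u) \<le> real N" using \<zeta>_norm[of u] N(2) by linarith
    qed (use \<zeta>_Re N in auto)
    also have "\<dots> \<le> exp 1 / real (Suc n)"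
    proof -
      have "(norm (\<zeta> u))\<^sup>2 \<le> (2 * mass)\<^sup>2" using \<zeta>_norm[of u] by (intro power_mono) auto
      then have "real (Suc n) * (norm (\<zeta> u))\<^sup>2 \<le> real (Suc n) * (4 * mass\<^sup>2)"
        by (intro mult_left_mono) (auto simp: power2_eq_square)
      also have "\<dots> \<le> real N" by (rule N(3))
      finally have "(norm (\<zeta> u))\<^sup>2 / real N \<le> 1 / real (Suc n)"
        using N(1) by (simp add: divide_simps mult.commute del: of_nat_Suc)
      then have "exp 1 * ((norm (\<zeta> u))\<^sup>2 / real N) \<le> exp 1 * (1 / real (Suc n))" by (intro mult_left_mono) auto
      then show ?thesis by simp
    qed
    finally show "norm (mchar I \<mu> u - exp (\<i> * of_real (\<Sum>i\<in>I. b i * u i) + (\<integral>x. indicator E x *\<^sub>R lk_integrand I u x \<partial>\<nu>)))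
      \<le> exp 1 / real (Suc n)" .
  qed
qed

text \<open>Only jumps of weight above 1/(n+1) are kept, and they have finite total mass. Dominated
  convergence lets the cutoff go, and Levy's continuity theorem supplies the limit law.\<close>

lemma levy_meas_law_exists:
  fixes I :: "'i set"
  assumes I: "finite I" and \<nu>: "levy_meas I \<nu>"
  obtains \<mu> where "prob_space \<mu>" "sets \<mu> = sets (PiM I (\<lambda>_. borel))"
    "\<And>u. mchar I \<mu> u = exp (\<i> * of_real (\<Sum>i\<in>I. b i * u i) + (\<integral>x. lk_integrand I u x \<partial>\<nu>))"
proof -
  have s: "sets \<nu> = sets (PiM I (\<lambda>_. borel))" using \<nu> by (simp add: levy_meas_def)
  have wt_m: "wt I \<in> borel_measurable \<nu>" by (simp add: measurable_cong_sets[OF s refl])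
  define E where "E n = {x\<in>space \<nu>. 1 / real (Suc n) < wt I x}" for n
  have E_set: "E n \<in> sets \<nu>" for n unfolding E_def using wt_m by measurable
  define Q where "Q n \<mu> \<longleftrightarrow> prob_space \<mu> \<and> sets \<mu> = sets (PiM I (\<lambda>_. borel)) \<and>
    (\<forall>u. norm (mchar I \<mu> u - exp (\<i> * of_real (\<Sum>i\<in>I. b i * u i) + (\<integral>x. indicator (E n) x *\<^sub>R lk_integrand I u x \<partial>\<nu>)))
        \<le> exp 1 / real (Suc n))" for n \<mu>
  have "\<exists>\<mu>. Q n \<mu>" for n
    unfolding Q_def E_def
    by (rule compound_poisson_approximation[where n=n and b=b, OF I \<nu>]) (intro exI conjI allI)
  then obtain \<mu> where "\<And>n. Q n (\<mu> n)" by metis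
  then have \<mu>: "\<And>n. prob_space (\<mu> n)" "\<And>n. sets (\<mu> n) = sets (PiM I (\<lambda>_. borel))"
    "\<And>n u. norm (mchar I (\<mu> n) u - exp (\<i> * of_real (\<Sum>i\<in>I. b i * u i) + (\<integral>x. indicator (E n) x *\<^sub>R lk_integrand I u x \<partial>\<nu>)))
        \<le> exp 1 / real (Suc n)"
    unfolding Q_def by blast+
  show ?thesis
  proof (rule multivariate_levy_continuity[OF I \<mu>(1,2)])
    fix u
    let ?a = "\<lambda>n. exp (\<i> * of_real (\<Sum>i\<in>I. b i * u i) + (\<integral>x. indicator (E n) x *\<^sub>R lk_integrand I u x \<partial>\<nu>))"
    have "(\<lambda>n. \<integral>x. indicator (E n) x *\<^sub>R lk_integrand I u x \<partial>\<nu>) \<longlonglongrightarrow> (\<integral>x. lk_integrand I u x \<partial>\<nu>)"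
    proof (rule integral_dominated_convergence[where w="\<lambda>x. norm (lk_integrand I u x)"])
      show "integrable \<nu> (\<lambda>x. norm (lk_integrand I u x))"
        by (intro integrable_norm levy_meas_integrable_lk \<nu>)
      show m: "lk_integrand I u \<in> borel_measurable \<nu>" by (simp add: measurable_cong_sets[OF s refl])
      show "(\<lambda>x. indicator (E n) x *\<^sub>R lk_integrand I u x) \<in> borel_measurable \<nu>" for n
        using m E_set[of n] by measurable
      show "AE x in \<nu>. norm (indicator (E n) x *\<^sub>R lk_integrand I u x) \<le> norm (lk_integrand I u x)" for n
        by (simp add: indicator_def)
      show "AE x in \<nu>. (\<lambda>n. indicator (E n) x *\<^sub>R lk_integrand I u x) \<longlonglongrightarrow> lk_integrand I u x"
      proof (intro AE_I2)
        fix x assume x: "x \<in> space \<nu>"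
        show "(\<lambda>n. indicator (E n) x *\<^sub>R lk_integrand I u x) \<longlonglongrightarrow> lk_integrand I u x"
        \<comment> \<open>Points of weight 0 belong to no E n, but the integrand vanishes there;
          every other point belongs to E n from some n on.\<close>
        proof (cases "wt I x = 0")
          case True
          then have "lk_integrand I u x = 0" using norm_lk_integrand_le[of I u x] by simp
          then show ?thesis by simp
        next
          case False
          then have "0 < wt I x" using wt_bounds(1)[of I x] by simp
          then have "\<forall>\<^sub>F n in sequentially. inverse (real (Suc n)) < wt I x"
            by (rule order_tendstoD[OF LIMSEQ_inverse_real_of_nat])
          then have "\<forall>\<^sub>F n in sequentially. indicator (E n) x *\<^sub>R lk_integrand I u x = lk_integrand I u x"
            by eventually_elim (simp add: E_def x inverse_eq_divide)
          then show ?thesis by (rule tendsto_eventually)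
        qed
      qed
    qed
    then have a: "?a \<longlonglongrightarrow> exp (\<i> * of_real (\<Sum>i\<in>I. b i * u i) + (\<integral>x. lk_integrand I u x \<partial>\<nu>))"
      by (intro tendsto_intros)
    have "(\<lambda>n. mchar I (\<mu> n) u - ?a n) \<longlonglongrightarrow> 0"
    proof (rule Lim_null_comparison)
      show "\<forall>\<^sub>F n in sequentially. norm (mchar I (\<mu> n) u - ?a n) \<le> exp 1 / real (Suc n)" using \<mu>(3) by simp
      show "(\<lambda>n. exp 1 / real (Suc n)) \<longlonglongrightarrow> 0"
        using tendsto_mult[OF tendsto_const LIMSEQ_inverse_real_of_nat, of "exp 1"] by (simp add: divide_inverse)
    qed
    from tendsto_add[OF this a] show "(\<lambda>n. mchar I (\<mu> n) u) \<longlonglongrightarrow> exp (\<i> * of_real (\<Sum>i\<in>I. b i * u i) + (\<integral>x. lk_integrand I u x \<partial>\<nu>))"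
      by simp
  next
    fix i assume i: "i \<in> I"
    have "((\<lambda>r. exp (\<i> * of_real (r * b i) + (\<integral>x. lk_integrand I (\<lambda>j. if j = i then r else 0) x \<partial>\<nu>))) \<longlongrightarrow> exp (\<i> * of_real (0 * b i) + 0)) (at 0)"
      by (intro tendsto_intros lk_integral_tendsto_0[OF I \<nu> i])
    then show "((\<lambda>r. exp (\<i> * of_real (\<Sum>j\<in>I. b j * (if j = i then r else 0)) + (\<integral>x. lk_integrand I (\<lambda>j. if j = i then r else 0) x \<partial>\<nu>))) \<longlongrightarrow> 1) (at 0)"
      using sum_single_coordinate[OF I i, of _ b] by (simp add: mult.commute)
  qed (rule that)
qed

subsection \<open>The Gaussian part\<close>


text \<open>The jump part grows more slowly than quadratically in the frequency. Pointwise the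
  integrand is of order sqrt n, so division by n sends it to 0; the quadratic bound
  \<open>norm_lk_integrand_le\<close> provides a majorant free of n.\<close>

lemma lk_integral_scaled_tendsto_0:
  fixes I :: "'i set"
  assumes \<nu>: "levy_meas I \<nu>"
  shows "(\<lambda>n. (\<integral>x. lk_integrand I (\<lambda>i. sqrt (real (Suc n)) * u i) x \<partial>\<nu>) / of_nat (Suc n)) \<longlonglongrightarrow> 0"
proof -
  have s: "sets \<nu> = sets (PiM I (\<lambda>_. borel))" using \<nu> by (simp add: levy_meas_def)
  let ?k = "\<lambda>n. lk_integrand I (\<lambda>i. sqrt (real (Suc n)) * u i)"
  have lf: "lform I (\<lambda>i. sqrt (real (Suc n)) * u i) x = sqrt (real (Suc n)) * lform I u x" for n x
    by (simp add: sum_distrib_left mult.assoc)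
  have "(\<lambda>n. \<integral>x. ?k n x / of_nat (Suc n) \<partial>\<nu>) \<longlonglongrightarrow> (\<integral>x. 0 \<partial>\<nu>)"
  proof (rule integral_dominated_convergence[where w="\<lambda>x. (4 + sqn I u) * wt I x"])
    show "integrable \<nu> (\<lambda>x. (4 + sqn I u) * wt I x)" using levy_meas_integrable_wt[OF \<nu>] by simp
    show "AE x in \<nu>. norm (?k n x / of_nat (Suc n)) \<le> (4 + sqn I u) * wt I x" for n
    proof (intro AE_I2)
      fix x
      have sq: "sqn I (\<lambda>i. sqrt (real (Suc n)) * u i) = real (Suc n) * sqn I u"
        by (simp add: sqn_def power_mult_distrib sum_distrib_left del: of_nat_Suc)
      have "norm (?k n x) \<le> (4 + real (Suc n) * sqn I u) * wt I x"
        using norm_lk_integrand_le[of I "\<lambda>i. sqrt (real (Suc n)) * u i" x] by (simp only: sq)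
      also have "\<dots> \<le> (real (Suc n) * 4 + real (Suc n) * sqn I u) * wt I x"
        by (intro mult_right_mono wt_bounds(1) add_right_mono) simp
      also have "\<dots> = (4 + sqn I u) * wt I x * real (Suc n)" by (simp only: distrib_left[symmetric] mult_ac)
      finally show "norm (?k n x / of_nat (Suc n)) \<le> (4 + sqn I u) * wt I x"
        unfolding norm_divide norm_of_nat by (subst pos_divide_le_eq) auto
    qed
    show "AE x in \<nu>. (\<lambda>n. ?k n x / of_nat (Suc n)) \<longlonglongrightarrow> 0"
    proof (intro AE_I2)
      fix x
      let ?y = "lform I u x"
      have le: "norm (?k n x / of_nat (Suc n)) \<le> 2 * inverse (real (Suc n)) + \<bar>?y\<bar> * inverse (sqrt (real (Suc n)))" for n
      proof -
        have "norm (?k n x) \<le> 2 + sqrt (real (Suc n)) * \<bar>?y\<bar>"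
          unfolding lk_integrand_def lf
        proof (rule order_trans[OF norm_triangle_ineq4 add_mono[OF norm_iexp_minus_1_le_2]])
          show "norm (\<i> * complex_of_real (sqrt (real (Suc n)) * ?y * (if sqrt (sqn I x) \<le> 1 then 1 else 0))) \<le> sqrt (real (Suc n)) * \<bar>?y\<bar>"
            by (simp add: norm_mult abs_mult del: of_real_sum of_real_mult of_nat_Suc)
        qed
        then have "norm (?k n x) / real (Suc n) \<le> (2 + sqrt (real (Suc n)) * \<bar>?y\<bar>) / real (Suc n)"
          by (intro divide_right_mono) auto
        also have "\<dots> = 2 * inverse (real (Suc n)) + \<bar>?y\<bar> * (sqrt (real (Suc n)) / real (Suc n))"
        proof -
          have "(2 + p * y) / N = 2 * inverse N + y * (p / N)" for p y N :: real
            by (simp add: divide_inverse distrib_right)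
          then show ?thesis .
        qed
        also have "sqrt (real (Suc n)) / real (Suc n) = inverse (sqrt (real (Suc n)))"
          by (simp add: sqrt_divide_self_eq del: of_nat_Suc)
        finally show ?thesis by (simp add: norm_divide del: of_nat_Suc)
      qed
      have lim: "(\<lambda>n. 2 * inverse (real (Suc n)) + \<bar>?y\<bar> * inverse (sqrt (real (Suc n)))) \<longlonglongrightarrow> 2 * 0 + \<bar>?y\<bar> * sqrt 0"
        unfolding real_sqrt_inverse[symmetric]
        by (intro tendsto_intros LIMSEQ_inverse_real_of_nat)
      then have lim0: "(\<lambda>n. 2 * inverse (real (Suc n)) + \<bar>?y\<bar> * inverse (sqrt (real (Suc n)))) \<longlonglongrightarrow> 0"
        by (simp only: real_sqrt_zero mult_zero_right add_0_right)
      show "(\<lambda>n. ?k n x / of_nat (Suc n)) \<longlonglongrightarrow> 0"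
        by (rule Lim_null_comparison[OF always_eventually[OF allI[OF le]] lim0])
    qed
  qed (simp_all add: measurable_cong_sets[OF s refl])
  then show ?thesis by simp
qed

text \<open>The variance of the Gaussian part of Z(1) for a one-dimensional time-stable Z:
  the normalised variables sqrt(n) Z(1/n) converge in law to this part.\<close>

definition gauss_form :: "'a measure \<Rightarrow> (real \<Rightarrow> 'a \<Rightarrow> real) \<Rightarrow> real" where
  "gauss_form M Z = - 2 * ln (Re (lim (\<lambda>n. \<integral>\<omega>. iexp (sqrt (real (Suc n)) * Z (1 / real (Suc n)) \<omega>) \<partial>M)))"

text \<open>Polarisation of \<open>gauss_form\<close> along the rays r \<mapsto> r t and r \<mapsto>
  r s; no index set and no matrix enters.\<close>

definition gauss_cov :: "'a measure \<Rightarrow> (real \<Rightarrow> 'a \<Rightarrow> real) \<Rightarrow> real \<Rightarrow> real \<Rightarrow> real" where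
  "gauss_cov M X t s = (gauss_form M (\<lambda>r \<omega>. X (r * t) \<omega> + X (r * s) \<omega>)
     - gauss_form M (\<lambda>r. X (r * t)) - gauss_form M (\<lambda>r. X (r * s))) / 2"

abbreviation qform :: "'i set \<Rightarrow> ('i \<Rightarrow> 'i \<Rightarrow> real) \<Rightarrow> ('i \<Rightarrow> real) \<Rightarrow> real" where
  "qform I A u \<equiv> (\<Sum>i\<in>I. \<Sum>j\<in>I. u i * u j * A i j)"

text \<open>With N = n+1, time c/N and frequency sqrt N * u leave c times the quadratic form intact,
  shrink the drift to order 1/sqrt N and divide the jump integral by N. The factor c prepares the
  scaling law of the covariance.\<close>

lemma gaussian_limit:
  fixes I :: "'i set"
  assumes \<nu>: "levy_meas I \<nu>" and c: "0 \<le> c"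
    and lk: "\<And>u s. 0 \<le> s \<Longrightarrow> (\<integral>\<omega>. iexp (\<Sum>i\<in>I. u i * X (s * t i) \<omega>) \<partial>M) =
       exp (of_real s * (\<i> * of_real (\<Sum>i\<in>I. b i * u i) - of_real (qform I A u) / 2
         + (\<integral>x. lk_integrand I u x \<partial>\<nu>)))"
  shows "(\<lambda>n. \<integral>\<omega>. iexp (\<Sum>i\<in>I. (sqrt (real (Suc n)) * u i) * X (c / real (Suc n) * t i) \<omega>) \<partial>M)
    \<longlonglongrightarrow> of_real (exp (- (c * qform I A u) / 2))"
proof -
  define B where "B = (\<Sum>i\<in>I. b i * u i)"
  define L where "L n = (\<integral>x. lk_integrand I (\<lambda>i. sqrt (real (Suc n)) * u i) x \<partial>\<nu>) / of_nat (Suc n)" for n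
  have "(\<lambda>n. exp (\<i> * of_real (c * B * sqrt (inverse (real (Suc n)))) - of_real (c * qform I A u) / 2 + of_real c * L n))
    \<longlonglongrightarrow> exp (\<i> * of_real (c * B * sqrt 0) - of_real (c * qform I A u) / 2 + of_real c * 0)"
    unfolding L_def by (intro tendsto_intros LIMSEQ_inverse_real_of_nat lk_integral_scaled_tendsto_0 \<nu>) simp_all
  moreover have "(\<integral>\<omega>. iexp (\<Sum>i\<in>I. (sqrt (real (Suc n)) * u i) * X (c / real (Suc n) * t i) \<omega>) \<partial>M)
    = exp (\<i> * of_real (c * B * sqrt (inverse (real (Suc n)))) - of_real (c * qform I A u) / 2 + of_real c * L n)" for n
  proof -
    define N where "N = real (Suc n)"
    have N: "0 < N" by (simp add: N_def)
    have B': "(\<Sum>i\<in>I. b i * (sqrt N * u i)) = sqrt N * B" by (simp add: B_def sum_distrib_left mult_ac)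
    have Q': "(\<Sum>i\<in>I. \<Sum>j\<in>I. (sqrt N * u i) * (sqrt N * u j) * A i j) = N * qform I A u"
    proof -
      have "(sqrt N * u i) * (sqrt N * u j) * A i j = N * (u i * u j * A i j)" for i j
      proof -
        have "(sqrt N * u i) * (sqrt N * u j) * A i j = (sqrt N * sqrt N) * (u i * u j * A i j)" by (simp only: mult_ac)
        also have "sqrt N * sqrt N = N" using N by simp
        finally show ?thesis .
      qed
      then show ?thesis by (simp only: sum_distrib_left)
    qed
    have "c / N * sqrt N = c * (sqrt N / N)" by simp
    also have "\<dots> = c * sqrt (inverse N)" using N by (simp only: sqrt_divide_self_eq real_sqrt_inverse)
    finally have s: "c / N * sqrt N = c * sqrt (inverse N)" .
    have Ln: "L n = (\<integral>x. lk_integrand I (\<lambda>i. sqrt N * u i) x \<partial>\<nu>) / of_real N" by (simp add: L_def N_def)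
    have "of_real (c / N) * (\<i> * of_real (sqrt N * B) - of_real (N * q) / 2 + J)
      = \<i> * of_real (c / N * sqrt N * B) - of_real (c * q) / 2 + of_real c * (J / of_real N)" for q J
      using N by (simp add: field_simps)
    from this[of "qform I A u" "\<integral>x. lk_integrand I (\<lambda>i. sqrt N * u i) x \<partial>\<nu>", folded Ln]
    have "of_real (c / N) * (\<i> * of_real (sqrt N * B) - of_real (N * qform I A u) / 2 + (\<integral>x. lk_integrand I (\<lambda>i. sqrt N * u i) x \<partial>\<nu>))
      = \<i> * of_real (c / N * sqrt N * B) - of_real (c * qform I A u) / 2 + of_real c * L n" .
    also have "c / N * sqrt N * B = c * B * sqrt (inverse N)" unfolding s by simp
    finally show ?thesis
      using lk[of "c / N" "\<lambda>i. sqrt N * u i"] c N unfolding B' Q' N_def[symmetric] by simp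
  qed
  moreover have "exp (\<i> * of_real (c * B * sqrt 0) - of_real (c * qform I A u) / 2 + of_real c * 0) = of_real (exp (- (c * qform I A u) / 2))"
    by (simp add: exp_of_real[symmetric] del: of_real_sum of_real_mult)
  ultimately show ?thesis by (simp only:)
qed

lemma gauss_form_eq:
  fixes I :: "'i set"
  assumes \<nu>: "levy_meas I \<nu>" and c: "0 \<le> c"
    and lk: "\<And>u s. 0 \<le> s \<Longrightarrow> (\<integral>\<omega>. iexp (\<Sum>i\<in>I. u i * X (s * t i) \<omega>) \<partial>M) =
       exp (of_real s * (\<i> * of_real (\<Sum>i\<in>I. b i * u i) - of_real (qform I A u) / 2
         + (\<integral>x. lk_integrand I u x \<partial>\<nu>)))"
  shows "gauss_form M (\<lambda>s \<omega>. \<Sum>i\<in>I. u i * X (s * (c * t i)) \<omega>) = c * qform I A u"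
proof -
  have "sqrt (real (Suc n)) * (\<Sum>i\<in>I. u i * X (1 / real (Suc n) * (c * t i)) \<omega>) =
    (\<Sum>i\<in>I. (sqrt (real (Suc n)) * u i) * X (c / real (Suc n) * t i) \<omega>)" for n \<omega>
    by (simp add: sum_distrib_left mult.assoc del: of_nat_Suc)
  then have "(\<lambda>n. \<integral>\<omega>. iexp (sqrt (real (Suc n)) * (\<Sum>i\<in>I. u i * X (1 / real (Suc n) * (c * t i)) \<omega>)) \<partial>M)
    \<longlonglongrightarrow> of_real (exp (- (c * qform I A u) / 2))"
    using gaussian_limit[OF \<nu> c lk, of u] by (simp only:)
  from limI[OF this] show ?thesis unfolding gauss_form_def by simp
qed

text \<open>Whatever symmetric matrix a representation supplies, its entries are values of
  \<open>gauss_cov\<close>: the unit vectors give the diagonal, and e i + e j gives the rest by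
  polarisation. So the matrix depends on the pairs of times only.\<close>

lemma gauss_cov_eq:
  fixes I :: "'i set"
  assumes \<nu>: "levy_meas I \<nu>" and c: "0 \<le> c"
    and lk: "\<And>u s. 0 \<le> s \<Longrightarrow> (\<integral>\<omega>. iexp (\<Sum>i\<in>I. u i * X (s * t i) \<omega>) \<partial>M) =
       exp (of_real s * (\<i> * of_real (\<Sum>i\<in>I. b i * u i) - of_real (qform I A u) / 2
         + (\<integral>x. lk_integrand I u x \<partial>\<nu>)))"
    and I: "finite I" and sym: "\<And>i j. A i j = A j i" and ij: "i \<in> I" "j \<in> I"
  shows "gauss_cov M X (c * t i) (c * t j) = c * A i j"
proof -
  define e where "e i = (\<lambda>j. if j = i then 1 else 0 :: real)" for i :: 'i
  have es: "(\<Sum>k\<in>I. e l k * g k) = g l" if "l \<in> I" for l and g :: "'i \<Rightarrow> real"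
    using sum_single_coordinate[OF I that, of 1 g] by (simp add: e_def)
  have ee: "(\<Sum>k\<in>I. (e i k + e j k) * g k) = g i + g j" for g :: "'i \<Rightarrow> real"
    using es[OF ij(1), of g] es[OF ij(2), of g] by (simp add: distrib_right sum.distrib)
  have qf: "qform I A u = (\<Sum>k\<in>I. u k * (\<Sum>l\<in>I. u l * A k l))" for u
    by (simp add: sum_distrib_left mult.assoc)
  have q1: "qform I A (e l) = A l l" if "l \<in> I" for l
    unfolding qf es[OF that] by simp
  have q2: "qform I A (\<lambda>k. e i k + e j k) = A i i + A i j + (A j i + A j j)"
    unfolding qf ee by simp
  note gf = gauss_form_eq[OF \<nu> c lk]
  have "gauss_form M (\<lambda>s \<omega>. X (s * (c * t i)) \<omega> + X (s * (c * t j)) \<omega>) = c * (A i i + A i j + (A j i + A j j))"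
    using gf[of "\<lambda>k. e i k + e j k"] unfolding ee q2 .
  moreover have "gauss_form M (\<lambda>s. X (s * (c * t l))) = c * A l l" if "l \<in> I" for l
    using gf[of "e l"] unfolding es[OF that] q1[OF that] .
  ultimately show ?thesis using ij sym[of j i] by (simp add: gauss_cov_def algebra_simps)
qed

text \<open>A single representation along the ray through (t, s) is evaluated at the factors c and
  1. The index set {0,1} in place of a set of times admits t = s.\<close>

lemma gauss_cov_scale:
  assumes ts: "time_stable M X" and "0 \<le> t" "0 \<le> s" and c: "0 \<le> c"
  shows "gauss_cov M X (c * t) (c * s) = c * gauss_cov M X t s"
proof -
  define tt where "tt i = (if i = (0::nat) then t else s)" for i
  have tt0: "0 \<le> tt i" for i using assms by (simp add: tt_def)
  obtain b A \<nu> where \<nu>: "levy_meas {0,1::nat} \<nu>" and sym: "\<And>i j. A i j = A j i"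
    and lk: "\<And>u s. 0 \<le> s \<Longrightarrow> (\<integral>\<omega>. iexp (\<Sum>i\<in>{0,1}. u i * X (s * tt i) \<omega>) \<partial>M) =
       exp (of_real s * (\<i> * of_real (\<Sum>i\<in>{0,1}. b i * u i) - of_real (qform {0,1} A u) / 2
         + (\<integral>x. lk_integrand {0,1} u x \<partial>\<nu>)))"
    by (rule time_stable_levy_khintchine[OF ts _ tt0, of "{0,1::nat}"]) (simp, rule that)
  have "gauss_cov M X (c * tt 0) (c * tt 1) = c * A 0 1" if "0 \<le> c" for c
    by (rule gauss_cov_eq[OF \<nu> that lk _ sym]) auto
  from this[OF c] this[of 1] show ?thesis by (simp add: tt_def)
qed

section \<open>Splitting characteristic functions into Gaussian and jump factors\<close>

lemma time_stable_decomposition: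
  fixes I :: "'i set"
  assumes ts: "time_stable M X" and I: "finite I" and t0: "\<And>i. i \<in> I \<Longrightarrow> 0 \<le> t i"
  defines "Q \<equiv> qform I (\<lambda>i j. gauss_cov M X (t i) (t j))"
  obtains b :: "'i \<Rightarrow> real" and \<nu> where "levy_meas I \<nu>"
    "\<And>u. (\<integral>\<omega>. iexp (\<Sum>i\<in>I. u i * X (t i) \<omega>) \<partial>M) =
       exp (\<i> * of_real (\<Sum>i\<in>I. b i * u i) + (\<integral>x. lk_integrand I u x \<partial>\<nu>)) * of_real (exp (- Q u / 2))"
    "\<And>u. (\<lambda>n. \<integral>\<omega>. iexp (\<Sum>i\<in>I. u i * (sqrt (real (Suc n)) * X (1 / real (Suc n) * t i) \<omega>)) \<partial>M) \<longlonglongrightarrow> of_real (exp (- Q u / 2))"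
proof -
  obtain b A \<nu> where \<nu>: "levy_meas I \<nu>" and sym: "\<And>i j. A i j = A j i"
    and lk: "\<And>u s. 0 \<le> s \<Longrightarrow> (\<integral>\<omega>. iexp (\<Sum>i\<in>I. u i * X (s * t i) \<omega>) \<partial>M) =
       exp (of_real s * (\<i> * of_real (\<Sum>i\<in>I. b i * u i) - of_real (qform I A u) / 2
         + (\<integral>x. lk_integrand I u x \<partial>\<nu>)))"
    by (rule time_stable_levy_khintchine[OF ts I t0]) (assumption, rule that)
  have "gauss_cov M X (t i) (t j) = A i j" if "i \<in> I" "j \<in> I" for i j
    using gauss_cov_eq[OF \<nu> _ lk I sym that, of 1] by simp
  then have Q: "Q u = qform I A u" for u unfolding Q_def by (intro sum.cong) auto
  show ?thesis
  proof
    show "levy_meas I \<nu>" by (rule \<nu>)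
    show "(\<integral>\<omega>. iexp (\<Sum>i\<in>I. u i * X (t i) \<omega>) \<partial>M) =
       exp (\<i> * of_real (\<Sum>i\<in>I. b i * u i) + (\<integral>x. lk_integrand I u x \<partial>\<nu>)) * of_real (exp (- Q u / 2))" for u
    proof -
      have "exp (of_real 1 * (a - of_real q / 2 + J)) = exp (a + J) * complex_of_real (exp (- q / 2))" for a J q
        unfolding exp_of_real[symmetric] exp_add[symmetric] by (simp add: algebra_simps)
      from trans[OF lk[OF zero_le_one, of u] this] show ?thesis
        unfolding Q by (simp only: mult_1)
    qed
    show "(\<lambda>n. \<integral>\<omega>. iexp (\<Sum>i\<in>I. u i * (sqrt (real (Suc n)) * X (1 / real (Suc n) * t i) \<omega>)) \<partial>M) \<longlonglongrightarrow> of_real (exp (- Q u / 2))" for u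
      unfolding Q using gaussian_limit[OF \<nu> _ lk, of 1 u] by (simp add: mult_ac del: of_nat_Suc)
  qed
qed

text \<open>exp(-Q/2) is a limit of characteristic functions and hence at most 1.\<close>

lemma qform_gauss_cov_nonneg:
  fixes I :: "'i set"
  assumes ts: "time_stable M X" and I: "finite I" and t0: "\<And>i. i \<in> I \<Longrightarrow> 0 \<le> t i"
  shows "0 \<le> qform I (\<lambda>i j. gauss_cov M X (t i) (t j)) u"
proof -
  interpret prob_space M using time_stableD[OF ts] by auto
  let ?Q = "qform I (\<lambda>i j. gauss_cov M X (t i) (t j)) u"
  obtain b \<nu> where lim: "(\<lambda>n. \<integral>\<omega>. iexp (\<Sum>i\<in>I. u i * (sqrt (real (Suc n)) * X (1 / real (Suc n) * t i) \<omega>)) \<partial>M) \<longlonglongrightarrow> complex_of_real (exp (- ?Q / 2))"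
    by (rule time_stable_decomposition[OF ts I t0]) (assumption, rule that)
  have "norm (complex_of_real (exp (- ?Q / 2))) \<le> 1"
  proof (rule Lim_norm_ubound[OF _ lim])
    show "\<forall>\<^sub>F n in sequentially. norm (\<integral>\<omega>. iexp (\<Sum>i\<in>I. u i * (sqrt (real (Suc n)) * X (1 / real (Suc n) * t i) \<omega>)) \<partial>M) \<le> 1"
      using t0 by (intro always_eventually allI norm_integral_iexp_le_1 borel_measurable_linear_comb
        borel_measurable_times borel_measurable_const time_stableD(2)[OF ts]) simp
  qed simp
  then show ?thesis by (simp del: of_real_exp)
qed

text \<open>Obtained as the limit law of sqrt(n) X(t/n) by Levy's continuity theorem; no
  factorisation of the covariance matrix is involved.\<close>

lemma gaussian_law_exists:
  fixes I :: "'i set"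
  assumes ts: "time_stable M X" and I: "finite I" and t0: "\<And>i. i \<in> I \<Longrightarrow> 0 \<le> t i"
  obtains \<mu> where "prob_space \<mu>" "sets \<mu> = sets (PiM I (\<lambda>_. borel))"
    "\<And>u. mchar I \<mu> u = of_real (exp (- qform I (\<lambda>i j. gauss_cov M X (t i) (t j)) u / 2))"
proof -
  interpret prob_space M using time_stableD[OF ts] by auto
  let ?Q = "qform I (\<lambda>i j. gauss_cov M X (t i) (t j))"
  obtain b :: "'i \<Rightarrow> real" and \<nu> where lim: "\<And>u. (\<lambda>n. \<integral>\<omega>. iexp (\<Sum>i\<in>I. u i * (sqrt (real (Suc n)) * X (1 / real (Suc n) * t i) \<omega>)) \<partial>M) \<longlonglongrightarrow> complex_of_real (exp (- ?Q u / 2))"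
    by (rule time_stable_decomposition[OF ts I t0]) (assumption, rule that)
  have m: "(\<lambda>\<omega>. sqrt (real (Suc n)) * X (1 / real (Suc n) * t i) \<omega>) \<in> borel_measurable M" if "i \<in> I" for n i
    using t0[OF that] by (intro borel_measurable_times borel_measurable_const time_stableD(2)[OF ts]) simp
  define \<mu> where "\<mu> n = distr M (PiM I (\<lambda>_. borel)) (\<lambda>\<omega>. \<lambda>i\<in>I. sqrt (real (Suc n)) * X (1 / real (Suc n) * t i) \<omega>)" for n
  show ?thesis
  proof (rule multivariate_levy_continuity[OF I, of \<mu> "\<lambda>u. of_real (exp (- ?Q u / 2))"])
    show "prob_space (\<mu> n)" for n unfolding \<mu>_def by (intro prob_space_distr measurable_restrict m)
    show "sets (\<mu> n) = sets (PiM I (\<lambda>_. borel))" for n by (simp add: \<mu>_def)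
    show "(\<lambda>n. mchar I (\<mu> n) u) \<longlonglongrightarrow> of_real (exp (- ?Q u / 2))" for u
      unfolding \<mu>_def using lim[of u] by (subst mchar_distr) (use m in auto)
    fix i assume i: "i \<in> I"
    let ?C = "gauss_cov M X (t i) (t i)"
    have q: "?Q (\<lambda>j. if j = i then r else 0) = r * (r * ?C)" for r
    proof -
      have "?Q (\<lambda>j. if j = i then r else 0) = (\<Sum>k\<in>I. (if k = i then r else 0) * (\<Sum>l\<in>I. (if l = i then r else 0) * gauss_cov M X (t k) (t l)))"
        by (simp add: sum_distrib_left mult.assoc)
      then show ?thesis unfolding sum_single_coordinate[OF I i] .
    qed
    have "((\<lambda>r. complex_of_real (exp (- (r * (r * ?C)) / 2))) \<longlongrightarrow> of_real (exp (- (0 * (0 * ?C)) / 2))) (at 0)"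
      by (intro tendsto_intros) simp
    then show "((\<lambda>r. complex_of_real (exp (- ?Q (\<lambda>j. if j = i then r else 0) / 2))) \<longlongrightarrow> 1) (at 0)"
      unfolding q by simp
  qed (rule that)
qed

text \<open>Multiplying a characteristic function by exp(Q/2) does not in general give one. Here it
  leaves a pure drift-and-jump exponent, for which \<open>levy_meas_law_exists\<close> constructs
  the law.\<close>

lemma nongaussian_law_exists:
  fixes I :: "'i set"
  assumes ts: "time_stable M X" and I: "finite I" and t0: "\<And>i. i \<in> I \<Longrightarrow> 0 \<le> t i"
  obtains \<mu> where "prob_space \<mu>" "sets \<mu> = sets (PiM I (\<lambda>_. borel))"
    "\<And>u. mchar I \<mu> u = (\<integral>\<omega>. iexp (\<Sum>i\<in>I. u i * X (t i) \<omega>) \<partial>M) *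
       of_real (exp (qform I (\<lambda>i j. gauss_cov M X (t i) (t j)) u / 2))"
proof -
  let ?Q = "qform I (\<lambda>i j. gauss_cov M X (t i) (t j))"
  obtain b :: "'i \<Rightarrow> real" and \<nu> where \<nu>: "levy_meas I \<nu>" and
    eq: "\<And>u. (\<integral>\<omega>. iexp (\<Sum>i\<in>I. u i * X (t i) \<omega>) \<partial>M) =
       exp (\<i> * of_real (\<Sum>i\<in>I. b i * u i) + (\<integral>x. lk_integrand I u x \<partial>\<nu>)) * of_real (exp (- ?Q u / 2))"
    by (rule time_stable_decomposition[OF ts I t0]) (assumption, rule that)
  obtain \<mu> where \<mu>: "prob_space \<mu>" "sets \<mu> = sets (PiM I (\<lambda>_. borel))"
    "\<And>u. mchar I \<mu> u = exp (\<i> * of_real (\<Sum>i\<in>I. b i * u i) + (\<integral>x. lk_integrand I u x \<partial>\<nu>))"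
    by (rule levy_meas_law_exists[OF I \<nu>]) (rule that)
  have "mchar I \<mu> u = (\<integral>\<omega>. iexp (\<Sum>i\<in>I. u i * X (t i) \<omega>) \<partial>M) * of_real (exp (?Q u / 2))" for u
  proof -
    have "complex_of_real (exp (- q / 2)) * of_real (exp (q / 2)) = 1" for q
      by (simp flip: of_real_mult exp_add)
    then show ?thesis unfolding eq \<mu>(3) by (simp only: mult.assoc mult_1_right)
  qed
  with \<mu>(1,2) show ?thesis by (rule that)
qed

subsection \<open>Construction of the process\<close>


lemma sum_restricted_support:
  fixes g :: "'i \<Rightarrow> real"
  assumes "finite H" "J \<subseteq> H"
  shows "(\<Sum>t\<in>H. (if t \<in> J then u t else 0) * g t) = (\<Sum>t\<in>J. u t * g t)"
  using assms by (intro sum.mono_neutral_cong_right) auto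

text \<open>Frequencies outside J set to 0 describe the marginal on J. Together with
  \<open>mchar_unique\<close> the functional equation for \<phi> therefore says that the laws are
  projective, and Kolmogorov's theorem for Polish spaces applies.\<close>

lemma kolmogorov_extension_mchar:
  fixes T :: "'i set" and \<phi> :: "'i set \<Rightarrow> ('i \<Rightarrow> real) \<Rightarrow> complex"
  assumes ex: "\<And>J. finite J \<Longrightarrow> J \<subseteq> T \<Longrightarrow>
      \<exists>\<mu>. prob_space \<mu> \<and> sets \<mu> = sets (PiM J (\<lambda>_. borel)) \<and> (\<forall>u. mchar J \<mu> u = \<phi> J u)"
    and cons: "\<And>J H u. J \<subseteq> H \<Longrightarrow> finite H \<Longrightarrow> H \<subseteq> T \<Longrightarrow> \<phi> J u = \<phi> H (\<lambda>t. if t \<in> J then u t else 0)"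
  obtains P where "prob_space P" "sets P = sets (PiM T (\<lambda>_. borel))"
    "\<And>J u. finite J \<Longrightarrow> J \<subseteq> T \<Longrightarrow> (\<integral>\<omega>. iexp (\<Sum>t\<in>J. u t * \<omega> t) \<partial>P) = \<phi> J u"
proof -
  define L where "L J = (SOME \<mu>. prob_space \<mu> \<and> sets \<mu> = sets (PiM J (\<lambda>_. borel)) \<and> (\<forall>u. mchar J \<mu> u = \<phi> J u))" for J
  have L0: "prob_space (L J) \<and> sets (L J) = sets (PiM J (\<lambda>_. borel)) \<and> (\<forall>u. mchar J (L J) u = \<phi> J u)"
    if "finite J" "J \<subseteq> T" for J
    unfolding L_def by (rule someI_ex[OF ex[OF that]])
  have L: "prob_space (L J)" "sets (L J) = sets (PiM J (\<lambda>_. borel))" "mchar J (L J) u = \<phi> J u"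
    if "finite J" "J \<subseteq> T" for J u
    using L0[OF that] by blast+
  have marg: "L J = distr (L H) (PiM J (\<lambda>_. borel)) (\<lambda>f. restrict f J)"
    if JH: "J \<subseteq> H" "finite H" "H \<subseteq> T" for J H
  proof -
    from JH have J: "finite J" "J \<subseteq> T" by (auto intro: finite_subset)
    have LH: "prob_space (L H)" "sets (L H) = sets (PiM H (\<lambda>_. borel))" by (rule L[OF JH(2,3)])+
    have m: "(\<lambda>f. f i) \<in> borel_measurable (L H)" if "i \<in> J" for i
      using that JH by (subst measurable_cong_sets[OF LH(2) refl]) auto
    show ?thesis
    proof (rule mchar_unique[OF J(1)])
      show "prob_space (distr (L H) (PiM J (\<lambda>_. borel)) (\<lambda>f. restrict f J))"
        by (intro prob_space.prob_space_distr LH measurable_restrict m)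
      fix u
      have "mchar J (distr (L H) (PiM J (\<lambda>_. borel)) (\<lambda>f. \<lambda>i\<in>J. f i)) u = (\<integral>x. iexp (\<Sum>i\<in>J. u i * x i) \<partial>L H)"
        by (rule mchar_distr) (rule m)
      also have "\<dots> = mchar H (L H) (\<lambda>t. if t \<in> J then u t else 0)"
        unfolding mchar_def sum_restricted_support[OF JH(2,1)] ..
      also have "\<dots> = \<phi> J u" unfolding L(3)[OF JH(2,3)] by (rule cons[OF JH, symmetric])
      finally show "mchar J (L J) u = mchar J (distr (L H) (PiM J (\<lambda>_. borel)) (\<lambda>f. restrict f J)) u"
        unfolding L(3)[OF J] by (rule sym)
    qed (simp_all add: L(1,2)[OF J])
  qed
  interpret polish_projective T L
    unfolding polish_projective_def by (rule projective_family.intro) (rule marg L(1); assumption)+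
  show ?thesis
  proof
    show "prob_space lim" by (rule P.prob_space_axioms)
    show "sets lim = sets (PiM T (\<lambda>_. borel))" by simp
    fix J u assume J: "finite J" "J \<subseteq> T"
    have m: "(\<lambda>f. f i) \<in> borel_measurable lim" if "i \<in> J" for i
      using that J by (subst measurable_cong_sets[OF sets_lim refl]) auto
    have r: "(\<lambda>f. restrict f J) \<in> measurable lim (PiM J (\<lambda>_. borel))"
      by (intro measurable_restrict m)
    have "distr lim (PiM J (\<lambda>_. borel)) (\<lambda>f. restrict f J) = L J"
    proof (rule measure_eqI)
      show "sets (distr lim (PiM J (\<lambda>_. borel)) (\<lambda>f. restrict f J)) = sets (L J)" by (simp add: L(2)[OF J])
      fix A assume "A \<in> sets (distr lim (PiM J (\<lambda>_. borel)) (\<lambda>f. restrict f J))"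
      then have A: "A \<in> sets (PiM J (\<lambda>_. borel))" by simp
      have "emeasure (distr lim (PiM J (\<lambda>_. borel)) (\<lambda>f. restrict f J)) A = emeasure lim (emb T J A)"
        by (simp add: emeasure_distr[OF r A] prod_emb_def space_PiM)
      also have "\<dots> = emeasure (L J) A" by (rule emeasure_lim_emb[OF J(2,1) A])
      finally show "emeasure (distr lim (PiM J (\<lambda>_. borel)) (\<lambda>f. restrict f J)) A = emeasure (L J) A" .
    qed
    then show "(\<integral>\<omega>. iexp (\<Sum>t\<in>J. u t * \<omega> t) \<partial>lim) = \<phi> J u"
      using mchar_distr[of J "\<lambda>i f. f i" lim u, OF m] L(3)[OF J] by simp
  qed
qed

section \<open>Repeated times, independent products, normal laws and increments\<close>

text \<open>A list of times may contain repetitions, whereas the extended measures are described on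
  sets of times; frequencies at equal times are added up.\<close>

lemma sum_group_by_value:
  fixes u :: "'i \<Rightarrow> real"
  assumes "finite I"
  shows "(\<Sum>s\<in>t ` I. (\<Sum>i\<in>{i\<in>I. t i = s}. u i) * g s) = (\<Sum>i\<in>I. u i * g (t i))"
proof -
  have "(\<Sum>i\<in>I. u i * g (t i)) = (\<Sum>s\<in>t ` I. \<Sum>i\<in>{i\<in>I. t i = s}. u i * g (t i))"
    by (rule sum.image_gen[OF assms])
  then show ?thesis by (simp add: sum_distrib_right)
qed

lemma qform_nested: "qform J C v = (\<Sum>s\<in>J. v s * (\<Sum>r\<in>J. v r * C s r))"
  by (simp add: sum_distrib_left mult.assoc)

lemma qform_group_by_value:
  assumes "finite I"
  shows "qform (t ` I) C (\<lambda>s. \<Sum>i\<in>{i\<in>I. t i = s}. u i) = qform I (\<lambda>i j. C (t i) (t j)) u"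
  by (simp only: qform_nested sum_group_by_value[OF assms])

lemma qform_restricted_support:
  assumes "finite H" "J \<subseteq> H"
  shows "qform H C (\<lambda>t. if t \<in> J then u t else 0) = qform J C u"
  by (simp only: qform_nested sum_restricted_support[OF assms])

lemma (in pair_prob_space) integral_iexp_product:
  assumes f: "f \<in> borel_measurable M1" and g: "g \<in> borel_measurable M2"
  shows "(\<integral>\<omega>. iexp (f (fst \<omega>) + g (snd \<omega>)) \<partial>(M1 \<Otimes>\<^sub>M M2)) = (\<integral>x. iexp (f x) \<partial>M1) * (\<integral>y. iexp (g y) \<partial>M2)"
proof -
  have m: "(\<lambda>\<omega>. f (fst \<omega>) + g (snd \<omega>)) \<in> borel_measurable (M1 \<Otimes>\<^sub>M M2)"
    using f g by measurable
  have "(\<integral>\<omega>. iexp (f (fst \<omega>) + g (snd \<omega>)) \<partial>(M1 \<Otimes>\<^sub>M M2)) = (\<integral>x. \<integral>y. iexp (f x + g y) \<partial>M2 \<partial>M1)"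
    using integral_fst'[OF integrable_iexp_rv[OF m]] by simp
  also have "\<dots> = (\<integral>x. \<integral>y. iexp (f x) * iexp (g y) \<partial>M2 \<partial>M1)"
    by (simp only: of_real_add distrib_left exp_add)
  finally show ?thesis by simp
qed

lemma char_centred_normal:
  assumes "0 \<le> v"
  shows "char (centred_normal v) r = of_real (exp (- (r * r * v) / 2))"
proof (cases "v = 0")
  case True
  then show ?thesis by (simp add: centred_normal_def char_def integral_return)
next
  case False
  then have v: "0 < sqrt v" using assms by simp
  interpret S: prob_space std_normal_distribution by (rule prob_space_normal_density) simp
  have "distributed std_normal_distribution lborel (\<lambda>x. x) (normal_density 0 1)"
    by (auto simp: distributed_def intro!: distr_id2)
  from S.normal_density_affine[OF this, of "sqrt v" 0]
  have "distr std_normal_distribution lborel (\<lambda>x. sqrt v * x) = density lborel (normal_density 0 (sqrt v))"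
    using v by (simp add: distributed_def)
  then have cn: "centred_normal v = distr std_normal_distribution lborel (\<lambda>x. sqrt v * x)"
    using False by (simp add: centred_normal_def)
  have "char (centred_normal v) r = (\<integral>x. iexp (r * (sqrt v * x)) \<partial>std_normal_distribution)"
    unfolding cn char_def by (rule integral_distr) auto
  also have "\<dots> = char std_normal_distribution (r * sqrt v)" by (simp add: char_def mult.assoc)
  also have "\<dots> = of_real (exp (- ((r * sqrt v)\<^sup>2) / 2))" by (simp add: char_std_normal_distribution)
  also have "(r * sqrt v)\<^sup>2 = r * r * v" using assms by (simp add: power_mult_distrib power2_eq_square)
  finally show ?thesis .
qed

lemma real_distribution_centred_normal: "0 \<le> v \<Longrightarrow> real_distribution (centred_normal v)"
  by (auto simp: centred_normal_def real_distribution_def real_distribution_axioms_def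
      intro!: prob_space_return prob_space_normal_density)

text \<open>The tail estimate with R = \<epsilon> bounds the probability of a large increment by an
  average of 1 - Re of its characteristic function over a bounded range of frequencies, which tends
  to 0 by dominated convergence.\<close>

lemma stoch_continuousI_char:
  assumes M: "prob_space M" and Ym: "\<And>t. 0 \<le> t \<Longrightarrow> Y t \<in> borel_measurable M"
    and lim: "\<And>t s r. 0 \<le> t \<Longrightarrow> (\<And>n. 0 \<le> s n) \<Longrightarrow> s \<longlonglongrightarrow> t \<Longrightarrow>
      (\<lambda>n. \<integral>\<omega>. iexp (r * (Y (s n) \<omega> - Y t \<omega>)) \<partial>M) \<longlonglongrightarrow> 1"
  shows "stoch_continuous M Y"
  unfolding stoch_continuous_def tendsto_at_iff_sequentially comp_def
proof (intro allI impI)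
  interpret prob_space M by fact
  interpret U: prob_space unit_lborel by (rule prob_space_unit_lborel)
  fix t \<epsilon> :: real and s :: "nat \<Rightarrow> real"
  assume t: "0 \<le> t" and \<epsilon>: "0 < \<epsilon>" and s: "\<forall>n. s n \<in> {0..} - {t}" "s \<longlonglongrightarrow> t"
  have s0: "0 \<le> s n" for n using s(1) by auto
  define Z where "Z n \<omega> = Y (s n) \<omega> - Y t \<omega>" for n \<omega>
  have Zm: "Z n \<in> borel_measurable M" for n
    unfolding Z_def[abs_def] using Ym[OF s0, of n] Ym[OF t] by simp
  define c where "c n r = (\<integral>\<omega>. iexp (r * Z n \<omega>) \<partial>M)" for n r
  have c_lim: "(\<lambda>n. c n r) \<longlonglongrightarrow> 1" for r unfolding c_def Z_def by (rule lim[OF t s0 s(2)])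
  have c_norm: "norm (c n r) \<le> 1" for n r
    unfolding c_def using Zm[of n] by (intro norm_integral_iexp_le_1) simp
  have c_cont: "continuous_on UNIV (c n)" for n
    unfolding c_def[abs_def] by (rule continuous_on_integral_iexp[OF Zm])
  have c_meas: "(\<lambda>r. 1 - Re (c n (r / \<epsilon>))) \<in> borel_measurable unit_lborel" for n
  proof (rule measurable_restrict_space1)
    have "continuous_on UNIV (\<lambda>r. 1 - Re (c n (r / \<epsilon>)))"
      using \<epsilon> by (intro continuous_intros continuous_on_compose2[OF c_cont]) auto
    then show "(\<lambda>r. 1 - Re (c n (r / \<epsilon>))) \<in> borel_measurable lborel" by (simp add: borel_measurable_continuous_onI)
  qed
  have "(\<lambda>n. \<integral>r. 1 - Re (c n (r / \<epsilon>)) \<partial>unit_lborel) \<longlonglongrightarrow> (\<integral>r. 0 \<partial>unit_lborel)"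
  proof (rule integral_dominated_convergence[where w="\<lambda>_. 2"])
    have "norm (1 - Re (c n r)) \<le> 2" for n r
      using abs_Re_le_cmod[of "c n r"] c_norm[of n r] unfolding real_norm_def by linarith
    then show "AE r in unit_lborel. norm (1 - Re (c n (r / \<epsilon>))) \<le> 2" for n by simp
    have "(\<lambda>n. 1 - Re (c n r)) \<longlonglongrightarrow> 1 - Re 1" for r by (intro tendsto_intros c_lim)
    then show "AE r in unit_lborel. (\<lambda>n. 1 - Re (c n (r / \<epsilon>))) \<longlonglongrightarrow> 0" by simp
  qed (use c_meas in auto)
  then have u: "(\<lambda>n. 16 * (\<integral>r. 1 - Re (c n (r / \<epsilon>)) \<partial>unit_lborel)) \<longlonglongrightarrow> 0"
    using tendsto_mult[OF tendsto_const, of _ 0 sequentially 16] by simp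
  show "(\<lambda>n. prob {\<omega>\<in>space M. \<epsilon> < \<bar>Y (s n) \<omega> - Y t \<omega>\<bar>}) \<longlonglongrightarrow> 0"
  proof (rule tendsto_sandwich[OF _ _ tendsto_const u])
    show "\<forall>\<^sub>F n in sequentially. prob {\<omega>\<in>space M. \<epsilon> < \<bar>Y (s n) \<omega> - Y t \<omega>\<bar>} \<le> 16 * (\<integral>r. 1 - Re (c n (r / \<epsilon>)) \<partial>unit_lborel)"
      using tail_prob_le_integral_iexp[OF Zm \<epsilon>] by (simp add: c_def Z_def)
  qed simp
qed

lemma levy_measure_levy_meas: "levy_measure k \<nu> \<longleftrightarrow> levy_meas {..<k} \<nu>"
proof -
  have "(vnorm k x)\<^sup>2 = sqn {..<k} x" for x by (simp add: vnorm_def sqn_def sum_nonneg)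
  then show ?thesis by (simp add: levy_measure_def levy_meas_def Ball_def)
qed

lemma lk_integrand_lessThan:
  "lk_integrand {..<k} u x = exp (\<i> * complex_of_real (\<Sum>i<k. u i * x i)) - 1
     - \<i> * complex_of_real ((\<Sum>i<k. u i * x i) * (if vnorm k x \<le> 1 then 1 else 0))"
  by (simp add: lk_integrand_def vnorm_def sqn_def)


theorem theorem2p2:
  fixes M :: "'a measure" and X :: "real \<Rightarrow> 'a \<Rightarrow> real"
  assumes "time_stable M X"
  shows "\<exists>(b::real) (C :: real \<Rightarrow> real \<Rightarrow> real)
            (N :: ((real \<Rightarrow> real) \<times> (real \<Rightarrow> real)) measure)
            (G :: real \<Rightarrow> (real \<Rightarrow> real) \<times> (real \<Rightarrow> real) \<Rightarrow> real)
            (Y :: real \<Rightarrow> (real \<Rightarrow> real) \<times> (real \<Rightarrow> real) \<Rightarrow> real).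
           centred_gaussian_process N G C \<and>
           (\<forall>t\<ge>0. \<forall>s\<ge>0. \<forall>u\<ge>0. C (u * t) (u * s) = u * C t s) \<and>
           time_stable N Y \<and> no_gaussian_component N Y \<and>
           prob_space.indep_var N
             (PiM {0..} (\<lambda>_. borel)) (\<lambda>\<omega>. \<lambda>t\<in>{0..}. G t \<omega>)
             (PiM {0..} (\<lambda>_. borel)) (\<lambda>\<omega>. \<lambda>t\<in>{0..}. Y t \<omega>) \<and>
           (\<forall>k ts. (\<forall>i<k. ts i \<ge> 0) \<longrightarrow>
              fdd M X k ts = fdd N (\<lambda>t \<omega>. b * t + G t \<omega> + Y t \<omega>) k ts)"
proof -
  note ts = assms
  note Xm = time_stableD(2)[OF ts]
  interpret M: prob_space M by (rule time_stableD(1)[OF ts])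
  define C where "C = gauss_cov M X"
  define Q where "Q I t = qform I (\<lambda>i j. C (t i) (t j))" for I :: "nat set" and t
  define \<phi>X where "\<phi>X I t u = (\<integral>\<omega>. iexp (\<Sum>i\<in>I. u i * X (t i) \<omega>) \<partial>M)" for I :: "nat set" and t u

  obtain PG where PG: "prob_space PG" "sets PG = sets (PiM {0..} (\<lambda>_. borel))" and
    PG_char: "\<And>J u. finite J \<Longrightarrow> J \<subseteq> {0..} \<Longrightarrow>
      (\<integral>\<omega>. iexp (\<Sum>t\<in>J. u t * \<omega> t) \<partial>PG) = complex_of_real (exp (- qform J C u / 2))"
  proof (rule kolmogorov_extension_mchar[of "{0..}" "\<lambda>J u. complex_of_real (exp (- qform J C u / 2))"])
    fix J :: "real set" assume J: "finite J" "J \<subseteq> {0..}"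
    show "\<exists>\<mu>. prob_space \<mu> \<and> sets \<mu> = sets (PiM J (\<lambda>_. borel)) \<and> (\<forall>u. mchar J \<mu> u = complex_of_real (exp (- qform J C u / 2)))"
      by (rule gaussian_law_exists[OF ts, of J "\<lambda>t. t"]) (use J in \<open>auto simp: C_def\<close>)
  qed (simp add: qform_restricted_support, rule that)
  obtain PY where PY: "prob_space PY" "sets PY = sets (PiM {0..} (\<lambda>_. borel))" and
    PY_char: "\<And>J u. finite J \<Longrightarrow> J \<subseteq> {0..} \<Longrightarrow>
      (\<integral>\<omega>. iexp (\<Sum>t\<in>J. u t * \<omega> t) \<partial>PY) = (\<integral>\<omega>. iexp (\<Sum>t\<in>J. u t * X t \<omega>) \<partial>M) * complex_of_real (exp (qform J C u / 2))"
  proof (rule kolmogorov_extension_mchar[of "{0..}"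
        "\<lambda>J u. (\<integral>\<omega>. iexp (\<Sum>t\<in>J. u t * X t \<omega>) \<partial>M) * complex_of_real (exp (qform J C u / 2))"])
    fix J :: "real set" assume J: "finite J" "J \<subseteq> {0..}"
    show "\<exists>\<mu>. prob_space \<mu> \<and> sets \<mu> = sets (PiM J (\<lambda>_. borel)) \<and>
        (\<forall>u. mchar J \<mu> u = (\<integral>\<omega>. iexp (\<Sum>t\<in>J. u t * X t \<omega>) \<partial>M) * complex_of_real (exp (qform J C u / 2)))"
      by (rule nongaussian_law_exists[OF ts, of J "\<lambda>t. t"]) (use J in \<open>auto simp: C_def\<close>)
  qed (simp only: qform_restricted_support sum_restricted_support, rule that)
  have coordG: "(\<lambda>\<omega>. \<omega> t) \<in> borel_measurable PG" and coordY: "(\<lambda>\<omega>. \<omega> t) \<in> borel_measurable PY" if "0 \<le> t" for t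
    using that by (auto simp: measurable_cong_sets[OF PG(2) refl] measurable_cong_sets[OF PY(2) refl])
  have charG: "(\<integral>\<omega>. iexp (\<Sum>i\<in>I. u i * \<omega> (t i)) \<partial>PG) = of_real (exp (- Q I t u / 2))"
    if "finite I" "\<And>i. i \<in> I \<Longrightarrow> 0 \<le> t i" for I t u
    using PG_char[of "t ` I" "\<lambda>s. \<Sum>i\<in>{i\<in>I. t i = s}. u i"] that
    unfolding sum_group_by_value[OF that(1)] qform_group_by_value[OF that(1)] Q_def by auto
  have charY: "(\<integral>\<omega>. iexp (\<Sum>i\<in>I. u i * \<omega> (t i)) \<partial>PY) = \<phi>X I t u * of_real (exp (Q I t u / 2))"
    if "finite I" "\<And>i. i \<in> I \<Longrightarrow> 0 \<le> t i" for I t u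
    using PY_char[of "t ` I" "\<lambda>s. \<Sum>i\<in>{i\<in>I. t i = s}. u i"] that
    unfolding sum_group_by_value[OF that(1)] qform_group_by_value[OF that(1)] Q_def \<phi>X_def by auto

  define N where "N = PG \<Otimes>\<^sub>M PY"
  define G where "G t \<omega> = fst \<omega> t" for t :: real and \<omega> :: "(real \<Rightarrow> real) \<times> (real \<Rightarrow> real)"
  define Y where "Y t \<omega> = snd \<omega> t" for t :: real and \<omega> :: "(real \<Rightarrow> real) \<times> (real \<Rightarrow> real)"
  interpret PG: prob_space PG by (rule PG)
  interpret PY: prob_space PY by (rule PY)
  interpret P: pair_prob_space PG PY ..
  have N: "prob_space N" unfolding N_def by (rule P.prob_space_axioms)
  interpret N: prob_space N by (rule N)
  have Gm: "G t \<in> borel_measurable N" and Ym: "Y t \<in> borel_measurable N" if "0 \<le> t" for t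
    unfolding N_def G_def[abs_def] Y_def[abs_def]
    using measurable_compose[OF measurable_fst coordG[OF that]] measurable_compose[OF measurable_snd coordY[OF that]] by auto
  \<comment> \<open>Independent frequencies u and v on the two components: u = 0 or v = 0 gives the
    marginals, and u = v gives the sum.\<close>
  have charN: "(\<integral>\<omega>. iexp ((\<Sum>i\<in>I. u i * G (t i) \<omega>) + (\<Sum>i\<in>I. v i * Y (t i) \<omega>)) \<partial>N)
    = of_real (exp (- Q I t u / 2)) * (\<phi>X I t v * of_real (exp (Q I t v / 2)))"
    if I: "finite I" "\<And>i. i \<in> I \<Longrightarrow> 0 \<le> t i" for I t u v
  proof -
    have "(\<integral>\<omega>. iexp ((\<Sum>i\<in>I. u i * G (t i) \<omega>) + (\<Sum>i\<in>I. v i * Y (t i) \<omega>)) \<partial>N) =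
      (\<integral>\<omega>. iexp (\<Sum>i\<in>I. u i * \<omega> (t i)) \<partial>PG) * (\<integral>\<omega>. iexp (\<Sum>i\<in>I. v i * \<omega> (t i)) \<partial>PY)"
      unfolding N_def G_def Y_def
      by (rule P.integral_iexp_product) (use I coordG coordY in \<open>auto intro!: borel_measurable_linear_comb\<close>)
    then show ?thesis by (simp only: charG[OF I] charY[OF I])
  qed
  have charNG: "(\<integral>\<omega>. iexp (\<Sum>i\<in>I. u i * G (t i) \<omega>) \<partial>N) = of_real (exp (- Q I t u / 2))"
    if I: "finite I" "\<And>i. i \<in> I \<Longrightarrow> 0 \<le> t i" for I t u
    using charN[of I t u "\<lambda>_. 0", OF I] by (simp add: \<phi>X_def M.prob_space Q_def)
  have charNY: "(\<integral>\<omega>. iexp (\<Sum>i\<in>I. u i * Y (t i) \<omega>) \<partial>N) = \<phi>X I t u * of_real (exp (Q I t u / 2))"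
    if I: "finite I" "\<And>i. i \<in> I \<Longrightarrow> 0 \<le> t i" for I t u
    using charN[of I t "\<lambda>_. 0" u, OF I] by (simp add: Q_def)
  have Q0: "0 \<le> Q I t u" if "finite I" "\<And>i. i \<in> I \<Longrightarrow> 0 \<le> t i" for I t u
    unfolding Q_def C_def by (rule qform_gauss_cov_nonneg[OF ts that])

  have scale: "C (u * t) (u * s) = u * C t s" if "0 \<le> t" "0 \<le> s" "0 \<le> u" for t s u
    unfolding C_def by (rule gauss_cov_scale[OF ts that])

  have gp: "centred_gaussian_process N G C"
    unfolding centred_gaussian_process_def
  proof (intro conjI allI impI N Gm)
    fix k :: nat and t u :: "nat \<Rightarrow> real" assume t: "\<forall>i<k. 0 \<le> t i"
    have q: "(\<Sum>i<k. \<Sum>j<k. u i * u j * C (t i) (t j)) = Q {..<k} t u" by (simp add: Q_def)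
    have Qk: "0 \<le> Q {..<k} t u" using t by (intro Q0) auto
    have Zm: "(\<lambda>\<omega>. \<Sum>i<k. u i * G (t i) \<omega>) \<in> borel_measurable N"
      using t Gm by (intro borel_measurable_linear_comb) auto
    show "distr N borel (\<lambda>\<omega>. \<Sum>i<k. u i * G (t i) \<omega>) = centred_normal (\<Sum>i<k. \<Sum>j<k. u i * u j * C (t i) (t j))"
      unfolding q
    proof (rule Levy_uniqueness[OF N.real_distribution_distr[OF Zm] real_distribution_centred_normal[OF Qk]], rule ext)
      fix r
      have "char (distr N borel (\<lambda>\<omega>. \<Sum>i<k. u i * G (t i) \<omega>)) r = (\<integral>\<omega>. iexp (\<Sum>i<k. (r * u i) * G (t i) \<omega>) \<partial>N)"
        unfolding char_def using Zm by (subst integral_distr) (auto simp: sum_distrib_left mult.assoc)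
      also have "\<dots> = of_real (exp (- Q {..<k} t (\<lambda>i. r * u i) / 2))"
        using t by (intro charNG) auto
      also have "Q {..<k} t (\<lambda>i. r * u i) = r * r * Q {..<k} t u"
        by (simp add: Q_def sum_distrib_left mult_ac)
      finally show "char (distr N borel (\<lambda>\<omega>. \<Sum>i<k. u i * G (t i) \<omega>)) r = char (centred_normal (Q {..<k} t u)) r"
        unfolding char_centred_normal[OF Qk] .
    qed
  qed

  have sc: "stoch_continuous N Y"
  proof (rule stoch_continuousI_char[OF N Ym])
    fix t r :: real and s :: "nat \<Rightarrow> real" assume t: "0 \<le> t" and s: "\<And>n. 0 \<le> s n" "s \<longlonglongrightarrow> t"
    \<comment> \<open>The increment over s n and t as a linear form in two indexed times with
      frequencies r and -r; equality of the two times is allowed.\<close>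
    define tt where "tt n i = (if i = (0::nat) then s n else t)" for n i
    define u where "u i = (if i = (0::nat) then r else - r)" for i
    have tt0: "0 \<le> tt n i" for n i using t s by (simp add: tt_def)
    have f01: "finite {0,1::nat}" by simp
    let ?I = "{0,1::nat}"
    have "(\<lambda>n. \<phi>X ?I (tt n) u) \<longlonglongrightarrow> (\<integral>\<omega>. iexp (\<Sum>i\<in>?I. u i * X t \<omega>) \<partial>M)"
      unfolding \<phi>X_def
      by (rule stoch_continuous_linear_iexp[OF M.prob_space_axioms Xm time_stableD(3)[OF ts] f01])
         (use t s in \<open>auto simp: tt_def\<close>)
    then have lim: "(\<lambda>n. \<phi>X ?I (tt n) u) \<longlonglongrightarrow> 1" by (simp add: u_def M.prob_space)
    have cY: "(\<integral>\<omega>. iexp (r * (Y (s n) \<omega> - Y t \<omega>)) \<partial>N) = \<phi>X ?I (tt n) u * of_real (exp (Q ?I (tt n) u / 2))" for n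
      using charNY[of ?I "tt n" u, OF f01 tt0] by (simp add: u_def tt_def right_diff_distrib)
    \<comment> \<open>The bound is read off from Y: its increments have a characteristic function of
      modulus at most 1. As \<phi>X tends to 1, this squeezes exp(-Q/2) to 1.\<close>
    have lower: "norm (\<phi>X ?I (tt n) u) \<le> exp (- Q ?I (tt n) u / 2)" for n
    proof -
      have "norm (\<integral>\<omega>. iexp (r * (Y (s n) \<omega> - Y t \<omega>)) \<partial>N) \<le> 1"
        using Ym[OF s(1), of n] Ym[OF t] by (intro N.norm_integral_iexp_le_1) simp
      then have "norm (\<phi>X ?I (tt n) u) * exp (Q ?I (tt n) u / 2) \<le> 1"
        unfolding cY by (simp add: norm_mult del: of_real_exp)
      then show ?thesis by (simp add: exp_minus field_simps)
    qed
    have "(\<lambda>n. exp (- Q ?I (tt n) u / 2)) \<longlonglongrightarrow> 1"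
    proof (rule tendsto_sandwich[of "\<lambda>n. norm (\<phi>X ?I (tt n) u)" _ _ "\<lambda>_. 1"])
      show "(\<lambda>n. norm (\<phi>X ?I (tt n) u)) \<longlonglongrightarrow> 1" using tendsto_norm[OF lim] by simp
      show "\<forall>\<^sub>F n in sequentially. exp (- Q ?I (tt n) u / 2) \<le> 1" using Q0[OF f01 tt0] by simp
    qed (use lower in auto)
    from tendsto_inverse[OF this] have "(\<lambda>n. exp (Q ?I (tt n) u / 2)) \<longlonglongrightarrow> 1"
      by (simp add: exp_minus[symmetric])
    from tendsto_mult[OF lim tendsto_of_real[OF this]]
    show "(\<lambda>n. \<integral>\<omega>. iexp (r * (Y (s n) \<omega> - Y t \<omega>)) \<partial>N) \<longlonglongrightarrow> 1"
      unfolding cY by simp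
  qed

  have tsY: "time_stable N Y"
    unfolding time_stable_def
  proof (intro conjI allI impI N Ym sc)
    fix n k :: nat and t :: "nat \<Rightarrow> real" assume n: "2 \<le> n" and t: "\<forall>i<k. 0 \<le> t i"
    let ?NN = "PiM {..<n} (\<lambda>_. N)"
    interpret NN: prob_space ?NN by (rule prob_space_PiM) (rule N)
    have Sm: "(\<lambda>\<omega>. \<Sum>j<n. Y (t i) (\<omega> j)) \<in> borel_measurable ?NN" if "i \<in> {..<k}" for i
      using t that by (intro borel_measurable_iid_sum Ym) auto
    have Ynm: "Y (real n * t i) \<in> borel_measurable N" if "i \<in> {..<k}" for i
      using t that by (intro Ym) auto
    show "fdd ?NN (\<lambda>t \<omega>. \<Sum>j<n. Y t (\<omega> j)) k t = fdd N Y k (\<lambda>i. real n * t i)"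
      unfolding fdd_def
    proof (rule mchar_unique[of "{..<k}"])
      show "prob_space (distr ?NN (PiM {..<k} (\<lambda>_. borel)) (\<lambda>\<omega>. \<lambda>i\<in>{..<k}. \<Sum>j<n. Y (t i) (\<omega> j)))"
        by (intro NN.prob_space_distr measurable_restrict Sm)
      show "prob_space (distr N (PiM {..<k} (\<lambda>_. borel)) (\<lambda>\<omega>. \<lambda>i\<in>{..<k}. Y (real n * t i) \<omega>))"
        by (intro N.prob_space_distr measurable_restrict Ynm)
      fix u
      have "mchar {..<k} (distr ?NN (PiM {..<k} (\<lambda>_. borel)) (\<lambda>\<omega>. \<lambda>i\<in>{..<k}. \<Sum>j<n. Y (t i) (\<omega> j))) u
        = (\<integral>\<omega>. iexp (\<Sum>i<k. u i * (\<Sum>j<n. Y (t i) (\<omega> j))) \<partial>?NN)"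
        by (rule mchar_distr) (rule Sm)
      also have "\<dots> = (\<integral>\<omega>. iexp (\<Sum>j<n. \<Sum>i<k. u i * Y (t i) (\<omega> j)) \<partial>?NN)"
        by (subst sum.swap) (simp add: sum_distrib_left)
      also have "\<dots> = (\<integral>\<omega>. iexp (\<Sum>i<k. u i * Y (t i) \<omega>) \<partial>N) ^ n"
        using t by (intro N.integral_iexp_iid_sum borel_measurable_linear_comb Ym) auto
      also have "\<dots> = (\<phi>X {..<k} t u * of_real (exp (Q {..<k} t u / 2))) ^ n"
        using t by (subst charNY) auto
      also have "\<dots> = \<phi>X {..<k} t u ^ n * of_real (exp (real n * (Q {..<k} t u / 2)))"
        by (simp only: power_mult_distrib exp_of_nat_mult of_real_power)
      also have "\<phi>X {..<k} t u ^ n = \<phi>X {..<k} (\<lambda>i. real n * t i) u"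
        unfolding \<phi>X_def using t n by (intro time_stable_char_power[OF ts, symmetric]) auto
      \<comment> \<open>The scaling of C makes Q homogeneous of degree 1 in time, so the correction
        factor exp(Q/2) obeys the same power rule as \<phi>X.\<close>
      also have "real n * (Q {..<k} t u / 2) = Q {..<k} (\<lambda>i. real n * t i) u / 2"
      proof -
        have "Q {..<k} (\<lambda>i. real n * t i) u = (\<Sum>i<k. \<Sum>j<k. real n * (u i * u j * C (t i) (t j)))"
          unfolding Q_def using t by (intro sum.cong refl) (simp add: scale)
        then show ?thesis by (simp add: Q_def sum_distrib_left)
      qed
      also have "\<phi>X {..<k} (\<lambda>i. real n * t i) u * of_real (exp (Q {..<k} (\<lambda>i. real n * t i) u / 2))
        = (\<integral>\<omega>. iexp (\<Sum>i<k. u i * Y (real n * t i) \<omega>) \<partial>N)"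
        using t by (subst charNY[of "{..<k}" "\<lambda>i. real n * t i"]) auto
      also have "\<dots> = mchar {..<k} (distr N (PiM {..<k} (\<lambda>_. borel)) (\<lambda>\<omega>. \<lambda>i\<in>{..<k}. Y (real n * t i) \<omega>)) u"
        by (rule mchar_distr[symmetric]) (rule Ynm)
      finally show "mchar {..<k} (distr ?NN (PiM {..<k} (\<lambda>_. borel)) (\<lambda>\<omega>. \<lambda>i\<in>{..<k}. \<Sum>j<n. Y (t i) (\<omega> j))) u
        = mchar {..<k} (distr N (PiM {..<k} (\<lambda>_. borel)) (\<lambda>\<omega>. \<lambda>i\<in>{..<k}. Y (real n * t i) \<omega>)) u" .
    qed auto
  qed

  have ng: "no_gaussian_component N Y"
    unfolding no_gaussian_component_def
  proof (intro allI impI)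
    fix k :: nat and t :: "nat \<Rightarrow> real" assume t: "\<forall>i<k. 0 \<le> t i"
    then have t': "\<And>i. i \<in> {..<k} \<Longrightarrow> 0 \<le> t i" by auto
    \<comment> \<open>The drift and the Levy measure found for X at these times serve for Y as well;
      only the Gaussian factor is cancelled.\<close>
    obtain b :: "nat \<Rightarrow> real" and \<nu> where \<nu>: "levy_meas {..<k} \<nu>" and
      eq0: "\<And>u. (\<integral>\<omega>. iexp (\<Sum>i<k. u i * X (t i) \<omega>) \<partial>M) =
        exp (\<i> * of_real (\<Sum>i<k. b i * u i) + (\<integral>x. lk_integrand {..<k} u x \<partial>\<nu>))
          * of_real (exp (- qform {..<k} (\<lambda>i j. gauss_cov M X (t i) (t j)) u / 2))"
      by (rule time_stable_decomposition[OF ts finite_lessThan t']) (assumption, rule that)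
    have eq: "\<phi>X {..<k} t u = exp (\<i> * of_real (\<Sum>i<k. b i * u i) + (\<integral>x. lk_integrand {..<k} u x \<partial>\<nu>)) * of_real (exp (- Q {..<k} t u / 2))" for u
      unfolding \<phi>X_def Q_def C_def by (rule eq0)
    show "id_no_gaussian_part k (fdd N Y k t)"
      unfolding id_no_gaussian_part_def levy_measure_levy_meas lk_integrand_lessThan[symmetric]
    proof (intro exI conjI allI)
      show "levy_meas {..<k} \<nu>" by (rule \<nu>)
      fix u
      have "charv k (fdd N Y k t) u = mchar {..<k} (fdd N Y k t) u" by (simp add: charv_def mchar_def)
      also have "\<dots> = (\<integral>\<omega>. iexp (\<Sum>i<k. u i * Y (t i) \<omega>) \<partial>N)"
        unfolding fdd_def by (rule mchar_distr) (use t' Ym in auto)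
      also have "\<dots> = \<phi>X {..<k} t u * of_real (exp (Q {..<k} t u / 2))"
        by (rule charNY) (use t' in auto)
      also have "\<dots> = exp (\<i> * of_real (\<Sum>i<k. b i * u i) + (\<integral>x. lk_integrand {..<k} u x \<partial>\<nu>))"
      proof -
        have "complex_of_real (exp (- q / 2)) * of_real (exp (q / 2)) = 1" for q
          by (simp flip: of_real_mult exp_add)
        then show ?thesis unfolding eq by (simp only: mult.assoc mult_1_right)
      qed
      finally show "charv k (fdd N Y k t) u = exp (\<i> * complex_of_real (\<Sum>i<k. b i * u i) + (\<integral>x. lk_integrand {..<k} u x \<partial>\<nu>))" .
    qed
  qed

  have ind: "prob_space.indep_var N
      (PiM {0..} (\<lambda>_. borel)) (\<lambda>\<omega>. \<lambda>t\<in>{0..}. G t \<omega>) (PiM {0..} (\<lambda>_. borel)) (\<lambda>\<omega>. \<lambda>t\<in>{0..}. Y t \<omega>)"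
  proof -
    let ?T = "PiM {0..} (\<lambda>_. borel) :: (real \<Rightarrow> real) measure"
    have rG: "(\<lambda>\<omega>. \<lambda>t\<in>{0..}. G t \<omega>) \<in> measurable N ?T" by (intro measurable_restrict Gm) auto
    have rY: "(\<lambda>\<omega>. \<lambda>t\<in>{0..}. Y t \<omega>) \<in> measurable N ?T" by (intro measurable_restrict Ym) auto
    have sN: "sets N = sets (?T \<Otimes>\<^sub>M ?T)" unfolding N_def by (intro sets_pair_measure_cong PG PY)
    \<comment> \<open>Points of the product space are extensional, so restricting the coordinate
      process returns the point itself. The joint law of the two paths is thus N, the product of its
      marginals, which is the criterion for independence.\<close>
    have ext: "restrict f {0..} = f" if "f \<in> space ?T" for f :: "real \<Rightarrow> real"
      using that by (simp add: space_PiM PiE_def extensional_restrict)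
    have sp: "fst \<omega> \<in> space ?T" "snd \<omega> \<in> space ?T" if "\<omega> \<in> space N" for \<omega>
      using that by (auto simp: N_def space_pair_measure sets_eq_imp_space_eq[OF PG(2)] sets_eq_imp_space_eq[OF PY(2)])
    have eG: "(\<lambda>t\<in>{0..}. G t \<omega>) = fst \<omega>" and eY: "(\<lambda>t\<in>{0..}. Y t \<omega>) = snd \<omega>" if "\<omega> \<in> space N" for \<omega>
      using ext[OF sp(1)[OF that]] ext[OF sp(2)[OF that]] by (auto simp: G_def Y_def)
    have "distr N ?T (\<lambda>\<omega>. \<lambda>t\<in>{0..}. G t \<omega>) = distr N PG fst"
      by (rule distr_cong) (simp_all add: PG(2) eG)
    also have "\<dots> = PG" unfolding N_def by (rule PY.distr_pair_fst)
    finally have dG: "distr N ?T (\<lambda>\<omega>. \<lambda>t\<in>{0..}. G t \<omega>) = PG" .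
    have "distr N ?T (\<lambda>\<omega>. \<lambda>t\<in>{0..}. Y t \<omega>) = distr N PY snd"
      by (rule distr_cong) (simp_all add: PY(2) eY)
    also have "\<dots> = PY"
    proof (rule measure_eqI)
      fix A assume "A \<in> sets (distr N PY snd)"
      then have A: "A \<in> sets PY" by simp
      have "emeasure (distr N PY snd) A = emeasure N (space PG \<times> A)"
        unfolding N_def using A sets.sets_into_space[OF A]
        by (subst emeasure_distr) (auto simp: space_pair_measure intro!: arg_cong2[where f=emeasure])
      also have "\<dots> = emeasure PY A"
        unfolding N_def using A by (simp add: PY.emeasure_pair_measure_Times PG.emeasure_space_1)
      finally show "emeasure (distr N PY snd) A = emeasure PY A" .
    qed simp
    finally have dY: "distr N ?T (\<lambda>\<omega>. \<lambda>t\<in>{0..}. Y t \<omega>) = PY" .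
    have "distr N (?T \<Otimes>\<^sub>M ?T) (\<lambda>\<omega>. (\<lambda>t\<in>{0..}. G t \<omega>, \<lambda>t\<in>{0..}. Y t \<omega>)) = distr N N (\<lambda>\<omega>. \<omega>)"
      by (rule distr_cong) (simp_all add: sN eG eY)
    also have "\<dots> = N" by (rule distr_id)
    finally show ?thesis
      unfolding N.indep_var_distribution_eq dG dY using rG rY by (simp add: N_def)
  qed

  have fd: "fdd M X k t = fdd N (\<lambda>t \<omega>. 0 * t + G t \<omega> + Y t \<omega>) k t" if t: "\<forall>i<k. 0 \<le> t i" for k t
  proof -
    have Xk: "X (t i) \<in> borel_measurable M" if "i \<in> {..<k}" for i using that t by (intro Xm) auto
    have Sk: "(\<lambda>\<omega>. G (t i) \<omega> + Y (t i) \<omega>) \<in> borel_measurable N" if "i \<in> {..<k}" for i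
      using that t by (intro borel_measurable_add Gm Ym) auto
    show ?thesis
      unfolding fdd_def mult_zero_left add_0_left
    proof (rule mchar_unique[of "{..<k}"])
      show "prob_space (distr M (PiM {..<k} (\<lambda>_. borel)) (\<lambda>\<omega>. \<lambda>i\<in>{..<k}. X (t i) \<omega>))"
        by (intro M.prob_space_distr measurable_restrict Xk)
      show "prob_space (distr N (PiM {..<k} (\<lambda>_. borel)) (\<lambda>\<omega>. \<lambda>i\<in>{..<k}. G (t i) \<omega> + Y (t i) \<omega>))"
        by (intro N.prob_space_distr measurable_restrict Sk)
      fix u
      have "mchar {..<k} (distr N (PiM {..<k} (\<lambda>_. borel)) (\<lambda>\<omega>. \<lambda>i\<in>{..<k}. G (t i) \<omega> + Y (t i) \<omega>)) u
        = (\<integral>\<omega>. iexp (\<Sum>i<k. u i * (G (t i) \<omega> + Y (t i) \<omega>)) \<partial>N)"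
        by (rule mchar_distr) (rule Sk)
      also have "\<dots> = (\<integral>\<omega>. iexp ((\<Sum>i<k. u i * G (t i) \<omega>) + (\<Sum>i<k. u i * Y (t i) \<omega>)) \<partial>N)"
        by (simp only: distrib_left sum.distrib)
      also have "\<dots> = of_real (exp (- Q {..<k} t u / 2)) * (\<phi>X {..<k} t u * of_real (exp (Q {..<k} t u / 2)))"
        by (rule charN) (use t in auto)
      also have "\<dots> = \<phi>X {..<k} t u"
        by (simp add: exp_minus)
      also have "\<dots> = mchar {..<k} (distr M (PiM {..<k} (\<lambda>_. borel)) (\<lambda>\<omega>. \<lambda>i\<in>{..<k}. X (t i) \<omega>)) u"
        unfolding \<phi>X_def by (rule mchar_distr[symmetric]) (rule Xk)
      finally show "mchar {..<k} (distr M (PiM {..<k} (\<lambda>_. borel)) (\<lambda>\<omega>. \<lambda>i\<in>{..<k}. X (t i) \<omega>)) u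
        = mchar {..<k} (distr N (PiM {..<k} (\<lambda>_. borel)) (\<lambda>\<omega>. \<lambda>i\<in>{..<k}. G (t i) \<omega> + Y (t i) \<omega>)) u" by (rule sym)
    qed auto
  qed
  show ?thesis
    by (rule exI[of _ 0], rule exI[of _ C], rule exI[of _ N], rule exI[of _ G], rule exI[of _ Y])
       (intro conjI gp tsY ng ind allI impI scale fd; simp)
qed

end
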